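(* Let $M=(M,J,g,\tilde g)$ be a $2n$-dimensional almost skew-Hermitian manifold with curvature tensor $R$, Ricci tensor $\rho$ and associated Ricci tensor $\tilde\rho$, and let $TM=(TM,H,\hat G)$, $H=(J_1,J_2,J_3)$, be its tangent bundle with the almost hypercomplex pseudo-Hermitian structure derived from the Sasaki metric $\hat g$ as in the context. 1. If $M\in\{\mathcal W_2\oplus\mathcal W_3\}(J)$, then $TM\in\mathcal{AK}(J_1)\cap\{\mathcal W_1\oplus\mathcal W_2\oplus\mathcal W_3\}(J_2)\cap\{\mathcal W_2\oplus\mathcal W_3\}(J_3)$. 2. If $M\in\{\mathcal W_2\oplus\mathcal W_3\}(J)$ and $\rho=\tilde\rho=0$, then $TM\in\mathcal{AK}(J_1)\cap\{\mathcal W_2\oplus\mathcal W_3\}(J_2)\cap\{\mathcal W_2\oplus\mathcal W_3\}(J_3)$. 3. If $M\in\{\mathcal W_2\oplus\mathcal W_3\}(J)$ and $R=0$, then $TM\in\mathcal K(J_1)\cap\{\mathcal W_2\oplus\mathcal W_3\}(J_2)\cap\{\mathcal W_2\oplus\mathcal W_3\}(J_3)$.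
   Context: An almost skew-Hermitian manifold $(M^{2n},J,g,\tilde g)$ is a smooth $2n$-manifold with an almost complex structure $J$ and a pseudo-Riemannian metric $g$ of signature $(n,n)$ with $g(JX,JY)=-g(X,Y)$; $\tilde g=g(\cdot,J\cdot)$. $\nabla$ is the Levi-Civita connection of $g$, $R(X,Y)=[\nabla_X,\nabla_Y]-\nabla_{[X,Y]}$, $R(X,Y,Z,W)=g(R(X,Y)Z,W)$. The Ricci tensor is $\rho(Y,Z)=g^{ij}R(e_i,Y,Z,e_j)$ and the associated Ricci tensor is $\tilde\rho(Y,Z)=g^{ij}R(e_i,Y,Z,Je_j)$, for any basis $\{e_i\}$ of $T_pM$. Lifts: local coordinates $(x^i)$ on $M$ induce coordinates $(x^i,y^i)$ on $TM$, where $(y^i)$ are the components of a tangent vector with respect to $\partial/\partial x^i$. For a vector field $X=X^k\,\partial/\partial x^k$ on $M$, $X^V=X^k\,\partial/\partial y^k$ and $X^H=X^k\,\partial/\partial x^k-y^i\Gamma_{ij}^kX^j\,\partial/\partial y^k$, where $\Gamma_{ij}^k$ are the components of $\nabla$. On $TM$: $J_1X^H=X^V$, $J_1X^V=-X^H$; $J_2X^H=(JX)^V$, $J_2X^V=(JX)^H$; $J_3=J_1\circ J_2$. Sasaki metric: $\hat g(X^H,Y^H)=\hat g(X^V,Y^V)=g(X,Y)$, $\hat g(X^H,Y^V)=0$, with Levi-Civita connection $\hat\nabla$. $\hat G=(\hat g,\hat\Phi,\hat g_2,\hat g_3)$ with $\hat\Phi=\hat g(J_1\cdot,\cdot)$,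 $\hat g_2=\hat g(J_2\cdot,\cdot)$, $\hat g_3=\hat g(J_3\cdot,\cdot)$. The metric $\hat g$ is Hermitian with respect to $J_1$ and skew-Hermitian with respect to $J_2$ and $J_3$. Classes. For an almost complex structure $I$ skew-Hermitian with respect to a metric $h$ with Levi-Civita connection $D$, put $F(x,y,z)=h((D_xI)y,z)$ and define the Lie form $\theta(z)=h^{ij}F(e_i,e_j,z)$. $\{\mathcal W_1\oplus\mathcal W_2\oplus\mathcal W_3\}(I)$ is the class of all almost skew-Hermitian manifolds (no condition on $F$); $\{\mathcal W_2\oplus\mathcal W_3\}(I)$ is determined by $\theta=0$. This is applied with $(h,I)=(g,J)$ on $M$ and $(h,I)=(\hat g,J_2)$ or $(\hat g,J_3)$ on $TM$. For $J_1$, put $F_1(A,B,C)=\hat g((\hat\nabla_AJ_1)B,C)$ and $\theta_1(C)=\hat g^{ij}F_1(e_i,e_j,C)$. $\mathcal{AK}(J_1)$ and $\mathcal K(J_1)$ denote the classes, with respect to $J_1$, of the almost Kähler manifolds and the Kähler manifolds, determined by the conditions $\theta_1=0$ and $F_1=0$, respectively. *)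

theory Defs
  imports "HOL-Analysis.Analysis"
begin

section \<open>Smooth functions on open subsets of coordinate space\<close>

definition pd :: "'d::finite \<Rightarrow> (real^'d \<Rightarrow> real) \<Rightarrow> real^'d \<Rightarrow> real" where
  "pd i f x = frechet_derivative f (at x) (axis i 1)"

text \<open>Both predicates are only meant for open \<open>S\<close>, where \<open>differentiable_on\<close> is ordinary
  differentiability at each point.\<close>

primrec Ck_on :: "nat \<Rightarrow> (real^'d::finite) set \<Rightarrow> (real^'d \<Rightarrow> real) \<Rightarrow> bool" where
  "Ck_on 0 S f \<longleftrightarrow> continuous_on S f"
| "Ck_on (Suc k) S f \<longleftrightarrow> f differentiable_on S \<and> (\<forall>i. Ck_on k S (pd i f))"

definition smooth_on :: "(real^'d::finite) set \<Rightarrow> (real^'d \<Rightarrow> real) \<Rightarrow> bool" where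
  "smooth_on S f \<longleftrightarrow> (\<forall>k. Ck_on k S f)"


section \<open>Smooth manifolds\<close>

text \<open>A manifold is given by an indexed atlas: \<open>cdom M c\<close> is the domain of the chart with index \<open>c\<close>
  and \<open>cmap M c\<close> its coordinate map.  The dimension is \<open>CARD('d)\<close>.  The topology is the one
  induced by the atlas.\<close>

record ('p, 'c, 'd) atlas =
  points :: "'p set"
  charts :: "'c set"
  cdom :: "'c \<Rightarrow> 'p set"
  cmap :: "'c \<Rightarrow> 'p \<Rightarrow> real^'d"

definition cimg :: "('p, 'c, 'd::finite) atlas \<Rightarrow> 'c \<Rightarrow> (real^'d) set" where
  "cimg M c = cmap M c ` cdom M c"

definition transition ::
  "('p, 'c, 'd::finite) atlas \<Rightarrow> 'c \<Rightarrow> 'c \<Rightarrow> real^'d \<Rightarrow> real^'d" where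
  "transition M c c' x = cmap M c' (the_inv_into (cdom M c) (cmap M c) x)"

definition atlas_topology :: "('p, 'c, 'd::finite) atlas \<Rightarrow> 'p topology" where
  "atlas_topology M = topology (\<lambda>W. W \<subseteq> points M \<and>
     (\<forall>c\<in>charts M. open (cmap M c ` (W \<inter> cdom M c))))"

definition smooth_manifold :: "('p, 'c, 'd::finite) atlas \<Rightarrow> bool" where
  "smooth_manifold M \<longleftrightarrow>
     points M = (\<Union>c\<in>charts M. cdom M c) \<and>
     (\<forall>c\<in>charts M. inj_on (cmap M c) (cdom M c)) \<and>
     (\<forall>c\<in>charts M. \<forall>c'\<in>charts M.
        open (cmap M c ` (cdom M c \<inter> cdom M c')) \<and>
        (\<forall>k. smooth_on (cmap M c ` (cdom M c \<inter> cdom M c')) (\<lambda>x. transition M c c' x $ k))) \<and>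
     Hausdorff_space (atlas_topology M) \<and> second_countable (atlas_topology M)"

lemma openin_atlas_topology:
  assumes "\<And>c. c \<in> charts M \<Longrightarrow> inj_on (cmap M c) (cdom M c)"
    and "\<And>c. c \<in> charts M \<Longrightarrow> open (cimg M c)"
  shows "openin (atlas_topology M) W \<longleftrightarrow>
    W \<subseteq> points M \<and> (\<forall>c\<in>charts M. open (cmap M c ` (W \<inter> cdom M c)))"
proof -
  let ?P = "\<lambda>W. W \<subseteq> points M \<and> (\<forall>c\<in>charts M. open (cmap M c ` (W \<inter> cdom M c)))"
  have "istopology ?P"
    unfolding istopology_def
  proof (intro conjI allI impI)
    fix S T assume S: "?P S" and T: "?P T"
    have "cmap M c ` (S \<inter> T \<inter> cdom M c)
        = cmap M c ` (S \<inter> cdom M c) \<inter> cmap M c ` (T \<inter> cdom M c)" if "c \<in> charts M" for c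
      using assms(1)[OF that] by (auto simp: inj_on_def)
    with S T show "S \<inter> T \<subseteq> points M" "\<forall>c\<in>charts M. open (cmap M c ` (S \<inter> T \<inter> cdom M c))"
      by auto
  next
    fix K assume K: "\<forall>S\<in>K. ?P S"
    have eq: "cmap M c ` (\<Union>K \<inter> cdom M c) = (\<Union>S\<in>K. cmap M c ` (S \<inter> cdom M c))" for c
      by auto
    show "\<Union>K \<subseteq> points M" using K by blast
    show "\<forall>c\<in>charts M. open (cmap M c ` (\<Union>K \<inter> cdom M c))"
      unfolding eq using K by blast
  qed
  then show ?thesis
    unfolding atlas_topology_def by (simp add: topology_inverse')
qed


section \<open>Tangent vectors and tensor fields\<close>

text \<open>A tangent vector at \<open>p\<close> is the family of its components with respect to all charts around
  \<open>p\<close>; the value \<open>0\<close> at the other indices makes the representation unique.\<close>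

definition tangent_space ::
  "('p, 'c, 'd::finite) atlas \<Rightarrow> 'p \<Rightarrow> ('c \<Rightarrow> real^'d) set" where
  "tangent_space M p = {v.
     (\<forall>c\<in>charts M. \<forall>c'\<in>charts M. p \<in> cdom M c \<longrightarrow> p \<in> cdom M c' \<longrightarrow>
        v c' = jacobian (transition M c c') (at (cmap M c p)) *v v c) \<and>
     (\<forall>c. \<not> (c \<in> charts M \<and> p \<in> cdom M c) \<longrightarrow> v c = 0)}"

text \<open>Tensor fields of types (0,2) and (1,1) are families of component matrices, one for each
  chart, as functions of the coordinates.  For \<open>g\<close> the entry \<open>g c x $ i $ j\<close> is the component
  \<open>g\<^sub>i\<^sub>j\<close>; for \<open>J\<close> the entry \<open>J c x $ k $ i\<close> is the \<open>k\<close>-th component of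
  the image of the \<open>i\<close>-th coordinate vector.\<close>

type_synonym ('c, 'd) tensor = "'c \<Rightarrow> real^'d \<Rightarrow> real^'d^'d"

definition smooth_components :: "('p, 'c, 'd::finite) atlas \<Rightarrow> ('c, 'd) tensor \<Rightarrow> bool" where
  "smooth_components M T \<longleftrightarrow>
     (\<forall>c\<in>charts M. \<forall>i j. smooth_on (cimg M c) (\<lambda>x. T c x $ i $ j))"

definition tensor_field_02 :: "('p, 'c, 'd::finite) atlas \<Rightarrow> ('c, 'd) tensor \<Rightarrow> bool" where
  "tensor_field_02 M T \<longleftrightarrow> smooth_components M T \<and>
     (\<forall>c\<in>charts M. \<forall>c'\<in>charts M. \<forall>p \<in> cdom M c \<inter> cdom M c'.
        let A = jacobian (transition M c c') (at (cmap M c p))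
        in T c (cmap M c p) = transpose A ** T c' (cmap M c' p) ** A)"

definition tensor_field_11 :: "('p, 'c, 'd::finite) atlas \<Rightarrow> ('c, 'd) tensor \<Rightarrow> bool" where
  "tensor_field_11 M T \<longleftrightarrow> smooth_components M T \<and>
     (\<forall>c\<in>charts M. \<forall>c'\<in>charts M. \<forall>p \<in> cdom M c \<inter> cdom M c'.
        let A = jacobian (transition M c c') (at (cmap M c p))
        in A ** T c (cmap M c p) = T c' (cmap M c' p) ** A)"

definition bil :: "real^'d^'d \<Rightarrow> real^'d \<Rightarrow> real^'d \<Rightarrow> real" where
  "bil G X Y = X \<bullet> (G *v Y)"

definition has_signature :: "nat \<Rightarrow> nat \<Rightarrow> real^'d^'d \<Rightarrow> bool" where
  "has_signature p q G \<longleftrightarrow> (\<exists>(P :: real^'d^'d) S. invertible P \<and> card S = p \<and> card (- S) = q \<and>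
     transpose P ** G ** P = (\<chi> i j. if i = j then (if i \<in> S then 1 else - 1) else 0))"

definition pseudo_riemannian_metric ::
  "nat \<Rightarrow> nat \<Rightarrow> ('p, 'c, 'd::finite) atlas \<Rightarrow> ('c, 'd) tensor \<Rightarrow> bool" where
  "pseudo_riemannian_metric p q M g \<longleftrightarrow> tensor_field_02 M g \<and>
     (\<forall>c\<in>charts M. \<forall>x\<in>cimg M c. transpose (g c x) = g c x \<and> has_signature p q (g c x))"

definition almost_complex_structure ::
  "('p, 'c, 'd::finite) atlas \<Rightarrow> ('c, 'd) tensor \<Rightarrow> bool" where
  "almost_complex_structure M J \<longleftrightarrow> tensor_field_11 M J \<and>
     (\<forall>c\<in>charts M. \<forall>x\<in>cimg M c. J c x ** J c x = - mat 1)"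


section \<open>Levi-Civita connection and curvature in one chart\<close>

text \<open>In this section \<open>g\<close> and \<open>J\<close> are the component functions in one fixed chart, vector
  fields are functions of the coordinates, and vectors at a point are given by their
  components.\<close>

text \<open>\<open>christoffel g x k i j\<close> is \<open>\<Gamma>\<close> with upper index \<open>k\<close> and lower indices \<open>i\<close>, \<open>j\<close>.\<close>

definition christoffel ::
  "(real^'d \<Rightarrow> real^'d^'d::finite) \<Rightarrow> real^'d \<Rightarrow> 'd \<Rightarrow> 'd \<Rightarrow> 'd \<Rightarrow> real" where
  "christoffel g x k i j = 1/2 * (\<Sum>l\<in>UNIV. matrix_inv (g x) $ k $ l *
     (pd i (\<lambda>z. g z $ j $ l) x + pd j (\<lambda>z. g z $ i $ l) x - pd l (\<lambda>z. g z $ i $ j) x))"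

definition nabla ::
  "(real^'d \<Rightarrow> real^'d^'d::finite) \<Rightarrow> (real^'d \<Rightarrow> real^'d) \<Rightarrow> (real^'d \<Rightarrow> real^'d) \<Rightarrow>
   real^'d \<Rightarrow> real^'d" where
  "nabla g X Y x = (\<chi> k. (\<Sum>i\<in>UNIV. X x $ i * pd i (\<lambda>z. Y z $ k) x) +
     (\<Sum>i\<in>UNIV. \<Sum>j\<in>UNIV. christoffel g x k i j * X x $ i * Y x $ j))"

definition lie_bracket ::
  "(real^'d::finite \<Rightarrow> real^'d) \<Rightarrow> (real^'d \<Rightarrow> real^'d) \<Rightarrow> real^'d \<Rightarrow> real^'d" where
  "lie_bracket X Y x = (\<chi> k. \<Sum>i\<in>UNIV.
     X x $ i * pd i (\<lambda>z. Y z $ k) x - Y x $ i * pd i (\<lambda>z. X z $ k) x)"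

definition curvature_op ::
  "(real^'d \<Rightarrow> real^'d^'d::finite) \<Rightarrow> (real^'d \<Rightarrow> real^'d) \<Rightarrow> (real^'d \<Rightarrow> real^'d) \<Rightarrow>
   (real^'d \<Rightarrow> real^'d) \<Rightarrow> real^'d \<Rightarrow> real^'d" where
  "curvature_op g X Y Z x =
     nabla g X (nabla g Y Z) x - nabla g Y (nabla g X Z) x - nabla g (lie_bracket X Y) Z x"

text \<open>The values at \<open>x\<close> of \<open>R\<close> and of \<open>F\<close> below do not depend on how the argument vectors are
  extended to vector fields; they are extended with constant components.\<close>

definition curvature ::
  "(real^'d \<Rightarrow> real^'d^'d::finite) \<Rightarrow> real^'d \<Rightarrow> real^'d \<Rightarrow> real^'d \<Rightarrow> real^'d \<Rightarrow> real^'d \<Rightarrow> real"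
  where
  "curvature g x X Y Z W = bil (g x) (curvature_op g (\<lambda>_. X) (\<lambda>_. Y) (\<lambda>_. Z) x) W"

definition metric_trace :: "real^'d^'d::finite \<Rightarrow> (real^'d \<Rightarrow> real^'d \<Rightarrow> real) \<Rightarrow> real" where
  "metric_trace G T = (\<Sum>i\<in>UNIV. \<Sum>j\<in>UNIV. matrix_inv G $ i $ j * T (axis i 1) (axis j 1))"

definition ricci ::
  "(real^'d \<Rightarrow> real^'d^'d::finite) \<Rightarrow> real^'d \<Rightarrow> real^'d \<Rightarrow> real^'d \<Rightarrow> real" where
  "ricci g x Y Z = metric_trace (g x) (\<lambda>e e'. curvature g x e Y Z e')"

definition assoc_ricci ::
  "(real^'d \<Rightarrow> real^'d^'d::finite) \<Rightarrow> (real^'d \<Rightarrow> real^'d^'d) \<Rightarrow>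
   real^'d \<Rightarrow> real^'d \<Rightarrow> real^'d \<Rightarrow> real" where
  "assoc_ricci g J x Y Z = metric_trace (g x) (\<lambda>e e'. curvature g x e Y Z (J x *v e'))"

definition nabla_endo ::
  "(real^'d \<Rightarrow> real^'d^'d::finite) \<Rightarrow> (real^'d \<Rightarrow> real^'d^'d) \<Rightarrow>
   (real^'d \<Rightarrow> real^'d) \<Rightarrow> (real^'d \<Rightarrow> real^'d) \<Rightarrow> real^'d \<Rightarrow> real^'d" where
  "nabla_endo g J X Y x = nabla g X (\<lambda>z. J z *v Y z) x - J x *v nabla g X Y x"

definition fundamental_F ::
  "(real^'d \<Rightarrow> real^'d^'d::finite) \<Rightarrow> (real^'d \<Rightarrow> real^'d^'d) \<Rightarrow>
   real^'d \<Rightarrow> real^'d \<Rightarrow> real^'d \<Rightarrow> real^'d \<Rightarrow> real" where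
  "fundamental_F g J x X Y Z = bil (g x) (nabla_endo g J (\<lambda>_. X) (\<lambda>_. Y) x) Z"

definition lie_form ::
  "(real^'d \<Rightarrow> real^'d^'d::finite) \<Rightarrow> (real^'d \<Rightarrow> real^'d^'d) \<Rightarrow> real^'d \<Rightarrow> real^'d \<Rightarrow> real"
  where
  "lie_form g J x Z = metric_trace (g x) (\<lambda>e e'. fundamental_F g J x e e' Z)"


section \<open>Classes of manifolds\<close>

text \<open>In the first predicate \<open>gt\<close> is the associated metric, in the second one \<open>\<Phi>\<close> is the
  fundamental 2-form.  The metric is neutral in both cases.\<close>

definition almost_skew_hermitian ::
  "nat \<Rightarrow> ('p, 'c, 'd::finite) atlas \<Rightarrow> ('c, 'd) tensor \<Rightarrow> ('c, 'd) tensor \<Rightarrow> ('c, 'd) tensor \<Rightarrow> bool"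
  where
  "almost_skew_hermitian n M J g gt \<longleftrightarrow>
     smooth_manifold M \<and> CARD('d) = 2 * n \<and>
     almost_complex_structure M J \<and> pseudo_riemannian_metric n n M g \<and>
     (\<forall>c\<in>charts M. \<forall>x\<in>cimg M c. \<forall>X Y.
        bil (g c x) (J c x *v X) (J c x *v Y) = - bil (g c x) X Y \<and>
        bil (gt c x) X Y = bil (g c x) X (J c x *v Y))"

definition almost_pseudo_hermitian ::
  "nat \<Rightarrow> ('p, 'c, 'd::finite) atlas \<Rightarrow> ('c, 'd) tensor \<Rightarrow> ('c, 'd) tensor \<Rightarrow> ('c, 'd) tensor \<Rightarrow> bool"
  where
  "almost_pseudo_hermitian n M J g \<Phi> \<longleftrightarrow>
     smooth_manifold M \<and> CARD('d) = 2 * n \<and>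
     almost_complex_structure M J \<and> pseudo_riemannian_metric n n M g \<and>
     (\<forall>c\<in>charts M. \<forall>x\<in>cimg M c. \<forall>X Y.
        bil (g c x) (J c x *v X) (J c x *v Y) = bil (g c x) X Y \<and>
        bil (\<Phi> c x) X Y = bil (g c x) (J c x *v X) Y)"

definition class_W123 ::
  "nat \<Rightarrow> ('p, 'c, 'd::finite) atlas \<Rightarrow> ('c, 'd) tensor \<Rightarrow> ('c, 'd) tensor \<Rightarrow> ('c, 'd) tensor \<Rightarrow> bool"
  where
  "class_W123 n M J g gt \<longleftrightarrow> almost_skew_hermitian n M J g gt"

definition class_W23 ::
  "nat \<Rightarrow> ('p, 'c, 'd::finite) atlas \<Rightarrow> ('c, 'd) tensor \<Rightarrow> ('c, 'd) tensor \<Rightarrow> ('c, 'd) tensor \<Rightarrow> bool"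
  where
  "class_W23 n M J g gt \<longleftrightarrow> almost_skew_hermitian n M J g gt \<and>
     (\<forall>c\<in>charts M. \<forall>x\<in>cimg M c. \<forall>Z. lie_form (g c) (J c) x Z = 0)"

definition class_AK ::
  "nat \<Rightarrow> ('p, 'c, 'd::finite) atlas \<Rightarrow> ('c, 'd) tensor \<Rightarrow> ('c, 'd) tensor \<Rightarrow> ('c, 'd) tensor \<Rightarrow> bool"
  where
  "class_AK n M J g \<Phi> \<longleftrightarrow> almost_pseudo_hermitian n M J g \<Phi> \<and>
     (\<forall>c\<in>charts M. \<forall>x\<in>cimg M c. \<forall>Z. lie_form (g c) (J c) x Z = 0)"

definition class_K ::
  "nat \<Rightarrow> ('p, 'c, 'd::finite) atlas \<Rightarrow> ('c, 'd) tensor \<Rightarrow> ('c, 'd) tensor \<Rightarrow> ('c, 'd) tensor \<Rightarrow> bool"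
  where
  "class_K n M J g \<Phi> \<longleftrightarrow> almost_pseudo_hermitian n M J g \<Phi> \<and>
     (\<forall>c\<in>charts M. \<forall>x\<in>cimg M c. \<forall>X Y Z. fundamental_F (g c) (J c) x X Y Z = 0)"

definition flat :: "('p, 'c, 'd::finite) atlas \<Rightarrow> ('c, 'd) tensor \<Rightarrow> bool" where
  "flat M g \<longleftrightarrow>
     (\<forall>c\<in>charts M. \<forall>x\<in>cimg M c. \<forall>X Y Z W. curvature (g c) x X Y Z W = 0)"

definition ricci_flat :: "('p, 'c, 'd::finite) atlas \<Rightarrow> ('c, 'd) tensor \<Rightarrow> bool" where
  "ricci_flat M g \<longleftrightarrow>
     (\<forall>c\<in>charts M. \<forall>x\<in>cimg M c. \<forall>Y Z. ricci (g c) x Y Z = 0)"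

definition assoc_ricci_flat ::
  "('p, 'c, 'd::finite) atlas \<Rightarrow> ('c, 'd) tensor \<Rightarrow> ('c, 'd) tensor \<Rightarrow> bool" where
  "assoc_ricci_flat M g J \<longleftrightarrow>
     (\<forall>c\<in>charts M. \<forall>x\<in>cimg M c. \<forall>Y Z. assoc_ricci (g c) (J c) x Y Z = 0)"


section \<open>The tangent bundle\<close>

text \<open>The index type \<open>'d + 'd\<close> holds the indices of the coordinates \<open>x\<close> (\<open>Inl\<close>) and \<open>y\<close>
  (\<open>Inr\<close>).  Each chart of the base induces one chart of the tangent bundle, with the same index.\<close>

definition join :: "real^'d \<Rightarrow> real^'d \<Rightarrow> real^('d::finite + 'd)" where
  "join x y = (\<chi> k. case k of Inl i \<Rightarrow> x $ i | Inr i \<Rightarrow> y $ i)"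

definition xpart :: "real^('d::finite + 'd) \<Rightarrow> real^'d" where
  "xpart w = (\<chi> i. w $ Inl i)"

definition ypart :: "real^('d::finite + 'd) \<Rightarrow> real^'d" where
  "ypart w = (\<chi> i. w $ Inr i)"

definition tangent_bundle ::
  "('p, 'c, 'd::finite) atlas \<Rightarrow> ('p \<times> ('c \<Rightarrow> real^'d), 'c, 'd + 'd) atlas" where
  "tangent_bundle M =
     \<lparr>points = Sigma (points M) (tangent_space M),
      charts = charts M,
      cdom = (\<lambda>c. Sigma (cdom M c) (tangent_space M)),
      cmap = (\<lambda>c (p, v). join (cmap M c p) (v c))\<rparr>"

text \<open>Below, \<open>w\<close> are the coordinates of a point of the tangent bundle.  \<open>vert\<close> and \<open>horiz\<close> are the
  lifts to \<open>w\<close> of a vector of the base at \<open>xpart w\<close>.\<close>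

definition vert :: "real^'d \<Rightarrow> real^('d::finite + 'd)" where
  "vert X = join 0 X"

definition Gamma_y ::
  "(real^'d \<Rightarrow> real^'d^'d::finite) \<Rightarrow> real^('d + 'd) \<Rightarrow> real^'d \<Rightarrow> real^'d" where
  "Gamma_y g w X =
     (\<chi> k. \<Sum>i\<in>UNIV. \<Sum>j\<in>UNIV. ypart w $ i * christoffel g (xpart w) k i j * X $ j)"

definition horiz ::
  "(real^'d \<Rightarrow> real^'d^'d::finite) \<Rightarrow> real^('d + 'd) \<Rightarrow> real^'d \<Rightarrow> real^('d + 'd)" where
  "horiz g w X = join X (- Gamma_y g w X)"

text \<open>Every tangent vector \<open>A\<close> at \<open>w\<close> is uniquely the horizontal lift of \<open>hcomp A\<close> plus the vertical
  lift of \<open>vcomp g w A\<close> (lemma \<open>horiz_vert_decomp\<close>).\<close>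

definition hcomp :: "real^('d::finite + 'd) \<Rightarrow> real^'d" where
  "hcomp A = xpart A"

definition vcomp ::
  "(real^'d \<Rightarrow> real^'d^'d::finite) \<Rightarrow> real^('d + 'd) \<Rightarrow> real^('d + 'd) \<Rightarrow> real^'d" where
  "vcomp g w A = ypart A + Gamma_y g w (xpart A)"

definition J1_hat :: "('c, 'd::finite) tensor \<Rightarrow> ('c, 'd + 'd) tensor" where
  "J1_hat g c w = matrix (\<lambda>A. vert (hcomp A) - horiz (g c) w (vcomp (g c) w A))"

definition J2_hat :: "('c, 'd::finite) tensor \<Rightarrow> ('c, 'd) tensor \<Rightarrow> ('c, 'd + 'd) tensor" where
  "J2_hat g J c w = matrix (\<lambda>A. vert (J c (xpart w) *v hcomp A)
     + horiz (g c) w (J c (xpart w) *v vcomp (g c) w A))"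

definition J3_hat :: "('c, 'd::finite) tensor \<Rightarrow> ('c, 'd) tensor \<Rightarrow> ('c, 'd + 'd) tensor" where
  "J3_hat g J c w = J1_hat g c w ** J2_hat g J c w"

definition sasaki :: "('c, 'd::finite) tensor \<Rightarrow> ('c, 'd + 'd) tensor" where
  "sasaki g c w = (\<chi> a b.
     bil (g c (xpart w)) (hcomp (axis a 1)) (hcomp (axis b 1)) +
     bil (g c (xpart w)) (vcomp (g c) w (axis a 1)) (vcomp (g c) w (axis b 1)))"

text \<open>The (0,2)-tensor field \<open>h(I\<cdot>,\<cdot>)\<close>.\<close>

definition lower :: "('c, 'd::finite) tensor \<Rightarrow> ('c, 'd) tensor \<Rightarrow> ('c, 'd) tensor" where
  "lower h I c w = transpose (I c w) ** h c w"

definition Phi_hat :: "('c, 'd::finite) tensor \<Rightarrow> ('c, 'd + 'd) tensor" where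
  "Phi_hat g = lower (sasaki g) (J1_hat g)"

definition g2_hat :: "('c, 'd::finite) tensor \<Rightarrow> ('c, 'd) tensor \<Rightarrow> ('c, 'd + 'd) tensor" where
  "g2_hat g J = lower (sasaki g) (J2_hat g J)"

definition g3_hat :: "('c, 'd::finite) tensor \<Rightarrow> ('c, 'd) tensor \<Rightarrow> ('c, 'd + 'd) tensor" where
  "g3_hat g J = lower (sasaki g) (J3_hat g J)"


subsection \<open>The defining equations on lifts\<close>

lemma join_simps [simp]:
  "xpart (join x y) = x" "ypart (join x y) = y" "join (xpart w) (ypart w) = w"
  "join x y + join x' y' = join (x + x') (y + y')" "r *\<^sub>R join x y = join (r *\<^sub>R x) (r *\<^sub>R y)"
  "- join x y = join (- x) (- y)"
  by (auto simp: xpart_def ypart_def join_def vec_eq_iff split: sum.split)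

lemma part_simps [simp]:
  "xpart (w + w') = xpart w + xpart w'" "ypart (w + w') = ypart w + ypart w'"
  "xpart (r *\<^sub>R w) = r *\<^sub>R xpart w" "ypart (r *\<^sub>R w) = r *\<^sub>R ypart w"
  by (auto simp: xpart_def ypart_def vec_eq_iff)

lemma linear_Gamma_y: "linear (Gamma_y g w)"
  by (rule linearI)
     (simp_all add: Gamma_y_def vec_eq_iff algebra_simps sum.distrib sum_distrib_left)

lemma linear_vert: "linear vert"
  by (rule linearI) (simp_all add: vert_def)

lemma linear_horiz: "linear (horiz g w)"
  by (rule linearI)
     (simp_all add: horiz_def linear_add[OF linear_Gamma_y] linear_cmul[OF linear_Gamma_y])

lemma linear_hcomp: "linear hcomp"
  by (rule linearI) (simp_all add: hcomp_def)

lemma linear_vcomp: "linear (vcomp g w)"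
  by (rule linearI) (simp_all add: vcomp_def linear_add[OF linear_Gamma_y]
      linear_cmul[OF linear_Gamma_y] algebra_simps)

lemma comp_lift [simp]:
  "hcomp (horiz g w X) = X" "vcomp g w (horiz g w X) = 0"
  "hcomp (vert X) = 0" "vcomp g w (vert X) = X"
  by (simp_all add: hcomp_def vcomp_def horiz_def vert_def linear_0[OF linear_Gamma_y])

lemma horiz_vert_decomp:
  "A = horiz g w X + vert Y \<longleftrightarrow> X = hcomp A \<and> Y = vcomp g w A"
proof
  assume "A = horiz g w X + vert Y"
  then show "X = hcomp A \<and> Y = vcomp g w A"
    by (simp add: linear_add[OF linear_hcomp] linear_add[OF linear_vcomp])
next
  assume "X = hcomp A \<and> Y = vcomp g w A"
  then show "A = horiz g w X + vert Y"
    by (simp add: horiz_def vert_def hcomp_def vcomp_def)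
qed

lemma J1_hat_apply:
  "J1_hat g c w *v A = vert (hcomp A) - horiz (g c) w (vcomp (g c) w A)"
proof -
  have "linear (\<lambda>A. vert (hcomp A) - horiz (g c) w (vcomp (g c) w A))"
    using linear_compose[OF linear_hcomp linear_vert]
      linear_compose[OF linear_vcomp linear_horiz, of "g c" w "g c" w]
    by (intro linear_compose_sub) (simp_all add: o_def)
  then show ?thesis unfolding J1_hat_def 
    by (rule matrix_works[OF iffD2[OF linear_matrix_vector_mul_eq]])
qed

lemma J2_hat_apply:
  "J2_hat g J c w *v A = vert (J c (xpart w) *v hcomp A)
     + horiz (g c) w (J c (xpart w) *v vcomp (g c) w A)"
proof -
  have J: "linear ((*v) (J c (xpart w)))" by (rule matrix_vector_mul_linear)
  have "linear (\<lambda>A. vert (J c (xpart w) *v hcomp A)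
     + horiz (g c) w (J c (xpart w) *v vcomp (g c) w A))"
    using linear_compose[OF linear_hcomp linear_compose[OF J linear_vert]]
      linear_compose[OF linear_vcomp linear_compose[OF J linear_horiz], of "g c" w "g c" w]
    by (intro linear_compose_add) (simp_all add: o_def)
  then show ?thesis unfolding J2_hat_def 
    by (rule matrix_works[OF iffD2[OF linear_matrix_vector_mul_eq]])
qed

lemma J1_hat_lift:
  "J1_hat g c w *v horiz (g c) w X = vert X"
  "J1_hat g c w *v vert X = - horiz (g c) w X"
  by (simp_all add: J1_hat_apply linear_0[OF linear_vert] linear_0[OF linear_horiz])

lemma J2_hat_lift:
  "J2_hat g J c w *v horiz (g c) w X = vert (J c (xpart w) *v X)"
  "J2_hat g J c w *v vert X = horiz (g c) w (J c (xpart w) *v X)"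
  by (simp_all add: J2_hat_apply linear_0[OF linear_vert] linear_0[OF linear_horiz])

lemma bil_linear:
  "bil G (X + X') Y = bil G X Y + bil G X' Y" "bil G (r *\<^sub>R X) Y = r * bil G X Y"
  "bil G X (Y + Y') = bil G X Y + bil G X Y'" "bil G X (r *\<^sub>R Y) = r * bil G X Y"
  "bil G 0 Y = 0" "bil G X 0 = 0"
  by (simp_all add: bil_def inner_add_left inner_add_right matrix_vector_right_distrib
      matrix_vector_mult_scaleR)

lemma bil_matrix_eqI:
  assumes "bilinear B"
  shows "bil (\<chi> a b. B (axis a 1) (axis b 1)) X Y = B X (Y :: real^'k)"
proof -
  have "B X Y = B (\<Sum>a\<in>UNIV. X $ a *\<^sub>R axis a 1) (\<Sum>b\<in>UNIV. Y $ b *\<^sub>R axis b 1)"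
    by (simp add: basis_expansion flip: scalar_mult_eq_scaleR)
  also have "\<dots> = (\<Sum>a\<in>UNIV. \<Sum>b\<in>UNIV. X $ a * Y $ b * B (axis a 1) (axis b 1))"
    using assms by (simp add: bilinear_sum bilinear_lmul bilinear_rmul sum.cartesian_product
        algebra_simps case_prod_beta)
  also have "\<dots> = bil (\<chi> a b. B (axis a 1) (axis b 1)) X Y"
    by (simp add: bil_def inner_vec_def matrix_vector_mult_def sum_distrib_left algebra_simps)
  finally show ?thesis by simp
qed

lemma sasaki_apply:
  "bil (sasaki g c w) A B = bil (g c (xpart w)) (hcomp A) (hcomp B)
     + bil (g c (xpart w)) (vcomp (g c) w A) (vcomp (g c) w B)"
proof -
  have "bilinear (\<lambda>A B. bil (g c (xpart w)) (hcomp A) (hcomp B)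
     + bil (g c (xpart w)) (vcomp (g c) w A) (vcomp (g c) w B))"
    by (auto simp: bilinear_def bil_linear linear_add[OF linear_hcomp] linear_add[OF linear_vcomp]
        linear_cmul[OF linear_hcomp] linear_cmul[OF linear_vcomp] algebra_simps intro!: linearI)
  from bil_matrix_eqI[OF this] show ?thesis unfolding sasaki_def .
qed

lemma sasaki_lift:
  "bil (sasaki g c w) (horiz (g c) w X) (horiz (g c) w Y) = bil (g c (xpart w)) X Y"
  "bil (sasaki g c w) (vert X) (vert Y) = bil (g c (xpart w)) X Y"
  "bil (sasaki g c w) (horiz (g c) w X) (vert Y) = 0"
  by (simp_all add: sasaki_apply bil_linear)

lemma lower_apply: "bil (lower h I c w) X Y = bil (h c w) (I c w *v X) Y"
  by (simp add: bil_def lower_def dot_lmul_matrix inner_commute flip: matrix_vector_mul_assoc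
      matrix_vector_mul_assoc)
     (metis dot_lmul_matrix inner_commute vector_transpose_matrix)


subsection \<open>The Christoffel symbols are those of the Levi-Civita connection\<close>

lemma pd_cong:
  assumes "open S" "x \<in> S" "\<And>z. z \<in> S \<Longrightarrow> f z = f' z"
  shows "pd i f x = pd i f' x"
proof -
  have "(f has_derivative D) (at x) \<longleftrightarrow> (f' has_derivative D) (at x)" for D
    using assms by (metis has_derivative_transform_within_open)
  then show ?thesis by (simp add: pd_def frechet_derivative_def)
qed

lemma christoffel_iff_torsion_free_metric:
  fixes g :: "real^'d \<Rightarrow> real^'d^'d::finite"
  assumes inv: "invertible (g x)" and S: "open S" "x \<in> S"
    and sym: "\<And>z. z \<in> S \<Longrightarrow> transpose (g z) = g z"
  shows "(\<forall>k i j. G k i j = christoffel g x k i j) \<longleftrightarrow>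
    (\<forall>k i j. G k i j = G k j i) \<and>
    (\<forall>k i j. pd k (\<lambda>z. g z $ i $ j) x =
       (\<Sum>l\<in>UNIV. G l k i * g x $ l $ j) + (\<Sum>l\<in>UNIV. G l k j * g x $ i $ l))"
    (is "?L \<longleftrightarrow> ?T \<and> ?N")
proof -
  have inverse: "g x ** matrix_inv (g x) = mat 1" "matrix_inv (g x) ** g x = mat 1"
    using inv someI_ex[of "\<lambda>A'. g x ** A' = mat 1 \<and> A' ** g x = mat 1"]
    unfolding invertible_def matrix_inv_def by blast+
  define K where "K i j l = 1/2 * (pd i (\<lambda>z. g z $ j $ l) x + pd j (\<lambda>z. g z $ i $ l) x
    - pd l (\<lambda>z. g z $ i $ j) x)" for i j l
  have gs: "g z $ i $ j = g z $ j $ i" if "z \<in> S" for z i j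
    using sym[OF that] by (metis transpose_def vec_lambda_beta)
  have ps: "pd k (\<lambda>z. g z $ i $ j) x = pd k (\<lambda>z. g z $ j $ i) x" for k i j
    by (rule pd_cong[OF S]) (rule gs)
  have chr: "(\<chi> k. christoffel g x k i j) = matrix_inv (g x) *v (\<chi> l. K i j l)" for i j
    by (simp add: vec_eq_iff christoffel_def K_def matrix_vector_mult_def sum_distrib_left
        algebra_simps)
  have "(\<forall>k. G k i j = christoffel g x k i j) \<longleftrightarrow> g x *v (\<chi> k. G k i j) = (\<chi> l. K i j l)" for i j
  proof -
    have "(\<forall>k. G k i j = christoffel g x k i j) \<longleftrightarrow>
      (\<chi> k. G k i j) = matrix_inv (g x) *v (\<chi> l. K i j l)"
      unfolding chr[symmetric] by (simp add: vec_eq_iff)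
    also have "\<dots> \<longleftrightarrow> g x *v (\<chi> k. G k i j) = (\<chi> l. K i j l)"
      using inverse
      by (metis matrix_vector_mul_assoc matrix_vector_mul_lid)
    finally show ?thesis .
  qed
  then have L: "?L \<longleftrightarrow> (\<forall>i j l. (\<Sum>m\<in>UNIV. g x $ l $ m * G m i j) = K i j l)"
    by (simp add: vec_eq_iff matrix_vector_mult_def) blast
  define H where "H l i j = (\<Sum>m\<in>UNIV. g x $ l $ m * G m i j)" for l i j
  have N: "?N \<longleftrightarrow> (\<forall>k i j. pd k (\<lambda>z. g z $ i $ j) x = H j k i + H i k j)"
    unfolding H_def by (simp add: mult.commute gs[OF S(2)])
  have T: "?T \<longleftrightarrow> (\<forall>l i j. H l i j = H l j i)"
  proof
    assume R: "\<forall>l i j. H l i j = H l j i"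
    have "(\<chi> m. G m i j) = (\<chi> m. G m j i)" for i j
    proof -
      have "g x *v (\<chi> m. G m i j) = g x *v (\<chi> m. G m j i)"
        using R by (simp add: vec_eq_iff matrix_vector_mult_def H_def)
      then show ?thesis
        using inverse by (metis matrix_vector_mul_assoc matrix_vector_mul_lid)
    qed
    then show ?T by (simp add: vec_eq_iff)
  qed (simp add: H_def)
  have "(\<forall>i j l. H l i j = K i j l) \<longleftrightarrow> (\<forall>l i j. H l i j = H l j i) \<and>
    (\<forall>k i j. pd k (\<lambda>z. g z $ i $ j) x = H j k i + H i k j)"
  proof safe
    fix l i j assume A: "\<forall>i j l. H l i j = K i j l"
    show "H l i j = H l j i" using A[rule_format, of l i j] A[rule_format, of l j i] ps[of l i j]
      by (simp add: K_def)
  next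
    fix k i j assume A: "\<forall>i j l. H l i j = K i j l"
    show "pd k (\<lambda>z. g z $ i $ j) x = H j k i + H i k j"
      using A[rule_format, of j k i] A[rule_format, of i k j] ps[of k i j]
      by (simp add: K_def)
  next
    fix i j l
    assume A: "\<forall>l i j. H l i j = H l j i"
      and B: "\<forall>k i j. pd k (\<lambda>z. g z $ i $ j) x = H j k i + H i k j"
    have "H j i l = H j l i" "H i j l = H i l j" "H l i j = H l j i" using A by auto
    then show "H l i j = K i j l" by (simp add: K_def B)
  qed
  then show ?thesis using L N T by (simp add: H_def)
qed

end

theory Submission
  imports Defs
begin

text \<open>
  Let \<open>u\<close> be a tangent vector of \<open>M\<close> at \<open>x\<close>, regarded as a point of \<open>TM\<close>.  Every tangent vector of
  \<open>TM\<close> at \<open>u\<close> is a sum of a horizontal and a vertical lift, and in this frame everything can be computed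
  on the base.  The Levi-Civita connection of the Sasaki metric is, at \<open>u\<close>,
  \<^item> \<open>\<nabla>(X\<^sup>H, Y\<^sup>H) = (\<nabla>(X, Y))\<^sup>H - 1/2 (R(X, Y) u)\<^sup>V\<close>,
  \<^item> \<open>\<nabla>(X\<^sup>H, Y\<^sup>V) = (\<nabla>(X, Y))\<^sup>V + 1/2 (R(u, Y) X)\<^sup>H\<close>,
  \<^item> \<open>\<nabla>(X\<^sup>V, Y\<^sup>H) = 1/2 (R(u, X) Y)\<^sup>H\<close> and \<open>\<nabla>(X\<^sup>V, Y\<^sup>V) = 0\<close>,

  where \<open>\<nabla>(A, B)\<close> is the derivative of \<open>B\<close> along \<open>A\<close>.  These formulas define a symmetric connection
  preserving the metric, and there is only one (\<open>levi_civita_unique\<close>, \<open>gamma_sasaki\<close>); the verification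
  uses the symmetries of \<open>R\<close>, in particular \<open>R(X, Y, Z, W) = R(Z, W, X, Y)\<close>.

  Differentiating the three structures in the frame of lifts (\<open>nabla_J1_hat\<close>, \<open>nabla_J2_hat\<close>,
  \<open>nabla_J3_hat\<close>) leaves curvature terms, and for \<open>J\<^sub>2\<close> and \<open>J\<^sub>3\<close> also \<open>\<nabla>J\<close>.  Hence \<open>J\<^sub>1\<close> is parallel if
  \<open>R = 0\<close>.  A trace with respect to the Sasaki metric is the sum of a trace over horizontal and a trace over
  vertical lifts (\<open>metric_trace_sasaki\<close>), which yields the Lie forms:
  \<^item> for \<open>J\<^sub>1\<close> the horizontal and the vertical half cancel, so the Lie form is \<open>0\<close> (\<open>lie_form_J1_hat\<close>);
  \<^item> for \<open>J\<^sub>2\<close> the two halves of the curvature part agree and add up to the associated Ricci tensor, and the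
    Lie form is \<open>\<rho>'(u, Z)\<close> on \<open>Z\<^sup>H\<close> and \<open>\<theta>(Z)\<close> on \<open>Z\<^sup>V\<close>, with \<open>\<rho>'\<close> the associated Ricci tensor
    (\<open>lie_form_J2_hat\<close>);
  \<^item> for \<open>J\<^sub>3\<close> the curvature enters only through contractions of \<open>R(X, Y)\<close>, skew in \<open>X\<close> and \<open>Y\<close>, with
    symmetric tensors, so the Lie form is \<open>-\<theta>(Z)\<close> on \<open>Z\<^sup>H\<close> and \<open>0\<close> on \<open>Z\<^sup>V\<close> (\<open>lie_form_J3_hat\<close>).

  All three assertions can be read off.  It remains to see that \<open>TM\<close> is a smooth manifold
  (\<open>smooth_manifold_tangent_bundle\<close>) on which these objects, defined chart by chart, are tensor fields.
  They are given by the same formulas on lifts in every chart, so it is enough that a change of charts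
  maps lifts to lifts (\<open>lift_transform\<close>).  This is the transformation law of the Christoffel
  symbols (\<open>gamma_transform\<close>), which follows from the uniqueness of the Levi-Civita connection as well.
\<close>

section \<open>Calculus of smooth functions\<close>

lemma pd_has_derivative: "(f has_derivative f') (at x) \<Longrightarrow> pd i f x = f' (axis i 1)"
  unfolding pd_def by (metis frechet_derivative_at)

lemma has_derivative_pd:
  fixes f :: "real^'d::finite \<Rightarrow> real"
  assumes "f differentiable (at x)"
  shows "(f has_derivative (\<lambda>v. \<Sum>i\<in>UNIV. v $ i * pd i f x)) (at x)"
proof -
  have D: "(f has_derivative frechet_derivative f (at x)) (at x)"
    using assms frechet_derivative_works by blast
  then have lin: "linear (frechet_derivative f (at x))"
    by (rule has_derivative_linear)
  have "frechet_derivative f (at x) v = (\<Sum>i\<in>UNIV. v $ i * pd i f x)" for v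
  proof -
    have "frechet_derivative f (at x) v
        = frechet_derivative f (at x) (\<Sum>i\<in>UNIV. v $ i *\<^sub>R axis i 1)"
      by (simp add: basis_expansion flip: scalar_mult_eq_scaleR)
    then show ?thesis
      by (simp add: linear_sum[OF lin] linear_cmul[OF lin] pd_def)
  qed
  then have "frechet_derivative f (at x) = (\<lambda>v. \<Sum>i\<in>UNIV. v $ i * pd i f x)" by blast
  with D show ?thesis by simp
qed

lemma sum_axis [simp]:
  fixes f :: "'d::finite \<Rightarrow> real"
  shows "(\<Sum>k\<in>UNIV. axis i 1 $ k * f k) = f i" "(\<Sum>k\<in>UNIV. f k * axis i 1 $ k) = f i"
  by (simp_all add: axis_def if_distrib[of "\<lambda>c. c * _"] if_distrib[of "\<lambda>c. _ * c"] cong: if_cong)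

lemma pd_const: "pd i (\<lambda>x. a) x = 0"
  by (subst pd_has_derivative) (auto intro!: derivative_eq_intros)

lemma has_derivative_nth: "((\<lambda>x. x $ j) has_derivative (\<lambda>v. v $ j)) F"
  by (intro bounded_linear_imp_has_derivative bounded_linear_vec_nth)

lemma pd_nth: "pd i (\<lambda>x. x $ j) x = (if i = j then 1 else 0)"
  by (subst pd_has_derivative[OF has_derivative_nth]) (simp add: axis_def)

lemma Ck_on_cong:
  assumes "open S" "\<And>x. x \<in> S \<Longrightarrow> f x = f' x"
  shows "Ck_on k S f \<longleftrightarrow> Ck_on k S f'"
  using assms(2)
proof (induction k arbitrary: f f')
  case 0
  then show ?case by (simp cong: continuous_on_cong_simp)
next
  case (Suc k)
  have "f differentiable_on S \<longleftrightarrow> f' differentiable_on S"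
    unfolding differentiable_on_def differentiable_def
    by (metis Suc.prems has_derivative_transform)
  moreover have "Ck_on k S (pd i f) \<longleftrightarrow> Ck_on k S (pd i f')" for i
    by (rule Suc.IH) (use pd_cong[OF assms(1)] Suc.prems in blast)
  ultimately show ?case by simp
qed

lemma Ck_on_SucD: "Ck_on (Suc k) S f \<Longrightarrow> Ck_on k S f"
  by (induction k arbitrary: f) (auto intro: differentiable_imp_continuous_on)

lemma Ck_on_const: "Ck_on k S (\<lambda>x. a)"
proof (induction k arbitrary: a)
  case (Suc k)
  have "pd i (\<lambda>x. a) = (\<lambda>x. 0)" for i :: 'a
    by (rule ext) (rule pd_const)
  with Suc show ?case by simp
qed simp

lemma Ck_on_nth: "Ck_on k S (\<lambda>x. x $ j)"
proof (cases k)
  case (Suc l)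
  have "pd i (\<lambda>x. x $ j) = (\<lambda>x. if i = j then 1 else 0)" for i
    by (rule ext) (rule pd_nth)
  with Suc show ?thesis
    by (auto simp: Ck_on_const differentiable_on_def differentiable_def
        intro!: exI has_derivative_nth)
qed (simp add: continuous_on_component)

lemma differentiable_on_openD: "f differentiable_on S \<Longrightarrow> open S \<Longrightarrow> x \<in> S \<Longrightarrow> f differentiable (at x)"
  using differentiable_on_eq_differentiable_at by blast

lemma pd_add:
  assumes "f differentiable (at x)" "h differentiable (at x)"
  shows "pd i (\<lambda>x. f x + h x) x = pd i f x + pd i h x"
  by (subst pd_has_derivative[OF has_derivative_add[OF has_derivative_pd[OF assms(1)]
      has_derivative_pd[OF assms(2)]]]) (simp)

lemma pd_mult:
  assumes "f differentiable (at x)" "h differentiable (at x)"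
  shows "pd i (\<lambda>x. f x * h x) x = f x * pd i h x + pd i f x * h x"
  by (subst pd_has_derivative[OF has_derivative_mult[OF has_derivative_pd[OF assms(1)]
      has_derivative_pd[OF assms(2)]]]) (simp)

lemma pd_inverse:
  assumes "f differentiable (at x)" "f x \<noteq> 0"
  shows "pd i (\<lambda>x. inverse (f x)) x = - (pd i f x * (inverse (f x) * inverse (f x)))"
  by (subst pd_has_derivative[OF Deriv.has_derivative_inverse[OF assms(2) has_derivative_pd[OF assms(1)]]])
    (simp)

lemma Ck_on_add:
  assumes "open S"
  shows "Ck_on k S f \<Longrightarrow> Ck_on k S h \<Longrightarrow> Ck_on k S (\<lambda>x. f x + h x)"
proof (induction k arbitrary: f h)
  case (Suc k)
  have "Ck_on k S (pd i (\<lambda>x. f x + h x)) \<longleftrightarrow> Ck_on k S (\<lambda>x. pd i f x + pd i h x)" for i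
    by (rule Ck_on_cong[OF assms])
      (use Suc.prems assms in \<open>auto intro!: pd_add dest: differentiable_on_openD\<close>)
  with Suc show ?case by (auto intro: differentiable_on_add)
qed (auto intro: continuous_intros)

lemma Ck_on_mult:
  assumes "open S"
  shows "Ck_on k S f \<Longrightarrow> Ck_on k S h \<Longrightarrow> Ck_on k S (\<lambda>x. f x * h x)"
proof (induction k arbitrary: f h)
  case (Suc k)
  have "Ck_on k S (pd i (\<lambda>x. f x * h x)) \<longleftrightarrow> Ck_on k S (\<lambda>x. f x * pd i h x + pd i f x * h x)" for i
    by (rule Ck_on_cong[OF assms])
      (use Suc.prems assms in \<open>auto intro!: pd_mult dest: differentiable_on_openD\<close>)
  moreover have "Ck_on k S f" "Ck_on k S h"
    using Suc.prems by (blast intro: Ck_on_SucD)+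
  ultimately show ?case
    using Suc by (auto intro!: differentiable_on_mult Ck_on_add[OF assms])
qed (auto intro: continuous_intros)

lemma Ck_on_minus: "open S \<Longrightarrow> Ck_on k S f \<Longrightarrow> Ck_on k S (\<lambda>x. - f x)"
  using Ck_on_mult[of S k "\<lambda>x. - 1" f] by (simp add: Ck_on_const)

lemma Ck_on_inverse:
  assumes "open S" "\<And>x. x \<in> S \<Longrightarrow> f x \<noteq> 0"
  shows "Ck_on k S f \<Longrightarrow> Ck_on k S (\<lambda>x. inverse (f x))"
proof (induction k)
  case (Suc k)
  have "Ck_on k S (pd i (\<lambda>x. inverse (f x)))
      \<longleftrightarrow> Ck_on k S (\<lambda>x. - (pd i f x * (inverse (f x) * inverse (f x))))" for i
    by (rule Ck_on_cong[OF assms(1)])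
      (use Suc.prems assms in \<open>auto intro!: pd_inverse dest: differentiable_on_openD\<close>)
  moreover have "Ck_on k S f"
    using Suc.prems by (blast intro: Ck_on_SucD)
  moreover have "(\<lambda>x. inverse (f x)) differentiable_on S"
    using Suc.prems assms by (auto simp: differentiable_on_def intro!: differentiable_inverse)
  ultimately show ?case
    using Suc by (auto intro!: Ck_on_minus[OF assms(1)] Ck_on_mult[OF assms(1)])
qed (use assms in \<open>auto intro: continuous_intros\<close>)

lemma smooth_on_const [simp]: "smooth_on S (\<lambda>x. a)"
  by (simp add: smooth_on_def Ck_on_const)

lemma smooth_on_nth [simp]: "smooth_on S (\<lambda>x. x $ j)"
  by (simp add: smooth_on_def Ck_on_nth)

lemma smooth_on_add: "open S \<Longrightarrow> smooth_on S f \<Longrightarrow> smooth_on S h \<Longrightarrow> smooth_on S (\<lambda>x. f x + h x)"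
  by (simp add: smooth_on_def Ck_on_add)

lemma smooth_on_mult: "open S \<Longrightarrow> smooth_on S f \<Longrightarrow> smooth_on S h \<Longrightarrow> smooth_on S (\<lambda>x. f x * h x)"
  by (simp add: smooth_on_def Ck_on_mult)

lemma smooth_on_minus: "open S \<Longrightarrow> smooth_on S f \<Longrightarrow> smooth_on S (\<lambda>x. - f x)"
  using smooth_on_mult[of S "\<lambda>x. - 1" f] by simp

lemma smooth_on_diff: "open S \<Longrightarrow> smooth_on S f \<Longrightarrow> smooth_on S h \<Longrightarrow> smooth_on S (\<lambda>x. f x - h x)"
  using smooth_on_add[of S f "\<lambda>x. - h x"] smooth_on_minus[of S h] by simp

lemma smooth_on_inverse:
  "open S \<Longrightarrow> smooth_on S f \<Longrightarrow> (\<And>x. x \<in> S \<Longrightarrow> f x \<noteq> 0) \<Longrightarrow> smooth_on S (\<lambda>x. inverse (f x))"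
  by (simp add: smooth_on_def Ck_on_inverse)

lemma smooth_on_sum:
  "open S \<Longrightarrow> (\<And>a. a \<in> A \<Longrightarrow> smooth_on S (f a)) \<Longrightarrow> smooth_on S (\<lambda>x. \<Sum>a\<in>A. f a x)"
  by (induction A rule: infinite_finite_induct) (auto intro: smooth_on_add)

lemma smooth_on_prod:
  "open S \<Longrightarrow> (\<And>a. a \<in> A \<Longrightarrow> smooth_on S (f a)) \<Longrightarrow> smooth_on S (\<lambda>x. \<Prod>a\<in>A. f a x)"
  by (induction A rule: infinite_finite_induct) (auto intro: smooth_on_mult)

lemma smooth_on_cong:
  "open S \<Longrightarrow> (\<And>x. x \<in> S \<Longrightarrow> f x = f' x) \<Longrightarrow> smooth_on S f \<longleftrightarrow> smooth_on S f'"
  unfolding smooth_on_def using Ck_on_cong by blast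

lemma smooth_on_pd: "smooth_on S f \<Longrightarrow> smooth_on S (pd i f)"
  unfolding smooth_on_def by (metis Ck_on.simps(2))

lemma smooth_on_differentiable:
  "smooth_on S f \<Longrightarrow> open S \<Longrightarrow> x \<in> S \<Longrightarrow> f differentiable (at x)"
  unfolding smooth_on_def by (metis Ck_on.simps(2) differentiable_on_openD)

lemma smooth_on_has_derivative:
  "smooth_on S f \<Longrightarrow> open S \<Longrightarrow> x \<in> S \<Longrightarrow>
    (f has_derivative (\<lambda>v. \<Sum>i\<in>UNIV. v $ i * pd i f x)) (at x)"
  by (intro has_derivative_pd smooth_on_differentiable)

lemma has_derivative_vecI:
  fixes f :: "'a::real_normed_vector \<Rightarrow> real^'k::finite"
  assumes "\<And>k. ((\<lambda>x. f x $ k) has_derivative (\<lambda>v. f' v $ k)) F"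
  shows "(f has_derivative f') F"
proof -
  have "((\<lambda>x. f x \<bullet> b) has_derivative (\<lambda>v. f' v \<bullet> b)) F" if "b \<in> Basis" for b :: "real^'k"
  proof -
    from that have "\<exists>k. b = axis k 1"
      by (auto simp: Basis_vec_def)
    then obtain k where "b = axis k 1" ..
    then show ?thesis
      using assms[of k] by (simp add: inner_axis)
  qed
  then have "((\<lambda>x. \<Sum>b\<in>Basis. (f x \<bullet> b) *\<^sub>R b) has_derivative (\<lambda>v. \<Sum>b\<in>Basis. (f' v \<bullet> b) *\<^sub>R b)) F"
    by (intro has_derivative_sum has_derivative_scaleR_left)
  then show ?thesis by (simp add: euclidean_representation)
qed

lemma has_derivative_vecD:
  "(f has_derivative f') F \<Longrightarrow> ((\<lambda>x. f x $ k) has_derivative (\<lambda>v. f' v $ k)) F"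
  by (rule bounded_linear.has_derivative[OF bounded_linear_vec_nth])

lemma pd_compose:
  fixes T :: "real^'d::finite \<Rightarrow> real^'e::finite"
  assumes "f differentiable (at (T x))" "\<And>j. (\<lambda>x. T x $ j) differentiable (at x)"
  shows "pd i (\<lambda>x. f (T x)) x = (\<Sum>j\<in>UNIV. pd i (\<lambda>x. T x $ j) x * pd j f (T x))"
proof -
  have "(T has_derivative (\<lambda>v. \<chi> j. \<Sum>i\<in>UNIV. v $ i * pd i (\<lambda>x. T x $ j) x)) (at x)"
    by (rule has_derivative_vecI) (simp add: has_derivative_pd assms(2))
  from has_derivative_compose[OF this has_derivative_pd[OF assms(1)]]
  show ?thesis
    by (subst pd_has_derivative, assumption) (simp)
qed

lemma differentiable_vec:
  fixes T :: "real^'d::finite \<Rightarrow> real^'e::finite"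
  assumes "\<And>j. (\<lambda>x. T x $ j) differentiable (at x)"
  shows "T differentiable (at x)"
proof -
  have "(T has_derivative (\<lambda>v. \<chi> j. \<Sum>i\<in>UNIV. v $ i * pd i (\<lambda>x. T x $ j) x)) (at x)"
    by (rule has_derivative_vecI) (simp add: has_derivative_pd assms)
  then show ?thesis by (auto simp: differentiable_def)
qed

text \<open>The partial derivatives of a composition are sums of products of partial derivatives of the inner map
  with compositions of one order less, so the induction has to run over all outer functions at once.\<close>

lemma Ck_on_compose:
  fixes T :: "real^'d::finite \<Rightarrow> real^'e::finite"
  assumes S: "open S" "open S'" and T: "\<And>j. smooth_on S (\<lambda>x. T x $ j)" and TS: "T ` S \<subseteq> S'"
  shows "Ck_on k S' f \<Longrightarrow> Ck_on k S (\<lambda>x. f (T x))"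
proof (induction k arbitrary: f)
  case 0
  have "continuous_on S T"
    unfolding continuous_on_componentwise[of S T]
    using T[unfolded smooth_on_def, THEN spec[of _ 0]] by (auto simp: Basis_vec_def inner_axis)
  then show ?case
    using 0 TS by (auto intro: continuous_on_compose2)
next
  case (Suc k)
  have f: "f differentiable (at (T x))" if "x \<in> S" for x
    using Suc.prems S(2) TS that by (auto intro!: differentiable_on_openD)
  have t: "(\<lambda>x. T x $ j) differentiable (at x)" if "x \<in> S" for x j
    using T S(1) that by (blast intro: smooth_on_differentiable)
  have "Ck_on k S (pd i (\<lambda>x. f (T x)))
      \<longleftrightarrow> Ck_on k S (\<lambda>x. \<Sum>j\<in>UNIV. pd i (\<lambda>x. T x $ j) x * pd j f (T x))" for i
    by (rule Ck_on_cong[OF S(1)]) (simp add: pd_compose f t)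
  moreover have "Ck_on k S (\<lambda>x. \<Sum>j\<in>A. pd i (\<lambda>x. T x $ j) x * pd j f (T x))" for i and A :: "'e set"
  proof (induction A rule: infinite_finite_induct)
    case (insert a A)
    have "Ck_on k S (pd i (\<lambda>x. T x $ a))"
      using smooth_on_pd[OF T] by (auto simp: smooth_on_def)
    moreover have "Ck_on k S (\<lambda>x. pd a f (T x))"
      using Suc by simp
    ultimately show ?case
      using insert by (auto intro!: Ck_on_add[OF S(1)] Ck_on_mult[OF S(1)])
  qed (simp_all add: Ck_on_const)
  moreover have "(\<lambda>x. f (T x)) differentiable_on S"
    unfolding differentiable_on_eq_differentiable_at[OF S(1)]
    using differentiable_chain_at[of T _ f, OF differentiable_vec[OF t] f] by (simp add: o_def)
  ultimately show ?case by simp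
qed

lemma smooth_on_compose:
  fixes T :: "real^'d::finite \<Rightarrow> real^'e::finite"
  assumes "open S" "open S'" "\<And>j. smooth_on S (\<lambda>x. T x $ j)" "T ` S \<subseteq> S'" "smooth_on S' f"
  shows "smooth_on S (\<lambda>x. f (T x))"
  using Ck_on_compose[OF assms(1-4)] assms(5) by (simp add: smooth_on_def)

section \<open>Symmetry of second derivatives\<close>

lemma has_real_derivative_line:
  fixes f :: "real^'d::finite \<Rightarrow> real"
  assumes "f differentiable (at (x + s *\<^sub>R axis i 1))"
  shows "((\<lambda>s. f (x + s *\<^sub>R axis i 1)) has_real_derivative pd i f (x + s *\<^sub>R axis i 1)) (at s)"
proof -
  have "((\<lambda>s. x + s *\<^sub>R axis i 1) has_derivative (\<lambda>h. h *\<^sub>R axis i 1)) (at s)"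
    by (auto intro!: derivative_eq_intros)
  from has_derivative_compose[OF this has_derivative_pd[OF assms]]
  have "((\<lambda>s. f (x + s *\<^sub>R axis i 1)) has_derivative
      (\<lambda>h. h * pd i f (x + s *\<^sub>R axis i 1))) (at s)"
    by (simp add: mult.assoc flip: sum_distrib_left)
  then show ?thesis
    by (simp add: has_field_derivative_def mult_commute_abs)
qed

text \<open>The mean value theorem twice: along direction \<open>i\<close> for the increment of \<open>f\<close> in direction \<open>j\<close>, then
  along direction \<open>j\<close> for the partial derivative that appears.\<close>

lemma second_difference:
  fixes f :: "real^'d::finite \<Rightarrow> real"
  assumes "0 < h"
    and box: "\<And>s t. 0 \<le> s \<Longrightarrow> s \<le> h \<Longrightarrow> 0 \<le> t \<Longrightarrow> t \<le> h \<Longrightarrow>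
      f differentiable (at (x + s *\<^sub>R axis i 1 + t *\<^sub>R axis j 1)) \<and>
      pd i f differentiable (at (x + s *\<^sub>R axis i 1 + t *\<^sub>R axis j 1))"
  shows "\<exists>s t. 0 < s \<and> s < h \<and> 0 < t \<and> t < h \<and>
    f (x + h *\<^sub>R axis i 1 + h *\<^sub>R axis j 1) - f (x + h *\<^sub>R axis i 1) - f (x + h *\<^sub>R axis j 1) + f x
    = h * h * pd j (pd i f) (x + s *\<^sub>R axis i 1 + t *\<^sub>R axis j 1)"
proof -
  let ?i = "axis i 1 :: real^'d" and ?j = "axis j 1 :: real^'d"
  define \<phi> where "\<phi> s = f (x + s *\<^sub>R ?i + h *\<^sub>R ?j) - f (x + s *\<^sub>R ?i)" for s
  have "DERIV \<phi> s :> pd i f (x + s *\<^sub>R ?i + h *\<^sub>R ?j) - pd i f (x + s *\<^sub>R ?i)"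
    if "0 \<le> s" "s \<le> h" for s
  proof -
    have "((\<lambda>s. f ((x + h *\<^sub>R ?j) + s *\<^sub>R ?i)) has_real_derivative
        pd i f ((x + h *\<^sub>R ?j) + s *\<^sub>R ?i)) (at s)"
      by (rule has_real_derivative_line)
        (use box[of s h] that \<open>0 < h\<close> in \<open>simp add: algebra_simps\<close>)
    moreover have "((\<lambda>s. f (x + s *\<^sub>R ?i)) has_real_derivative pd i f (x + s *\<^sub>R ?i)) (at s)"
      by (rule has_real_derivative_line)
        (use box[of s 0] that \<open>0 < h\<close> in \<open>simp add: algebra_simps\<close>)
    ultimately show ?thesis
      unfolding \<phi>_def by (auto intro!: derivative_intros simp: algebra_simps)
  qed
  from MVT2[OF \<open>0 < h\<close> this] obtain s where s: "0 < s" "s < h"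
    and 1: "\<phi> h - \<phi> 0 = h * (pd i f (x + s *\<^sub>R ?i + h *\<^sub>R ?j) - pd i f (x + s *\<^sub>R ?i))"
    by auto
  have "DERIV (\<lambda>t. pd i f (x + s *\<^sub>R ?i + t *\<^sub>R ?j)) t :> pd j (pd i f) (x + s *\<^sub>R ?i + t *\<^sub>R ?j)"
    if "0 \<le> t" "t \<le> h" for t
    by (rule has_real_derivative_line) (use box[of s t] that s in simp)
  from MVT2[OF \<open>0 < h\<close> this] obtain t where t: "0 < t" "t < h"
    and 2: "pd i f (x + s *\<^sub>R ?i + h *\<^sub>R ?j) - pd i f (x + s *\<^sub>R ?i + 0 *\<^sub>R ?j)
      = h * pd j (pd i f) (x + s *\<^sub>R ?i + t *\<^sub>R ?j)"
    by auto
  from 1 2 have "\<phi> h - \<phi> 0 = h * h * pd j (pd i f) (x + s *\<^sub>R ?i + t *\<^sub>R ?j)"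
    by simp
  then show ?thesis
    using s t by (intro exI[of _ s] exI[of _ t]) (simp add: \<phi>_def)
qed

text \<open>The second difference over a small square does not change when the two directions are exchanged, and by
  \<open>second_difference\<close> it is the area of the square times either mixed derivative at some point of the
  square.  Both mixed derivatives are continuous, so shrinking the square gives equality at \<open>x\<close>.\<close>

theorem pd_pd_commute:
  fixes f :: "real^'d::finite \<Rightarrow> real"
  assumes f: "Ck_on 2 S f" and S: "open S" "x \<in> S"
  shows "pd i (pd j f) x = pd j (pd i f) x"
proof (rule ccontr)
  let ?i = "axis i 1 :: real^'d" and ?j = "axis j 1 :: real^'d"
  let ?p = "pd i (pd j f)" and ?q = "pd j (pd i f)"
  assume ne: "?p x \<noteq> ?q x"
  define e where "e = \<bar>?p x - ?q x\<bar> / 2"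
  have e: "0 < e" using ne by (simp add: e_def)
  have f2: "f differentiable_on S" "pd a f differentiable_on S" "continuous_on S (pd b (pd a f))" for a b
    using f by (simp_all add: numeral_2_eq_2)
  have diff: "f differentiable (at z)" "pd a f differentiable (at z)" if "z \<in> S" for a z
    using f2 S(1) that by (auto intro: differentiable_on_openD)
  have "isCont ?p x" "isCont ?q x"
    using f2(3) S continuous_on_eq_continuous_at by blast+
  then have "\<forall>\<^sub>F z in at x. dist (?p z) (?p x) < e" "\<forall>\<^sub>F z in at x. dist (?q z) (?q x) < e"
    using e by (auto simp: isCont_def tendsto_iff)
  then have "\<forall>\<^sub>F z in at x. dist (?p z) (?p x) < e \<and> dist (?q z) (?q x) < e"
    by (rule eventually_conj)
  then obtain d1 where "0 < d1"
    and d: "\<And>z. z \<noteq> x \<Longrightarrow> dist z x < d1 \<Longrightarrow> dist (?p z) (?p x) < e \<and> dist (?q z) (?q x) < e"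
    unfolding eventually_at by auto
  have d1: "0 < d1" "\<And>z. dist z x < d1 \<Longrightarrow> dist (?p z) (?p x) < e \<and> dist (?q z) (?q x) < e"
    using \<open>0 < d1\<close> d e by (metis dist_self)+
  obtain d2 where d2: "0 < d2" "ball x d2 \<subseteq> S"
    using S open_contains_ball by blast
  \<comment> \<open>The far corner of the square of side h has distance at most \<open>2 * h\<close> from \<open>x\<close>.\<close>
  define h where "h = min d1 d2 / 4"
  have h: "0 < h" "h + h < min d1 d2" using d1(1) d2(1) by (auto simp: h_def min_def)
  have near: "dist (x + s *\<^sub>R axis a 1 + t *\<^sub>R axis b 1) x < min d1 d2"
    if "0 \<le> s" "s \<le> h" "0 \<le> t" "t \<le> h" for s t a b
  proof -
    have "norm (s *\<^sub>R axis a 1 + t *\<^sub>R axis b 1 :: real^'d)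
        \<le> norm (s *\<^sub>R axis a 1 :: real^'d) + norm (t *\<^sub>R axis b 1 :: real^'d)"
      by (rule norm_triangle_ineq)
    also have "\<dots> \<le> h + h" using that by simp
    also have "\<dots> < min d1 d2" by (rule h(2))
    finally show ?thesis by (simp add: dist_norm add.assoc)
  qed
  have inS: "x + s *\<^sub>R axis a 1 + t *\<^sub>R axis b 1 \<in> S"
    if "0 \<le> s" "s \<le> h" "0 \<le> t" "t \<le> h" for s t a b
    using near[OF that, of a b] d2(2) by (auto simp: dist_commute)
  obtain s t where st: "0 < s" "s < h" "0 < t" "t < h"
    and 1: "f (x + h *\<^sub>R ?i + h *\<^sub>R ?j) - f (x + h *\<^sub>R ?i) - f (x + h *\<^sub>R ?j) + f x
      = h * h * ?q (x + s *\<^sub>R ?i + t *\<^sub>R ?j)"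
    using second_difference[OF h(1), of f x i j] diff inS by blast
  obtain s' t' where st': "0 < s'" "s' < h" "0 < t'" "t' < h"
    and 2: "f (x + h *\<^sub>R ?j + h *\<^sub>R ?i) - f (x + h *\<^sub>R ?j) - f (x + h *\<^sub>R ?i) + f x
      = h * h * ?p (x + s' *\<^sub>R ?j + t' *\<^sub>R ?i)"
    using second_difference[OF h(1), of f x j i] diff inS by blast
  have swap: "x + h *\<^sub>R ?j + h *\<^sub>R ?i = x + h *\<^sub>R ?i + h *\<^sub>R ?j"
    by (simp add: algebra_simps)
  have "h * h * ?q (x + s *\<^sub>R ?i + t *\<^sub>R ?j) = h * h * ?p (x + s' *\<^sub>R ?j + t' *\<^sub>R ?i)"
    unfolding 1[symmetric] 2[symmetric] swap by simp
  then have eq: "?q (x + s *\<^sub>R ?i + t *\<^sub>R ?j) = ?p (x + s' *\<^sub>R ?j + t' *\<^sub>R ?i)"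
    using h(1) by simp
  have "dist (?q (x + s *\<^sub>R ?i + t *\<^sub>R ?j)) (?q x) < e"
    using d1(2) near st by (meson less_imp_le min_less_iff_conj)
  moreover have "dist (?p (x + s' *\<^sub>R ?j + t' *\<^sub>R ?i)) (?p x) < e"
    using d1(2) near st' by (meson less_imp_le min_less_iff_conj)
  ultimately have "dist (?p x) (?q x) < e + e"
    unfolding eq by (metis add.commute dist_commute dist_triangle_less_add)
  then show False
    by (simp add: e_def dist_real_def)
qed

lemma smooth_on_pd_pd_commute:
  "smooth_on S f \<Longrightarrow> open S \<Longrightarrow> x \<in> S \<Longrightarrow> pd i (pd j f) x = pd j (pd i f) x"
  by (rule pd_pd_commute) (auto simp: smooth_on_def)

section \<open>Smooth maps and matrix functions\<close>

definition smooth_matrix_on :: "(real^'d::finite) set \<Rightarrow> (real^'d \<Rightarrow> real^'k^'m) \<Rightarrow> bool" where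
  "smooth_matrix_on S T \<longleftrightarrow> (\<forall>i j. smooth_on S (\<lambda>x. T x $ i $ j))"

definition smooth_map_on :: "(real^'d::finite) set \<Rightarrow> (real^'d \<Rightarrow> real^'k) \<Rightarrow> bool" where
  "smooth_map_on S f \<longleftrightarrow> (\<forall>k. smooth_on S (\<lambda>x. f x $ k))"

lemma smooth_map_on_differentiable:
  fixes f :: "real^'d::finite \<Rightarrow> real^'k::finite"
  shows "smooth_map_on S f \<Longrightarrow> open S \<Longrightarrow> x \<in> S \<Longrightarrow> f differentiable (at x)"
  unfolding smooth_map_on_def by (blast intro: differentiable_vec smooth_on_differentiable)

lemma smooth_map_on_mult:
  fixes f :: "real^'d::finite \<Rightarrow> real^'k::finite"
  assumes "open S" "smooth_matrix_on S T" "smooth_map_on S f"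
  shows "smooth_map_on S (\<lambda>x. T x *v f x)"
  using assms by (auto simp: smooth_map_on_def smooth_matrix_on_def matrix_vector_mult_def
      intro!: smooth_on_sum smooth_on_mult)

lemma smooth_matrix_on_mult:
  fixes U :: "real^'d::finite \<Rightarrow> real^'k^'l::finite"
  assumes "open S" "smooth_matrix_on S T" "smooth_matrix_on S U"
  shows "smooth_matrix_on S (\<lambda>x. T x ** U x)"
  using assms by (auto simp: smooth_matrix_on_def matrix_matrix_mult_def
      intro!: smooth_on_sum smooth_on_mult)

lemma smooth_on_det:
  fixes T :: "real^'d::finite \<Rightarrow> real^'k^'k::finite"
  assumes "open S" "smooth_matrix_on S T"
  shows "smooth_on S (\<lambda>x. det (T x))"
  using assms unfolding det_def smooth_matrix_on_def
  by (auto intro!: smooth_on_sum smooth_on_mult smooth_on_prod)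

lemma matrix_eqI: "(\<And>X. A *v X = B *v X) \<Longrightarrow> A = (B :: real^'d::finite^'e)"
  by (simp add: matrix_eq)

lemma minus_mat_1_mult: "- mat 1 *v A = - (A :: real^'k::finite)"
  using matrix_vector_mult_diff_rdistrib[of 0 "mat 1" A] by simp

lemma matrix_vector_mult_minus: "M *v (- Z) = - (M *v Z)" for M :: "real^'k::finite^'l::finite"
  by (rule linear_neg[OF matrix_vector_mul_linear])

lemma matrix_inv_cancel:
  fixes A :: "real^'k^'k::finite"
  assumes "invertible A"
  shows "A ** matrix_inv A = mat 1" "matrix_inv A ** A = mat 1"
  using assms someI_ex[of "\<lambda>A'. A ** A' = mat 1 \<and> A' ** A = mat 1"]
  unfolding invertible_def matrix_inv_def by blast+

lemma matrix_inv_unique: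
  fixes A :: "real^'k^'k::finite"
  assumes "A ** B = mat 1"
  shows "matrix_inv A = B"
proof -
  have "invertible A"
    using assms by (auto simp: invertible_right_inverse)
  then have "matrix_inv A ** (A ** B) = B"
    by (simp add: matrix_mul_assoc matrix_inv_cancel)
  with assms show ?thesis by simp
qed

text \<open>By Cramer's rule the entries of the inverse are quotients of determinants, that is, of polynomials in
  the entries of the matrix.\<close>

lemma smooth_matrix_on_inv:
  fixes T :: "real^'d::finite \<Rightarrow> real^'k^'k::finite"
  assumes S: "open S" and T: "smooth_matrix_on S T" and inv: "\<And>x. x \<in> S \<Longrightarrow> invertible (T x)"
  shows "smooth_matrix_on S (\<lambda>x. matrix_inv (T x))"
  unfolding smooth_matrix_on_def
proof (intro allI)
  fix k l
  let ?C = "\<lambda>x. \<chi> i j. if j = k then axis l 1 $ i else T x $ i $ j"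
  have eq: "matrix_inv (T x) $ k $ l = det (?C x) * inverse (det (T x))" if "x \<in> S" for x
  proof -
    have "T x *v (matrix_inv (T x) *v axis l 1) = axis l 1"
      by (simp add: matrix_vector_mul_assoc matrix_inv_cancel inv that)
    moreover have "det (T x) \<noteq> 0"
      using inv[OF that] by (simp add: invertible_det_nz)
    ultimately have "matrix_inv (T x) *v axis l 1
        = (\<chi> k. det (\<chi> i j. if j = k then axis l 1 $ i else T x $ i $ j) / det (T x))"
      by (simp add: cramer)
    then show ?thesis
      by (simp add: vec_eq_iff matrix_vector_mult_basis column_def divide_inverse)
  qed
  have "smooth_matrix_on S ?C"
    unfolding smooth_matrix_on_def
  proof (intro allI)
    show "smooth_on S (\<lambda>x. ?C x $ i $ j)" for i j
      using T by (cases "j = k") (simp_all add: smooth_matrix_on_def)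
  qed
  then have "smooth_on S (\<lambda>x. det (?C x) * inverse (det (T x)))"
    using inv by (intro smooth_on_mult smooth_on_inverse smooth_on_det S T)
      (auto simp: invertible_det_nz)
  then show "smooth_on S (\<lambda>x. matrix_inv (T x) $ k $ l)"
    using smooth_on_cong[OF S, of "\<lambda>x. matrix_inv (T x) $ k $ l"
      "\<lambda>x. det (?C x) * inverse (det (T x))"] eq by blast
qed


section \<open>The Levi-Civita connection of a metric in one chart\<close>

text \<open>The Christoffel symbols as a bilinear map on vectors: the covariant derivative of a field with constant
  components.  \<open>dgamma g x A\<close> is its derivative at \<open>x\<close> in direction \<open>A\<close>, and \<open>curv\<close> is the curvature
  operator on fields with constant components, whose brackets vanish.\<close>

definition gamma ::
  "(real^'d \<Rightarrow> real^'d^'d::finite) \<Rightarrow> real^'d \<Rightarrow> real^'d \<Rightarrow> real^'d \<Rightarrow> real^'d" where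
  "gamma g x X Y = (\<chi> k. \<Sum>i\<in>UNIV. \<Sum>j\<in>UNIV. christoffel g x k i j * X $ i * Y $ j)"

definition dgamma ::
  "(real^'d \<Rightarrow> real^'d^'d::finite) \<Rightarrow> real^'d \<Rightarrow> real^'d \<Rightarrow> real^'d \<Rightarrow> real^'d \<Rightarrow> real^'d" where
  "dgamma g x A X Y = (\<chi> k. \<Sum>i\<in>UNIV. \<Sum>j\<in>UNIV.
     (\<Sum>a\<in>UNIV. A $ a * pd a (\<lambda>z. christoffel g z k i j) x) * X $ i * Y $ j)"

definition curv ::
  "(real^'d \<Rightarrow> real^'d^'d::finite) \<Rightarrow> real^'d \<Rightarrow> real^'d \<Rightarrow> real^'d \<Rightarrow> real^'d \<Rightarrow> real^'d" where
  "curv g x X Y Z = dgamma g x X Y Z - dgamma g x Y X Z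
     + gamma g x X (gamma g x Y Z) - gamma g x Y (gamma g x X Z)"

lemma linear_gamma: "linear (gamma g x X)" "linear (\<lambda>X. gamma g x X Y)"
  by (rule linearI; simp add: gamma_def vec_eq_iff algebra_simps sum.distrib sum_distrib_left)+

lemma linear_dgamma: "linear (dgamma g x A X)" "linear (\<lambda>X. dgamma g x A X Y)" "linear (\<lambda>A. dgamma g x A X Y)"
  by (rule linearI; simp add: dgamma_def vec_eq_iff algebra_simps sum.distrib sum_distrib_left
      sum_distrib_right)+

lemmas gamma_simps [simp] =
  linear_gamma(1)[THEN linear_add] linear_gamma(1)[THEN linear_diff] linear_gamma(1)[THEN linear_neg]
  linear_gamma(1)[THEN linear_0] linear_gamma(1)[THEN linear_cmul]
  linear_gamma(2)[THEN linear_add] linear_gamma(2)[THEN linear_diff] linear_gamma(2)[THEN linear_neg]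
  linear_gamma(2)[THEN linear_0] linear_gamma(2)[THEN linear_cmul]

lemmas dgamma_simps [simp] =
  linear_dgamma(1)[THEN linear_add] linear_dgamma(1)[THEN linear_diff] linear_dgamma(1)[THEN linear_neg]
  linear_dgamma(1)[THEN linear_0] linear_dgamma(1)[THEN linear_cmul]
  linear_dgamma(2)[THEN linear_add] linear_dgamma(2)[THEN linear_diff] linear_dgamma(2)[THEN linear_neg]
  linear_dgamma(2)[THEN linear_0] linear_dgamma(2)[THEN linear_cmul]
  linear_dgamma(3)[THEN linear_add] linear_dgamma(3)[THEN linear_diff] linear_dgamma(3)[THEN linear_neg]
  linear_dgamma(3)[THEN linear_0] linear_dgamma(3)[THEN linear_cmul]

lemma linear_curv: "linear (curv g x X Y)" "linear (\<lambda>Y. curv g x X Y Z)" "linear (\<lambda>X. curv g x X Y Z)"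
  by (rule linearI; simp add: curv_def algebra_simps)+

lemmas curv_simps [simp] =
  linear_curv(1)[THEN linear_add] linear_curv(1)[THEN linear_diff] linear_curv(1)[THEN linear_neg]
  linear_curv(1)[THEN linear_0] linear_curv(1)[THEN linear_cmul]
  linear_curv(2)[THEN linear_add] linear_curv(2)[THEN linear_diff] linear_curv(2)[THEN linear_neg]
  linear_curv(2)[THEN linear_0] linear_curv(2)[THEN linear_cmul]
  linear_curv(3)[THEN linear_add] linear_curv(3)[THEN linear_diff] linear_curv(3)[THEN linear_neg]
  linear_curv(3)[THEN linear_0] linear_curv(3)[THEN linear_cmul]

lemma linear_bil: "linear (bil G X)" "linear (\<lambda>X. bil G X Y)"
  by (rule linearI; simp add: bil_linear)+

lemmas bil_simps [simp] =
  linear_bil(1)[THEN linear_add] linear_bil(1)[THEN linear_diff] linear_bil(1)[THEN linear_neg]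
  linear_bil(1)[THEN linear_0] linear_bil(1)[THEN linear_cmul]
  linear_bil(2)[THEN linear_add] linear_bil(2)[THEN linear_diff] linear_bil(2)[THEN linear_neg]
  linear_bil(2)[THEN linear_0] linear_bil(2)[THEN linear_cmul]

lemma Gamma_y_eq: "Gamma_y g w X = gamma g (xpart w) (ypart w) X"
  by (simp add: Gamma_y_def gamma_def mult.commute mult.assoc)

lemma curv_skew: "curv g x Y X Z = - curv g x X Y Z"
  by (simp add: curv_def)

lemma bil_sum: "bil G X Y = (\<Sum>i\<in>UNIV. \<Sum>j\<in>UNIV. G $ i $ j * X $ i * Y $ j)"
  by (simp add: bil_def inner_vec_def matrix_vector_mult_def sum_distrib_left algebra_simps)

lemma bil_sym: "transpose G = G \<Longrightarrow> bil G X Y = bil G Y X"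
  unfolding bil_def by (metis dot_lmul_matrix inner_commute vector_transpose_matrix)

lemma bil_nondegenerate:
  assumes "invertible G" "\<And>Y. bil G Y X = 0"
  shows "X = 0"
proof -
  have "G *v X = 0"
    using assms(2)[of "G *v X"] by (simp add: bil_def)
  then have "matrix_inv G *v (G *v X) = 0" by simp
  then show ?thesis by (simp add: matrix_vector_mul_assoc matrix_inv_cancel assms(1))
qed

lemma has_derivative_sum_basis:
  fixes f :: "real^'d::finite \<Rightarrow> real^'k::finite"
  assumes "(f has_derivative f') (at x)"
  shows "f' v = (\<chi> k. \<Sum>i\<in>UNIV. v $ i * pd i (\<lambda>z. f z $ k) x)"
proof (simp add: vec_eq_iff, intro allI)
  fix k
  have D: "((\<lambda>z. f z $ k) has_derivative (\<lambda>v. f' v $ k)) (at x)"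
    by (rule has_derivative_vecD[OF assms])
  then have "((\<lambda>z. f z $ k) has_derivative (\<lambda>v. \<Sum>i\<in>UNIV. v $ i * pd i (\<lambda>z. f z $ k) x)) (at x)"
    by (intro has_derivative_pd) (auto simp: differentiable_def)
  from fun_cong[OF has_derivative_unique[OF D this]]
  show "f' v $ k = (\<Sum>i\<in>UNIV. v $ i * pd i (\<lambda>z. f z $ k) x)" .
qed

lemma nabla_eq:
  assumes "(Y has_derivative Y') (at x)"
  shows "nabla g X Y x = Y' (X x) + gamma g x (X x) (Y x)"
  by (simp add: has_derivative_sum_basis[OF assms] nabla_def gamma_def vec_eq_iff)

lemma nabla_const_const: "nabla g (\<lambda>_. X) (\<lambda>_. Y) z = gamma g z X Y"
  using nabla_eq[of "\<lambda>_. Y" "\<lambda>_. 0" z g "\<lambda>_. X"] by simp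

text \<open>The base point \<open>b w\<close> is a function of the parameter because on the tangent bundle the parameter is a
  point of the bundle and \<open>b\<close> is the projection.\<close>

lemma has_derivative_gamma:
  fixes b :: "'e::real_normed_vector \<Rightarrow> real^'d::finite"
  assumes c: "\<And>k i j. (\<lambda>z. christoffel g z k i j) differentiable (at (b w))"
    and b: "(b has_derivative b') (at w)"
    and X: "(X has_derivative X') (at w)" and Y: "(Y has_derivative Y') (at w)"
  shows "((\<lambda>w. gamma g (b w) (X w) (Y w)) has_derivative
    (\<lambda>A. dgamma g (b w) (b' A) (X w) (Y w) + gamma g (b w) (X' A) (Y w)
      + gamma g (b w) (X w) (Y' A))) (at w)"
proof (rule has_derivative_vecI)
  fix k
  let ?D = "\<lambda>A i j. \<Sum>a\<in>UNIV. b' A $ a * pd a (\<lambda>z. christoffel g z k i j) (b w)"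
  have "((\<lambda>w. christoffel g (b w) k i j) has_derivative (\<lambda>A. ?D A i j)) (at w)" for i j
    by (rule has_derivative_compose[OF b has_derivative_pd[OF c]])
  then have "((\<lambda>w. \<Sum>i\<in>UNIV. \<Sum>j\<in>UNIV. christoffel g (b w) k i j * X w $ i * Y w $ j) has_derivative
      (\<lambda>A. \<Sum>i\<in>UNIV. \<Sum>j\<in>UNIV. (christoffel g (b w) k i j * X w $ i) * Y' A $ j
        + (christoffel g (b w) k i j * X' A $ i + ?D A i j * X w $ i) * Y w $ j)) (at w)"
    by (intro has_derivative_sum has_derivative_mult has_derivative_vecD[OF X] has_derivative_vecD[OF Y])
  then show "((\<lambda>w. gamma g (b w) (X w) (Y w) $ k) has_derivative (\<lambda>A. (dgamma g (b w) (b' A) (X w) (Y w)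
      + gamma g (b w) (X' A) (Y w) + gamma g (b w) (X w) (Y' A)) $ k)) (at w)"
    unfolding gamma_def dgamma_def vec_lambda_beta vector_add_component
    by (rule has_derivative_eq_rhs) (simp add: fun_eq_iff distrib_right sum.distrib)
qed

text \<open>Equality of mixed partial derivatives without coordinates.  It is used for components of the metric,
  where it gives the skew symmetry of the curvature, and for components of coordinate changes, where it gives the
  symmetry of the transformed connection.\<close>

lemma second_derivative_symmetric:
  fixes \<phi> :: "real^'d::finite \<Rightarrow> real"
  assumes "smooth_on S \<phi>" and S: "open S" "x \<in> S"
    and 1: "\<And>z. z \<in> S \<Longrightarrow> (\<phi> has_derivative \<phi>' z) (at z)"
    and 2: "\<And>Y. ((\<lambda>z. \<phi>' z Y) has_derivative D Y) (at x)"
  shows "D Y X = D X Y"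
proof -
  have eq: "\<phi>' z Y = (\<Sum>j\<in>UNIV. Y $ j * pd j \<phi> z)" if "z \<in> S" for z Y
    by (rule fun_cong[OF has_derivative_unique[OF 1[OF that]
        smooth_on_has_derivative[OF assms(1) S(1) that]]])
  have "((\<lambda>z. \<Sum>j\<in>UNIV. Y $ j * pd j \<phi> z) has_derivative
      (\<lambda>X. \<Sum>j\<in>UNIV. Y $ j * (\<Sum>i\<in>UNIV. X $ i * pd i (pd j \<phi>) x))) (at x)" for Y
    by (intro has_derivative_sum has_derivative_mult_right smooth_on_has_derivative[OF _ S]
        smooth_on_pd assms(1))
  then have "((\<lambda>z. \<phi>' z Y) has_derivative
      (\<lambda>X. \<Sum>j\<in>UNIV. Y $ j * (\<Sum>i\<in>UNIV. X $ i * pd i (pd j \<phi>) x))) (at x)" for Y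
    by (rule has_derivative_transform_within_open[OF _ S]) (simp add: eq)
  from fun_cong[OF has_derivative_unique[OF 2 this]]
  have "D Y X = (\<Sum>j\<in>UNIV. \<Sum>i\<in>UNIV. Y $ j * X $ i * pd i (pd j \<phi>) x)" for X Y
    by (simp add: sum_distrib_left mult.assoc)
  note D = this
  show ?thesis
    unfolding D[of Y] D[of X]
    by (subst sum.swap) (simp only: smooth_on_pd_pd_commute[OF assms(1) S] mult.commute[of "X $ _"])
qed

locale metric_chart =
  fixes g :: "real^'d::finite \<Rightarrow> real^'d^'d" and S :: "(real^'d) set"
  assumes open_S: "open S"
    and smooth_g: "smooth_matrix_on S g"
    and sym: "\<And>x. x \<in> S \<Longrightarrow> transpose (g x) = g x"
    and inv: "\<And>x. x \<in> S \<Longrightarrow> invertible (g x)"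
begin

lemma smooth_christoffel: "smooth_on S (\<lambda>x. christoffel g x k i j)"
proof -
  have "smooth_on S (pd i (\<lambda>z. g z $ j $ l))" for i j l
    using smooth_g by (intro smooth_on_pd) (simp add: smooth_matrix_on_def)
  moreover have "smooth_on S (\<lambda>x. matrix_inv (g x) $ k $ l)" for l
    using smooth_matrix_on_inv[OF open_S smooth_g inv] by (simp add: smooth_matrix_on_def)
  ultimately show ?thesis
    unfolding christoffel_def using open_S
    by (intro smooth_on_mult smooth_on_const smooth_on_sum smooth_on_diff smooth_on_add)
qed

lemma christoffel_differentiable:
  "x \<in> S \<Longrightarrow> (\<lambda>z. christoffel g z k i j) differentiable (at x)"
  by (rule smooth_on_differentiable[OF smooth_christoffel open_S])

lemmas gamma_derivative = has_derivative_gamma[OF christoffel_differentiable]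

lemma christoffel_levi_civita:
  assumes "x \<in> S"
  shows "christoffel g x k i j = christoffel g x k j i"
    and "pd k (\<lambda>z. g z $ i $ j) x =
      (\<Sum>l\<in>UNIV. christoffel g x l k i * g x $ l $ j) + (\<Sum>l\<in>UNIV. christoffel g x l k j * g x $ i $ l)"
  using christoffel_iff_torsion_free_metric[of g x S "christoffel g x", OF inv[OF assms] open_S assms] sym
  by blast+

lemma gamma_sym: "x \<in> S \<Longrightarrow> gamma g x X Y = gamma g x Y X"
  unfolding gamma_def by (subst sum.swap) (simp add: christoffel_levi_civita(1)[of x] mult_ac)

lemma gamma_derivative_const:
  "x \<in> S \<Longrightarrow> ((\<lambda>z. gamma g z X Y) has_derivative (\<lambda>A. dgamma g x A X Y)) (at x)"
  using gamma_derivative[of "\<lambda>z. z" x "\<lambda>A. A" "\<lambda>_. X" "\<lambda>_. 0" "\<lambda>_. Y" "\<lambda>_. 0"] by simp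

lemma dgamma_sym: 
  assumes "x \<in> S"
  shows "dgamma g x A X Y = dgamma g x A Y X"
proof -
  have "((\<lambda>z. gamma g z X Y) has_derivative (\<lambda>A. dgamma g x A Y X)) (at x)"
    by (rule has_derivative_transform_within_open[OF gamma_derivative_const[OF assms] open_S assms])
      (rule gamma_sym)
  with gamma_derivative_const[OF assms] show ?thesis by (metis has_derivative_unique)
qed

text \<open>Compatibility of the connection with the metric, as a product rule along an arbitrary map \<open>b\<close> into
  the chart.\<close>

lemma has_derivative_bil:
  fixes b :: "'e::real_normed_vector \<Rightarrow> real^'d"
  assumes w: "b w \<in> S" and b: "(b has_derivative b') (at w)"
    and X: "(X has_derivative X') (at w)" and Y: "(Y has_derivative Y') (at w)"
  shows "((\<lambda>w. bil (g (b w)) (X w) (Y w)) has_derivative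
    (\<lambda>A. bil (g (b w)) (X' A + gamma g (b w) (b' A) (X w)) (Y w)
      + bil (g (b w)) (X w) (Y' A + gamma g (b w) (b' A) (Y w)))) (at w)"
proof -
  let ?D = "\<lambda>A i j. \<Sum>a\<in>UNIV. b' A $ a * pd a (\<lambda>z. g z $ i $ j) (b w)"
  have "(\<lambda>z. g z $ i $ j) differentiable (at (b w))" for i j
    using smooth_g open_S w by (intro smooth_on_differentiable) (auto simp: smooth_matrix_on_def)
  then have "((\<lambda>w. g (b w) $ i $ j) has_derivative (\<lambda>A. ?D A i j)) (at w)" for i j
    by (rule has_derivative_compose[OF b has_derivative_pd])
  then have "((\<lambda>w. \<Sum>i\<in>UNIV. \<Sum>j\<in>UNIV. g (b w) $ i $ j * X w $ i * Y w $ j) has_derivative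
      (\<lambda>A. \<Sum>i\<in>UNIV. \<Sum>j\<in>UNIV. (g (b w) $ i $ j * X w $ i) * Y' A $ j
        + (g (b w) $ i $ j * X' A $ i + ?D A i j * X w $ i) * Y w $ j)) (at w)"
    by (intro has_derivative_sum has_derivative_mult has_derivative_vecD[OF X] has_derivative_vecD[OF Y])
  then have D: "((\<lambda>w. bil (g (b w)) (X w) (Y w)) has_derivative (\<lambda>A. (\<Sum>i\<in>UNIV. \<Sum>j\<in>UNIV. ?D A i j * X w $ i * Y w $ j)
      + bil (g (b w)) (X' A) (Y w) + bil (g (b w)) (X w) (Y' A))) (at w)"
    unfolding bil_sum
    by (rule has_derivative_eq_rhs) (simp add: fun_eq_iff distrib_right sum.distrib)
  have "(\<Sum>i\<in>UNIV. \<Sum>j\<in>UNIV. ?D A i j * X w $ i * Y w $ j)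
      = bil (g (b w)) (gamma g (b w) (b' A) (X w)) (Y w) + bil (g (b w)) (X w) (gamma g (b w) (b' A) (Y w))" for A
  proof -
    let ?c = "christoffel g (b w)"
    (* The sums over l, j, a, i are reordered to i, j, a, l, so that the sum over l is the contraction
       in the formula for the derivative of g. *)
    have 1: "bil (g (b w)) (gamma g (b w) (b' A) U) V = (\<Sum>i\<in>UNIV. \<Sum>j\<in>UNIV.
        (\<Sum>a\<in>UNIV. b' A $ a * (\<Sum>l\<in>UNIV. ?c l a i * g (b w) $ l $ j)) * U $ i * V $ j)" for U V
    proof -
      have "bil (g (b w)) (gamma g (b w) (b' A) U) V = (\<Sum>l\<in>UNIV. \<Sum>j\<in>UNIV. \<Sum>a\<in>UNIV. \<Sum>i\<in>UNIV.
          ?c l a i * b' A $ a * U $ i * g (b w) $ l $ j * V $ j)"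
        by (simp add: bil_sum gamma_def sum_distrib_left sum_distrib_right mult_ac)
      also have "\<dots> = (\<Sum>j\<in>UNIV. \<Sum>l\<in>UNIV. \<Sum>i\<in>UNIV. \<Sum>a\<in>UNIV.
          ?c l a i * b' A $ a * U $ i * g (b w) $ l $ j * V $ j)"
        by (subst sum.swap) (intro sum.cong refl sum.swap)
      also have "\<dots> = (\<Sum>j\<in>UNIV. \<Sum>i\<in>UNIV. \<Sum>l\<in>UNIV. \<Sum>a\<in>UNIV.
          ?c l a i * b' A $ a * U $ i * g (b w) $ l $ j * V $ j)"
        by (intro sum.cong refl sum.swap)
      also have "\<dots> = (\<Sum>i\<in>UNIV. \<Sum>j\<in>UNIV. \<Sum>a\<in>UNIV. \<Sum>l\<in>UNIV.
          ?c l a i * b' A $ a * U $ i * g (b w) $ l $ j * V $ j)"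
        by (subst sum.swap) (intro sum.cong refl sum.swap)
      finally show ?thesis
        by (simp add: sum_distrib_left sum_distrib_right mult_ac)
    qed
    have "g (b w) $ i $ l = g (b w) $ l $ i" for i l
      using sym[OF w] by (metis transpose_def vec_lambda_beta)
    then have 2: "?D A i j = (\<Sum>a\<in>UNIV. b' A $ a * (\<Sum>l\<in>UNIV. ?c l a i * g (b w) $ l $ j))
        + (\<Sum>a\<in>UNIV. b' A $ a * (\<Sum>l\<in>UNIV. ?c l a j * g (b w) $ l $ i))" for i j
      by (simp add: christoffel_levi_civita(2)[OF w] distrib_left sum.distrib)
    show ?thesis
      unfolding 2 distrib_right sum.distrib bil_sym[OF sym[OF w], of "X w" "gamma g (b w) (b' A) (Y w)"] 1
      by (subst (4) sum.swap) (simp add: mult_ac)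
  qed
  with D show ?thesis by (simp add: algebra_simps)
qed

lemma curvature_eq:
  assumes x: "x \<in> S"
  shows "curvature g x X Y Z W = bil (g x) (curv g x X Y Z) W"
proof -
  have 1: "nabla g (\<lambda>_. X) (nabla g (\<lambda>_. Y) (\<lambda>_. Z)) x
      = dgamma g x X Y Z + gamma g x X (gamma g x Y Z)" for X Y
    using nabla_eq[OF gamma_derivative_const[OF x], of g "\<lambda>_. X" Y Z]
    by (simp add: nabla_const_const[abs_def])
  have 2: "lie_bracket (\<lambda>_. X) (\<lambda>_. Y) = (\<lambda>_. 0)"
    by (simp add: fun_eq_iff lie_bracket_def pd_const vec_eq_iff)
  show ?thesis
    by (simp add: curvature_def curvature_op_def 1 2 nabla_const_const curv_def algebra_simps)
qed

lemma curv_bianchi: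
  assumes "x \<in> S"
  shows "curv g x X Y Z + curv g x Y Z X + curv g x Z X Y = 0"
  using dgamma_sym[OF assms] gamma_sym[OF assms] unfolding curv_def by (simp add: algebra_simps)

text \<open>The second derivative of \<open>g(Z, W)\<close> in directions \<open>X\<close> and \<open>Y\<close> is symmetric; its antisymmetric part,
  computed with the product rule \<open>has_derivative_bil\<close>, is \<open>R(X, Y)\<close> acting on both arguments.\<close>

lemma curv_metric_skew:
  assumes x: "x \<in> S"
  shows "bil (g x) (curv g x X Y Z) W = - bil (g x) Z (curv g x X Y W)"
proof -
  define D where "D Y X = bil (g x) (dgamma g x X Y Z + gamma g x X (gamma g x Y Z)) W
    + bil (g x) (gamma g x Y Z) (gamma g x X W) + bil (g x) (gamma g x X Z) (gamma g x Y W)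
    + bil (g x) Z (dgamma g x X Y W + gamma g x X (gamma g x Y W))" for X Y
  have "((\<lambda>z. bil (g z) (gamma g z Y Z) W + bil (g z) Z (gamma g z Y W)) has_derivative D Y) (at x)" for Y
    using has_derivative_add[OF
      has_derivative_bil[of "\<lambda>z. z" x "\<lambda>A. A", OF x has_derivative_ident gamma_derivative_const[OF x, of Y Z] has_derivative_const[of W]]
      has_derivative_bil[of "\<lambda>z. z" x "\<lambda>A. A", OF x has_derivative_ident has_derivative_const[of Z] gamma_derivative_const[OF x, of Y W]]]
    by (rule has_derivative_eq_rhs) (simp add: D_def fun_eq_iff algebra_simps)
  moreover have "((\<lambda>z. bil (g z) Z W) has_derivative
      (\<lambda>Y. bil (g z) (gamma g z Y Z) W + bil (g z) Z (gamma g z Y W))) (at z)" if "z \<in> S" for z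
    using has_derivative_bil[of "\<lambda>z. z" z "\<lambda>A. A" "\<lambda>_. Z" "\<lambda>_. 0" "\<lambda>_. W" "\<lambda>_. 0", OF that] by simp
  moreover have "smooth_on S (\<lambda>z. bil (g z) Z W)"
    unfolding bil_sum using smooth_g open_S
    by (intro smooth_on_sum smooth_on_mult smooth_on_const) (auto simp: smooth_matrix_on_def)
  ultimately have "D Y X = D X Y"
    using second_derivative_symmetric[OF _ open_S x, of "\<lambda>z. bil (g z) Z W"
      "\<lambda>z Y. bil (g z) (gamma g z Y Z) W + bil (g z) Z (gamma g z Y W)" D] by blast
  then show ?thesis
    unfolding D_def curv_def by (simp add: algebra_simps)
qed

text \<open>The classical combination of the first Bianchi identity for the four cyclic arrangements of
  \<open>X, Y, Z, W\<close>, all terms being reduced to six by the two skew symmetries.\<close>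

lemma curv_pair_sym:
  assumes x: "x \<in> S"
  shows "bil (g x) (curv g x X Y Z) W = bil (g x) (curv g x Z W X) Y"
proof -
  define R where "R X Y Z W = bil (g x) (curv g x X Y Z) W" for X Y Z W
  have 1: "R X Y Z W = - R Y X Z W" for X Y Z W
    by (simp add: R_def curv_skew[of g x Y X])
  have 2: "R X Y Z W = - R X Y W Z" for X Y Z W
    unfolding R_def using curv_metric_skew[OF x, of X Y Z W] bil_sym[OF sym[OF x]] by metis
  have 3: "R X Y Z W + R Y Z X W + R Z X Y W = 0" for X Y Z W
    using arg_cong[OF curv_bianchi[OF x, of X Y Z], of "\<lambda>V. bil (g x) V W"] by (simp add: R_def)
  have "R Y Z W X = - R Y Z X W" "R Z W Y X = - R Z W X Y" "R W Y Z X = - R Y W Z X"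
    "R W X Z Y = R X W Y Z" "R X Z W Y = R Z X Y W"
    "R W X Y Z = - R X W Y Z" "R X Y W Z = - R X Y Z W" "R Y W X Z = - R Y W Z X"
    using 1 2 by (metis minus_minus)+
  with 3[of X Y Z W] 3[of Y Z W X] 3[of Z W X Y] 3[of W X Y Z]
  have "R X Y Z W = R Z W X Y"
    by linarith
  then show ?thesis by (simp add: R_def)
qed

end


section \<open>Metric traces\<close>

text \<open>As the trace of a matrix product, the contraction can be moved along linear maps by cyclicity.\<close>

lemma metric_trace_eq_trace:
  "metric_trace G T = trace (matrix_inv G ** transpose (\<chi> i j. T (axis i 1) (axis j 1)))"
  by (simp add: metric_trace_def trace_def matrix_matrix_mult_def transpose_def)

lemma inner_transpose_mult: "X \<bullet> (transpose P *v Z) = (P *v X) \<bullet> (Z :: real^'k::finite)"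
  unfolding transpose_matrix_vector
  by (subst inner_commute, subst dot_lmul_matrix, rule inner_commute)

lemma bil_transpose_mult: "bil (transpose P ** G ** Q) X Y = bil G (P *v X) (Q *v Y)"
  unfolding bil_def matrix_vector_mul_assoc[symmetric] inner_transpose_mult ..

lemma bil_axis: "bil G (axis i 1) (axis j 1) = G $ i $ j"
  by (simp add: bil_def matrix_vector_mult_basis inner_axis' column_def)

lemma bil_eqI:
  assumes "\<And>X Y. bil G X Y = bil H X Y"
  shows "G = H"
proof -
  have "G $ i $ j = H $ i $ j" for i j
    using assms[of "axis i 1" "axis j 1"] unfolding bil_axis .
  then show ?thesis by (simp add: vec_eq_iff)
qed

lemma bilinear_matrix_pullback:
  fixes P Q :: "real^'d::finite^'e::finite" and T :: "real^'e \<Rightarrow> real^'e \<Rightarrow> real"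
  assumes "bilinear T"
  shows "(\<chi> i j. T (P *v axis i 1) (Q *v axis j 1))
    = transpose P ** (\<chi> a b. T (axis a 1) (axis b 1)) ** Q"
  by (simp add: vec_eq_iff bil_matrix_eqI[OF assms] bil_transpose_mult flip: bil_axis[of "transpose P ** _ ** Q"])

lemma metric_trace_pullback:
  fixes P :: "real^'d::finite^'e::finite" and T :: "real^'e \<Rightarrow> real^'e \<Rightarrow> real"
  assumes "bilinear T"
  shows "trace (P ** matrix_inv G ** transpose P ** transpose (\<chi> a b. T (axis a 1) (axis b 1)))
    = metric_trace G (\<lambda>X Y. T (P *v X) (P *v Y))"
proof -
  let ?T = "\<chi> a b. T (axis a 1) (axis b 1)"
  have "trace (P ** (matrix_inv G ** transpose P ** transpose ?T))
      = trace (matrix_inv G ** transpose P ** transpose ?T ** P)"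
    by (rule trace_mul_sym)
  also have "matrix_inv G ** transpose P ** transpose ?T ** P
      = matrix_inv G ** transpose (transpose P ** ?T ** P)"
    by (simp add: matrix_transpose_mul transpose_transpose matrix_mul_assoc)
  finally show ?thesis
    by (simp add: metric_trace_eq_trace bilinear_matrix_pullback[OF assms] matrix_mul_assoc)
qed

lemma metric_trace_add: "metric_trace G (\<lambda>X Y. T X Y + U X Y) = metric_trace G T + metric_trace G U"
  by (simp add: metric_trace_def distrib_left sum.distrib)

lemma metric_trace_minus: "metric_trace G (\<lambda>X Y. - T X Y) = - metric_trace G T"
  by (simp add: metric_trace_def sum_negf)

lemma metric_trace_scale: "metric_trace G (\<lambda>X Y. r * T X Y) = r * metric_trace G T"
  by (simp add: metric_trace_def sum_distrib_left mult.left_commute)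

lemma symmetric_matrix_inv:
  fixes G :: "real^'d^'d::finite"
  assumes "invertible G" "transpose G = G"
  shows "transpose (matrix_inv G) = matrix_inv G"
proof -
  have "G ** transpose (matrix_inv G) = transpose (matrix_inv G ** G)"
    by (simp add: matrix_transpose_mul assms(2))
  then have "G ** transpose (matrix_inv G) = mat 1"
    by (simp add: matrix_inv_cancel[OF assms(1)] transpose_mat)
  then show ?thesis by (rule matrix_inv_unique[symmetric])
qed

lemma metric_trace_swap:
  fixes G :: "real^'d^'d::finite"
  assumes "invertible G" "transpose G = G"
  shows "metric_trace G (\<lambda>X Y. T Y X) = metric_trace G T"
proof -
  have "matrix_inv G $ i $ j = matrix_inv G $ j $ i" for i j
    using arg_cong[OF symmetric_matrix_inv[OF assms], of "\<lambda>A. A $ j $ i"] by (simp add: transpose_def)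
  then show ?thesis
    unfolding metric_trace_def
    by (subst sum.swap) (intro sum.cong refl arg_cong2[where f = "(*)"])
qed

lemma metric_trace_skew:
  fixes G :: "real^'d^'d::finite"
  assumes "invertible G" "transpose G = G" "\<And>X Y. T Y X = - T X Y"
  shows "metric_trace G T = 0"
proof -
  have "(\<lambda>X Y. T Y X) = (\<lambda>X Y. - T X Y)"
    by (intro ext) (rule assms(3))
  then have "metric_trace G T = metric_trace G (\<lambda>X Y. - T X Y)"
    using metric_trace_swap[OF assms(1,2), of T] by (simp only:)
  then show ?thesis
    unfolding metric_trace_minus by simp
qed

text \<open>For a self-adjoint \<open>J\<close> the inverse metric satisfies \<open>G\<^sup>-\<^sup>1 J\<^sup>T = J G\<^sup>-\<^sup>1\<close>, so \<open>J\<close> can change the slot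
  under the trace.\<close>

lemma metric_trace_selfadjoint:
  fixes G :: "real^'d^'d::finite"
  assumes G: "invertible G" and T: "bilinear T"
    and J: "\<And>X Y. bil G (J *v X) Y = bil G X (J *v Y)"
  shows "metric_trace G (\<lambda>X Y. T X (J *v Y)) = metric_trace G (\<lambda>X Y. T (J *v X) Y)"
proof -
  let ?T = "\<chi> a b. T (axis a 1) (axis b 1)" and ?N = "matrix_inv G"
  have "transpose J ** G = G ** J"
    using J bil_transpose_mult[of J G "mat 1"] bil_transpose_mult[of "mat 1" G J]
    by (intro bil_eqI) (simp add: transpose_mat)
  then have "?N ** (transpose J ** G) ** ?N = ?N ** (G ** J) ** ?N" by simp
  also have "\<dots> = J ** ?N"
    by (simp add: matrix_mul_assoc matrix_inv_cancel G)
  also have "?N ** (transpose J ** G) ** ?N = ?N ** transpose J"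
    by (simp add: matrix_inv_cancel G flip: matrix_mul_assoc)
  finally have NJ: "?N ** transpose J = J ** ?N" .
  have 1: "(\<chi> i j. T (axis i 1) (J *v axis j 1)) = ?T ** J"
    using bilinear_matrix_pullback[OF T, of "mat 1" J] by (simp add: transpose_mat)
  have 2: "(\<chi> i j. T (J *v axis i 1) (axis j 1)) = transpose J ** ?T"
    using bilinear_matrix_pullback[OF T, of J "mat 1"] by (simp add: transpose_mat)
  have "trace (J ** (?N ** transpose ?T)) = trace (?N ** transpose ?T ** J)"
    by (rule trace_mul_sym)
  then show ?thesis
    by (simp add: metric_trace_eq_trace 1 2 matrix_transpose_mul transpose_transpose matrix_mul_assoc NJ)
qed


section \<open>Uniqueness of the Levi-Civita connection\<close>

lemma bilinear_vec:
  fixes B :: "real^'d::finite \<Rightarrow> real^'d \<Rightarrow> real^'k::finite"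
  assumes "bilinear B"
  shows "B X Y $ k = (\<Sum>i\<in>UNIV. \<Sum>j\<in>UNIV. B (axis i 1) (axis j 1) $ k * X $ i * Y $ j)"
proof -
  have "bilinear (\<lambda>X Y. B X Y $ k)"
    using assms by (auto simp: bilinear_def linear_iff)
  from bil_matrix_eqI[OF this] show ?thesis
    by (simp add: bil_sum)
qed

text \<open>The Levi-Civita connection is characterised by symmetry and metric compatibility, stated for vectors
  instead of index families.  All Christoffel symbols below are identified in this way.\<close>

lemma levi_civita_unique:
  fixes g :: "real^'d::finite \<Rightarrow> real^'d^'d"
  assumes inv: "invertible (g x)" and S: "open S" "x \<in> S"
    and sym: "\<And>z. z \<in> S \<Longrightarrow> transpose (g z) = g z"
    and B: "bilinear B" and torsion_free: "\<And>X Y. B X Y = B Y X"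
    and metric: "\<And>X Y. ((\<lambda>z. bil (g z) X Y) has_derivative
      (\<lambda>A. bil (g x) (B A X) Y + bil (g x) X (B A Y))) (at x)"
  shows "gamma g x X Y = B X Y"
proof -
  define G where "G k i j = B (axis i 1) (axis j 1) $ k" for k i j
  have "pd k (\<lambda>z. g z $ i $ j) x
      = (\<Sum>l\<in>UNIV. G l k i * g x $ l $ j) + (\<Sum>l\<in>UNIV. G l k j * g x $ i $ l)" for k i j
    using pd_has_derivative[OF metric[of "axis i 1" "axis j 1"], of k]
    unfolding bil_axis
    by (simp add: bil_def matrix_vector_mult_basis column_def inner_vec_def inner_axis'
        matrix_vector_mult_def G_def mult.commute)
  moreover have "G k i j = G k j i" for k i j
    unfolding G_def by (subst torsion_free) simp
  ultimately have eq: "christoffel g x k i j = B (axis i 1) (axis j 1) $ k" for k i j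
    using christoffel_iff_torsion_free_metric[of g x S G, OF inv S sym] unfolding G_def by metis
  have "gamma g x X Y $ k = B X Y $ k" for k
    unfolding gamma_def vec_lambda_beta eq by (rule bilinear_vec[OF B, symmetric])
  then show ?thesis
    by (simp add: vec_eq_iff)
qed


section \<open>The Levi-Civita connection of the Sasaki metric\<close>

lemma linear_xpart: "linear xpart" and linear_ypart: "linear ypart"
  by (auto intro!: linearI)

lemmas part_linear_simps [simp] = linear_xpart[THEN linear_diff] linear_ypart[THEN linear_diff]
  linear_xpart[THEN linear_neg] linear_ypart[THEN linear_neg] linear_xpart[THEN linear_0] linear_ypart[THEN linear_0]

lemma has_derivative_parts:
  "(xpart has_derivative hcomp) F" "(ypart has_derivative ypart) F"
  by (auto simp: hcomp_def[abs_def] intro!: linear_imp_has_derivative linear_xpart linear_ypart)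

lemma join_eq_iff: "join x y = join x' y' \<longleftrightarrow> x = x' \<and> y = y'"
  by (metis join_simps(1,2))

lemma has_derivative_join:
  assumes "(X has_derivative X') F" "(Y has_derivative Y') F"
  shows "((\<lambda>z. join (X z) (Y z)) has_derivative (\<lambda>A. join (X' A) (Y' A))) F"
proof (rule has_derivative_vecI)
  fix k :: "'b + 'b"
  show "((\<lambda>z. join (X z) (Y z) $ k) has_derivative (\<lambda>A. join (X' A) (Y' A) $ k)) F"
    using assms by (cases k) (auto simp: join_def intro: has_derivative_vecD)
qed

lemma lift_eq_join: "horiz g w X + vert Y = join X (Y - gamma g (xpart w) (ypart w) X)"
  by (simp add: horiz_def vert_def Gamma_y_eq)

lemma vcomp_eq: "vcomp g w A = ypart A + gamma g (xpart w) (ypart w) (hcomp A)"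
  by (simp add: vcomp_def Gamma_y_eq hcomp_def)

lemmas lift_linear =
  linear_vert[THEN linear_add] linear_vert[THEN linear_diff] linear_vert[THEN linear_neg]
  linear_vert[THEN linear_0] linear_vert[THEN linear_cmul]
  linear_horiz[THEN linear_add] linear_horiz[THEN linear_diff] linear_horiz[THEN linear_neg]
  linear_horiz[THEN linear_0] linear_horiz[THEN linear_cmul]

lemmas comp_linear [simp] =
  linear_hcomp[THEN linear_add] linear_hcomp[THEN linear_diff] linear_hcomp[THEN linear_neg]
  linear_hcomp[THEN linear_0] linear_hcomp[THEN linear_cmul]
  linear_vcomp[THEN linear_add] linear_vcomp[THEN linear_diff] linear_vcomp[THEN linear_neg]
  linear_vcomp[THEN linear_0] linear_vcomp[THEN linear_cmul]

text \<open>The covariant derivative along \<open>A\<close> of the field with constant components \<open>B\<close>, obtained from the formulas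
  for lifts.  Such a field is the horizontal lift of the constant \<open>hcomp B\<close> plus the vertical lift of
  \<open>vcomp g w B\<close>; the latter varies with \<open>w\<close>, and its derivative contributes the terms with \<open>dgamma\<close> and
  with \<open>ypart A\<close>.\<close>

definition sasaki_gamma ::
  "(real^'d \<Rightarrow> real^'d^'d::finite) \<Rightarrow> real^('d + 'd) \<Rightarrow> real^('d + 'd) \<Rightarrow> real^('d + 'd) \<Rightarrow> real^('d + 'd)"
  where "sasaki_gamma g w A B =
    (let x = xpart w; u = ypart w in
      horiz g w (gamma g x (hcomp A) (hcomp B)
        + (1/2) *\<^sub>R (curv g x u (vcomp g w A) (hcomp B) + curv g x u (vcomp g w B) (hcomp A)))
      + vert (dgamma g x (hcomp A) u (hcomp B) + gamma g x (ypart A) (hcomp B)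
        + gamma g x (hcomp A) (vcomp g w B) - (1/2) *\<^sub>R curv g x (hcomp A) (hcomp B) u))"

lemma lift_cancel: "horiz g w (hcomp A) + vert (vcomp g w A) = A"
  using horiz_vert_decomp[of A g w "hcomp A" "vcomp g w A"] by simp

lemma lift_eq_iff:
  "horiz g w X + vert Y = horiz g w X' + vert Y' \<longleftrightarrow> X = X' \<and> Y = Y'"
  unfolding horiz_vert_decomp by auto

lemma bilinear_sasaki_gamma: "bilinear (sasaki_gamma g w)"
  unfolding bilinear_def sasaki_gamma_def Let_def
  by (auto intro!: linearI simp: lift_linear algebra_simps)

definition horiz_matrix :: "(real^'d \<Rightarrow> real^'d^'d::finite) \<Rightarrow> real^('d + 'd) \<Rightarrow> real^'d^('d + 'd)" where
  "horiz_matrix g w = matrix (horiz g w)"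

definition vert_matrix :: "real^'d^('d::finite + 'd)" where
  "vert_matrix = matrix vert"

lemma lift_matrix_apply: "horiz_matrix g w *v X = horiz g w X" "vert_matrix *v X = vert X"
  by (simp_all add: horiz_matrix_def vert_matrix_def linear_horiz linear_vert matrix_works
      linear_matrix_vector_mul_eq)

text \<open>The lifts of a base frame form a frame in which the Sasaki metric consists of two copies of \<open>g\<close>, so
  its inverse is the inverse of \<open>g\<close> pushed forward along both lifts.\<close>

lemma sasaki_inverse:
  fixes g :: "('c, 'd::finite) tensor" and w c
  defines "H \<equiv> horiz_matrix (g c) w" and "V \<equiv> vert_matrix :: real^'d^('d + 'd)"
    and "Q \<equiv> matrix_inv (g c (xpart w))"
  assumes inv: "invertible (g c (xpart w))"
  shows "(H ** Q ** transpose H + V ** Q ** transpose V) ** sasaki g c w = mat 1"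
proof -
  have eqI: "a = b" if "\<And>X. X \<bullet> a = X \<bullet> b" for a b :: "real^'d"
    using that vector_eq_ldot[of a b] by blast
  have 1: "transpose H *v (sasaki g c w *v A) = g c (xpart w) *v hcomp A" for A
  proof (rule eqI)
    fix X
    have "X \<bullet> (transpose H *v (sasaki g c w *v A)) = bil (sasaki g c w) (H *v X) A"
      by (simp add: bil_def dot_lmul_matrix flip: vector_transpose_matrix) 
    then show "X \<bullet> (transpose H *v (sasaki g c w *v A)) = X \<bullet> (g c (xpart w) *v hcomp A)"
      by (simp add: H_def lift_matrix_apply sasaki_apply) (simp add: bil_def)
  qed
  have 2: "transpose V *v (sasaki g c w *v A) = g c (xpart w) *v vcomp (g c) w A" for A
  proof (rule eqI)
    fix X
    have "X \<bullet> (transpose V *v (sasaki g c w *v A)) = bil (sasaki g c w) (V *v X) A"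
      by (simp add: bil_def dot_lmul_matrix flip: vector_transpose_matrix) 
    then show "X \<bullet> (transpose V *v (sasaki g c w *v A)) = X \<bullet> (g c (xpart w) *v vcomp (g c) w A)"
      by (simp add: V_def lift_matrix_apply sasaki_apply) (simp add: bil_def)
  qed
  have Q: "Q *v (g c (xpart w) *v X) = X" for X
    by (simp add: Q_def matrix_vector_mul_assoc matrix_inv_cancel inv)
  have "((H ** Q ** transpose H + V ** Q ** transpose V) ** sasaki g c w) *v A = mat 1 *v A" for A
    by (simp only: matrix_vector_mult_add_rdistrib matrix_vector_mul_assoc[symmetric] 1 2 Q)
      (simp add: H_def V_def lift_matrix_apply lift_cancel)
  then show ?thesis by (simp add: matrix_eq)
qed

lemma invertible_sasaki:
  assumes "invertible (g c (xpart w))"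
  shows "invertible (sasaki g c w)"
  unfolding invertible_left_inverse[of "sasaki g c w"]
  by (rule exI, rule sasaki_inverse[of g c w, OF assms])

lemma sasaki_symmetric:
  assumes "transpose (g c (xpart w)) = g c (xpart w)"
  shows "transpose (sasaki g c w) = sasaki g c w"
  by (simp add: sasaki_def transpose_def vec_eq_iff bil_sym[OF assms])

lemma matrix_add_mult_distrib: "(A + B) ** (C :: real^'k^'l::finite) = A ** C + B ** C"
  by (simp add: matrix_matrix_mult_def vec_eq_iff distrib_right sum.distrib)

lemma metric_trace_sasaki:
  fixes T :: "real^('d::finite + 'd) \<Rightarrow> real^('d + 'd) \<Rightarrow> real"
  assumes inv: "invertible (g c (xpart w))" and T: "bilinear T"
  shows "metric_trace (sasaki g c w) T
    = metric_trace (g c (xpart w)) (\<lambda>X Y. T (horiz (g c) w X) (horiz (g c) w Y))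
    + metric_trace (g c (xpart w)) (\<lambda>X Y. T (vert X) (vert Y))"
proof -
  let ?H = "horiz_matrix (g c) w" and ?V = "vert_matrix :: real^'d^('d + 'd)"
    and ?Q = "matrix_inv (g c (xpart w))"
  have "sasaki g c w ** (?H ** ?Q ** transpose ?H + ?V ** ?Q ** transpose ?V) = mat 1"
    by (subst matrix_left_right_inverse) (rule sasaki_inverse[of g c w, OF inv])
  then have I: "matrix_inv (sasaki g c w) = ?H ** ?Q ** transpose ?H + ?V ** ?Q ** transpose ?V"
    by (rule matrix_inv_unique)
  let ?T = "transpose (\<chi> a b. T (axis a 1) (axis b 1))"
  have "metric_trace (sasaki g c w) T
      = trace ((?H ** ?Q ** transpose ?H + ?V ** ?Q ** transpose ?V) ** ?T)"
    unfolding I[symmetric] by (rule metric_trace_eq_trace[of "sasaki g c w" T])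
  also have "\<dots> = trace (?H ** ?Q ** transpose ?H ** ?T) + trace (?V ** ?Q ** transpose ?V ** ?T)"
    unfolding matrix_add_mult_distrib by (rule trace_add)
  also have "trace (?H ** ?Q ** transpose ?H ** ?T)
      = metric_trace (g c (xpart w)) (\<lambda>X Y. T (horiz (g c) w X) (horiz (g c) w Y))"
    using metric_trace_pullback[OF T, of ?H "g c (xpart w)"] by (simp only: lift_matrix_apply)
  also have "trace (?V ** ?Q ** transpose ?V ** ?T)
      = metric_trace (g c (xpart w)) (\<lambda>X Y. T (vert X) (vert Y))"
    using metric_trace_pullback[OF T, of ?V "g c (xpart w)"] by (simp only: lift_matrix_apply)
  finally show ?thesis .
qed

lemma open_xpart_vimage:
  assumes "open S"
  shows "open {w. xpart w \<in> S}"
proof -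
  have "continuous_on UNIV (xpart :: real^('a + 'a) \<Rightarrow> real^'a)"
    by (rule linear_continuous_on[OF linear_conv_bounded_linear[THEN iffD1, OF linear_xpart]])
  from open_vimage[OF assms this] show ?thesis by (simp add: vimage_def)
qed

locale tangent_chart = metric_chart "g c" S for g :: "('c, 'd::finite) tensor" and c S
begin

abbreviation "TS \<equiv> {w. xpart w \<in> S}"

lemmas open_TS = open_xpart_vimage[OF open_S]

lemma has_derivative_vcomp:
  assumes "xpart w \<in> S"
  shows "((\<lambda>z. vcomp (g c) z B) has_derivative (\<lambda>A. dgamma (g c) (xpart w) (hcomp A) (ypart w) (hcomp B)
    + gamma (g c) (xpart w) (ypart A) (hcomp B))) (at w)"
  unfolding vcomp_eq
  using has_derivative_add[OF has_derivative_const[of "ypart B"]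
      gamma_derivative[of xpart, OF assms has_derivative_parts has_derivative_const[of "hcomp B"]]]
  by simp

text \<open>The frame of lifts itself depends on the point: differentiating the horizontal lift produces the vertical
  corrections.\<close>

lemma has_derivative_lift:
  assumes w: "xpart w \<in> S"
    and X: "(X has_derivative X') (at w)" and Y: "(Y has_derivative Y') (at w)"
  shows "((\<lambda>z. horiz (g c) z (X z) + vert (Y z)) has_derivative
    (\<lambda>A. horiz (g c) w (X' A) + vert (Y' A - dgamma (g c) (xpart w) (hcomp A) (ypart w) (X w)
      - gamma (g c) (xpart w) (ypart A) (X w)))) (at w)"
  unfolding lift_eq_join
  by (rule has_derivative_eq_rhs[OF has_derivative_join[OF X has_derivative_diff[OF Y
      gamma_derivative[of xpart, OF w has_derivative_parts X]]]])
    (simp add: algebra_simps)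

text \<open>Torsion freeness is the definition of the curvature, written with symmetric Christoffel symbols.  In the
  compatibility with the metric the terms without curvature are the compatibility of \<open>g\<close>, and those with
  curvature cancel by skew symmetry and by pair symmetry.\<close>

lemma gamma_sasaki:
  assumes w: "xpart w \<in> S"
  shows "gamma (sasaki g c) w A B = sasaki_gamma (g c) w A B"
proof (rule levi_civita_unique[of _ _ TS])
  let ?x = "xpart w" and ?u = "ypart w"
  show "invertible (sasaki g c w)" "w \<in> TS"
    using w by (simp_all add: invertible_sasaki inv)
  show "open TS" by (rule open_TS)
  show "transpose (sasaki g c z) = sasaki g c z" if "z \<in> TS" for z
    using that by (simp add: sasaki_symmetric sym)
  show "bilinear (sasaki_gamma (g c) w)" by (rule bilinear_sasaki_gamma)
  show "sasaki_gamma (g c) w A B = sasaki_gamma (g c) w B A" for A B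
  proof -
    have "curv (g c) ?x X Y ?u = dgamma (g c) ?x X ?u Y - dgamma (g c) ?x Y ?u X
        + gamma (g c) ?x X (gamma (g c) ?x ?u Y) - gamma (g c) ?x Y (gamma (g c) ?x ?u X)" for X Y
      by (simp add: curv_def gamma_sym[OF w, of _ ?u] dgamma_sym[OF w, of _ _ ?u])
    note c = this[of "hcomp A" "hcomp B"]
    (* Half of the curvature term, so that both sides become sums of the same atoms. *)
    define h where "h = (1/2) *\<^sub>R curv (g c) ?x (hcomp A) (hcomp B) ?u"
    have hh: "curv (g c) ?x (hcomp A) (hcomp B) ?u = h + h"
      by (simp add: h_def flip: scaleR_add_left)
    have h: "(1/2) *\<^sub>R (h + h) = h"
      by (simp flip: hh h_def)
    have p: "dgamma (g c) ?x (hcomp A) ?u (hcomp B) = h + h + dgamma (g c) ?x (hcomp B) ?u (hcomp A)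
        - gamma (g c) ?x (hcomp A) (gamma (g c) ?x ?u (hcomp B))
        + gamma (g c) ?x (hcomp B) (gamma (g c) ?x ?u (hcomp A))"
      using c unfolding hh by (simp add: algebra_simps)
    have q: "gamma (g c) ?x (ypart A) (hcomp B) = gamma (g c) ?x (hcomp B) (ypart A)"
      "gamma (g c) ?x (ypart B) (hcomp A) = gamma (g c) ?x (hcomp A) (ypart B)"
      by (rule gamma_sym[OF w])+
    have "dgamma (g c) ?x (hcomp A) ?u (hcomp B) + gamma (g c) ?x (ypart A) (hcomp B)
        + gamma (g c) ?x (hcomp A) (vcomp (g c) w B) - (1/2) *\<^sub>R curv (g c) ?x (hcomp A) (hcomp B) ?u
      = dgamma (g c) ?x (hcomp B) ?u (hcomp A) + gamma (g c) ?x (ypart B) (hcomp A)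
        + gamma (g c) ?x (hcomp B) (vcomp (g c) w A) - (1/2) *\<^sub>R curv (g c) ?x (hcomp B) (hcomp A) ?u"
      unfolding curv_skew[of "g c" ?x "hcomp B" "hcomp A"] hh scaleR_minus_right h q p
      by (simp add: vcomp_eq)
    then show ?thesis
      unfolding sasaki_gamma_def Let_def lift_eq_iff
      by (simp add: gamma_sym[OF w, of "hcomp A" "hcomp B"] add.commute)
  qed
  show "((\<lambda>z. bil (sasaki g c z) B C) has_derivative
      (\<lambda>A. bil (sasaki g c w) (sasaki_gamma (g c) w A B) C
         + bil (sasaki g c w) B (sasaki_gamma (g c) w A C))) (at w)" for B C
  proof -
    let ?R = "\<lambda>X Y Z W. bil (g c ?x) (curv (g c) ?x X Y Z) W"
    note D = has_derivative_add[OF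
      has_derivative_bil[of xpart, OF w has_derivative_parts(1) has_derivative_const[of "hcomp B"]
        has_derivative_const[of "hcomp C"]]
      has_derivative_bil[of xpart, OF w has_derivative_parts(1) has_derivative_vcomp[OF w, of B]
        has_derivative_vcomp[OF w, of C]]]
    have 1: "bil (g c ?x) X Y = bil (g c ?x) Y X" for X Y
      by (rule bil_sym[OF sym[OF w]])
    have 2: "?R X Y Z W = - ?R X Y W Z" for X Y Z W
      using curv_metric_skew[OF w, of X Y Z W] 1 by metis
    have 3: "?R (hcomp A) (hcomp B) ?u W = ?R ?u W (hcomp A) (hcomp B)" for A B W
      by (rule curv_pair_sym[OF w])
    show ?thesis
      unfolding sasaki_apply
    proof (rule has_derivative_eq_rhs[OF D], rule ext, goal_cases)
      case (1 A)
      have "?R ?u (vcomp (g c) w A) (hcomp C) (hcomp B) = - ?R ?u (vcomp (g c) w A) (hcomp B) (hcomp C)"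
        "?R ?u (vcomp (g c) w C) (hcomp A) (hcomp B) = ?R (hcomp A) (hcomp B) ?u (vcomp (g c) w C)"
        "?R ?u (vcomp (g c) w B) (hcomp A) (hcomp C) = ?R (hcomp A) (hcomp C) ?u (vcomp (g c) w B)"
        by (rule 2, rule 3[symmetric], rule 3[symmetric])
      note facts = this
      have L: "bil (g c ?x) (hcomp B) (curv (g c) ?x X Y Z) = bil (g c ?x) (curv (g c) ?x X Y Z) (hcomp B)"
        "bil (g c ?x) (vcomp (g c) w B) (curv (g c) ?x X Y Z) = bil (g c ?x) (curv (g c) ?x X Y Z) (vcomp (g c) w B)" for X Y Z
        by (rule bil_sym[OF sym[OF w]])+
      show ?case
        unfolding sasaki_gamma_def Let_def comp_linear comp_lift add_0_left add_0_right bil_simps L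
        by (simp add: facts) (simp add: add_divide_distrib diff_divide_distrib)
    qed
  qed
qed

text \<open>The formulas for the Levi-Civita connection of the Sasaki metric on arbitrary combinations of lifts.  The
  corrections coming from the motion of the frame have disappeared.\<close>

lemma nabla_sasaki_lift:
  fixes w A
  defines "x \<equiv> xpart w" and "u \<equiv> ypart w"
  assumes w: "xpart w \<in> S"
    and X: "(X has_derivative X') (at w)" and Y: "(Y has_derivative Y') (at w)"
  shows "nabla (sasaki g c) (\<lambda>_. A) (\<lambda>z. horiz (g c) z (X z) + vert (Y z)) w
    = horiz (g c) w (X' A + gamma (g c) x (hcomp A) (X w)
        + (1/2) *\<^sub>R (curv (g c) x u (vcomp (g c) w A) (X w) + curv (g c) x u (Y w) (hcomp A)))
    + vert (Y' A + gamma (g c) x (hcomp A) (Y w) - (1/2) *\<^sub>R curv (g c) x (hcomp A) (X w) u)"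
  by (simp add: nabla_eq[OF has_derivative_lift[OF w X Y]] gamma_sasaki[OF w] sasaki_gamma_def Let_def
      x_def u_def lift_linear) (simp add: algebra_simps)

end


section \<open>Covariant derivatives of the almost complex structures\<close>

text \<open>The derivative of a matrix function in a given direction.\<close>

definition dmatrix :: "(real^'d::finite \<Rightarrow> real^'k^'l) \<Rightarrow> real^'d \<Rightarrow> real^'d \<Rightarrow> real^'k^'l" where
  "dmatrix J x X = (\<chi> i j. \<Sum>a\<in>UNIV. X $ a * pd a (\<lambda>z. J z $ i $ j) x)"

lemma dmatrix_linear:
  "dmatrix J x (X + Y) = dmatrix J x X + dmatrix J x Y"
  "dmatrix J x (r *\<^sub>R X) = r *\<^sub>R dmatrix J x X"
  by (simp_all add: dmatrix_def vec_eq_iff distrib_right sum.distrib sum_distrib_left mult.assoc)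

lemma has_derivative_matrix_vector:
  fixes J :: "real^'d::finite \<Rightarrow> real^'k::finite^'l::finite" and b :: "'e::real_normed_vector \<Rightarrow> real^'d"
  assumes J: "\<And>i j. (\<lambda>z. J z $ i $ j) differentiable (at (b w))"
    and b: "(b has_derivative b') (at w)" and Y: "(Y has_derivative Y') (at w)"
  shows "((\<lambda>w. J (b w) *v Y w) has_derivative
    (\<lambda>A. dmatrix J (b w) (b' A) *v Y w + J (b w) *v Y' A)) (at w)"
  unfolding dmatrix_def
proof (rule has_derivative_vecI)
  fix i
  let ?D = "\<lambda>A i j. \<Sum>a\<in>UNIV. b' A $ a * pd a (\<lambda>z. J z $ i $ j) (b w)"
  have "((\<lambda>w. J (b w) $ i $ j) has_derivative (\<lambda>A. ?D A i j)) (at w)" for j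
    by (rule has_derivative_compose[OF b has_derivative_pd[OF J]])
  then have "((\<lambda>w. \<Sum>j\<in>UNIV. J (b w) $ i $ j * Y w $ j) has_derivative
      (\<lambda>A. \<Sum>j\<in>UNIV. J (b w) $ i $ j * Y' A $ j + ?D A i j * Y w $ j)) (at w)"
    by (intro has_derivative_sum has_derivative_mult has_derivative_vecD[OF Y])
  then show "((\<lambda>w. (J (b w) *v Y w) $ i) has_derivative
      (\<lambda>A. ((\<chi> i j. ?D A i j) *v Y w + J (b w) *v Y' A) $ i)) (at w)"
    unfolding matrix_vector_mult_def vec_lambda_beta vector_add_component
    by (rule has_derivative_eq_rhs) (simp add: fun_eq_iff sum.distrib)
qed

lemma J1_hat_lift_sum: "J1_hat g c w *v (horiz (g c) w X + vert Y) = horiz (g c) w (- Y) + vert X"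
  by (simp add: matrix_vector_right_distrib J1_hat_lift lift_linear)

lemma J2_hat_lift_sum: "J2_hat g J c w *v (horiz (g c) w X + vert Y)
    = horiz (g c) w (J c (xpart w) *v Y) + vert (J c (xpart w) *v X)"
  by (simp add: matrix_vector_right_distrib J2_hat_lift add.commute)

lemma J3_hat_lift_sum: "J3_hat g J c w *v (horiz (g c) w X + vert Y)
    = horiz (g c) w (- (J c (xpart w) *v X)) + vert (J c (xpart w) *v Y)"
  by (simp add: J3_hat_def J2_hat_lift_sum J1_hat_lift_sum flip: matrix_vector_mul_assoc)

lemma lift_diff: "horiz g w X + vert Y - (horiz g w X' + vert Y') = horiz g w (X - X') + vert (Y - Y')"
  by (simp add: lift_linear)

lemma bil_sasaki_lift:
  "bil (sasaki g c w) (horiz (g c) w X + vert Y) C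
    = bil (g c (xpart w)) X (hcomp C) + bil (g c (xpart w)) Y (vcomp (g c) w C)"
  by (simp add: sasaki_apply)

context tangent_chart
begin

lemma nabla_sasaki_const:
  assumes w: "xpart w \<in> S"
    and Y: "((\<lambda>z. vcomp (g c) z B) has_derivative Y') (at w)"
  shows "nabla (sasaki g c) (\<lambda>_. A) (\<lambda>_. B) w
    = horiz (g c) w (gamma (g c) (xpart w) (hcomp A) (hcomp B)
        + (1/2) *\<^sub>R (curv (g c) (xpart w) (ypart w) (vcomp (g c) w A) (hcomp B)
            + curv (g c) (xpart w) (ypart w) (vcomp (g c) w B) (hcomp A)))
    + vert (Y' A + gamma (g c) (xpart w) (hcomp A) (vcomp (g c) w B)
        - (1/2) *\<^sub>R curv (g c) (xpart w) (hcomp A) (hcomp B) (ypart w))"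
  using nabla_sasaki_lift[OF w has_derivative_const[of "hcomp B"] Y, of A] by (simp add: lift_cancel)

text \<open>The derivatives of the components of the field occur once inside and once outside of \<open>J\<^sub>1\<close> and cancel;
  the same happens for \<open>J\<^sub>2\<close> and \<open>J\<^sub>3\<close> below, up to \<open>\<nabla>J\<close>.\<close>

lemma nabla_J1_hat:
  fixes w A B
  defines "R \<equiv> curv (g c) (xpart w)" and "u \<equiv> ypart w"
    and "A1 \<equiv> hcomp A" and "A2 \<equiv> vcomp (g c) w A" and "B1 \<equiv> hcomp B" and "B2 \<equiv> vcomp (g c) w B"
  assumes w: "xpart w \<in> S"
  shows "nabla_endo (sasaki g c) (J1_hat g c) (\<lambda>_. A) (\<lambda>_. B) w
    = horiz (g c) w ((1/2) *\<^sub>R (R u B1 A1 - R A1 B1 u - R u A2 B2))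
    + vert ((1/2) *\<^sub>R (R A1 B2 u - R u A2 B1 - R u B2 A1))"
proof -
  note Y = has_derivative_vcomp[OF w, of B]
  have *: "J1_hat g c z *v B = horiz (g c) z (- vcomp (g c) z B) + vert B1" for z
    by (subst lift_cancel[of "g c" z B, symmetric]) (simp only: J1_hat_lift_sum B1_def)
  show ?thesis
    unfolding nabla_endo_def * nabla_sasaki_const[OF w Y]
      nabla_sasaki_lift[OF w has_derivative_minus[OF Y] has_derivative_const]
      J1_hat_lift_sum lift_diff lift_eq_iff
    unfolding R_def u_def A1_def A2_def B1_def B2_def
    by (simp add: algebra_simps)
qed

end

locale skew_hermitian_chart = tangent_chart g c S for g :: "('c, 'd::finite) tensor" and c S +
  fixes J :: "('c, 'd) tensor"
  assumes smooth_J: "smooth_matrix_on S (J c)"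
    and J_square: "\<And>x. x \<in> S \<Longrightarrow> J c x ** J c x = - mat 1"
    and J_skew: "\<And>x X Y. x \<in> S \<Longrightarrow> bil (g c x) (J c x *v X) (J c x *v Y) = - bil (g c x) X Y"
begin

abbreviation "NJ x X Y \<equiv> nabla_endo (g c) (J c) (\<lambda>_. X) (\<lambda>_. Y) x"

lemma J_J: "x \<in> S \<Longrightarrow> J c x *v (J c x *v X) = - X"
  by (simp add: matrix_vector_mul_assoc J_square minus_mat_1_mult)

lemma J_selfadjoint:
  assumes "x \<in> S"
  shows "bil (g c x) (J c x *v X) Y = bil (g c x) X (J c x *v Y)"
  using J_skew[OF assms, of X "J c x *v Y"] by (simp add: J_J[OF assms])

lemma J_differentiable: "x \<in> S \<Longrightarrow> (\<lambda>z. J c z $ i $ j) differentiable (at x)"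
  using smooth_J open_S by (auto simp: smooth_matrix_on_def intro: smooth_on_differentiable)

text \<open>The right-hand side is algebraic in \<open>X\<close> and \<open>Y\<close>, so that \<open>\<nabla>J\<close> is bilinear and can be traced.\<close>

lemma NJ_eq:
  assumes "x \<in> S"
  shows "NJ x X Y = dmatrix (J c) x X *v Y
    + gamma (g c) x X (J c x *v Y) - J c x *v gamma (g c) x X Y"
  using nabla_eq[OF has_derivative_matrix_vector[of "J c" "\<lambda>z. z", OF J_differentiable[OF assms] has_derivative_ident
    has_derivative_const], of "g c" "\<lambda>_. X" Y]
  by (simp add: nabla_endo_def nabla_const_const)

lemma bilinear_NJ:
  assumes "x \<in> S"
  shows "bilinear (NJ x)"
  unfolding bilinear_def NJ_eq[OF assms]
  by (auto intro!: linearI simp: algebra_simps matrix_vector_mult_scaleR dmatrix_linear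
      simp flip: scaleR_matrix_vector_assoc)

lemma has_derivative_J:
  assumes w: "xpart w \<in> S" and Y: "(Y has_derivative Y') (at w)"
  shows "((\<lambda>w. J c (xpart w) *v Y w) has_derivative
    (\<lambda>A. NJ (xpart w) (hcomp A) (Y w) - gamma (g c) (xpart w) (hcomp A) (J c (xpart w) *v Y w)
      + J c (xpart w) *v gamma (g c) (xpart w) (hcomp A) (Y w) + J c (xpart w) *v Y' A)) (at w)"
  by (rule has_derivative_eq_rhs[OF has_derivative_matrix_vector[of "J c" xpart,
        OF J_differentiable[OF w] has_derivative_parts(1) Y]])
    (simp add: NJ_eq[OF w] hcomp_def)

lemma nabla_J2_hat:
  fixes w A B
  defines "R \<equiv> curv (g c) (xpart w)" and "u \<equiv> ypart w" and "j \<equiv> (*v) (J c (xpart w))"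
    and "A1 \<equiv> hcomp A" and "A2 \<equiv> vcomp (g c) w A" and "B1 \<equiv> hcomp B" and "B2 \<equiv> vcomp (g c) w B"
  assumes w: "xpart w \<in> S"
  shows "nabla_endo (sasaki g c) (J2_hat g J c) (\<lambda>_. A) (\<lambda>_. B) w
    = horiz (g c) w (NJ (xpart w) A1 B2 + (1/2) *\<^sub>R (R u A2 (j B2) + R u (j B1) A1 + j (R A1 B1 u)))
    + vert (NJ (xpart w) A1 B1 - (1/2) *\<^sub>R (R A1 (j B2) u + j (R u A2 B1) + j (R u B2 A1)))"
proof -
  note Y = has_derivative_vcomp[OF w, of B]
  have *: "J2_hat g J c z *v B = horiz (g c) z (J c (xpart z) *v vcomp (g c) z B) + vert (J c (xpart z) *v B1)" for z
    by (subst lift_cancel[of "g c" z B, symmetric]) (simp only: J2_hat_lift_sum B1_def)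
  show ?thesis
    unfolding nabla_endo_def[of "sasaki g c"] * nabla_sasaki_const[OF w Y]
      nabla_sasaki_lift[OF w has_derivative_J[OF w Y] has_derivative_J[OF w has_derivative_const]]
      J2_hat_lift_sum lift_diff lift_eq_iff
    unfolding R_def u_def A1_def A2_def B1_def B2_def j_def
    by (simp add: algebra_simps matrix_vector_mult_scaleR)
qed

lemma nabla_J3_hat:
  fixes w A B
  defines "R \<equiv> curv (g c) (xpart w)" and "u \<equiv> ypart w" and "j \<equiv> (*v) (J c (xpart w))"
    and "A1 \<equiv> hcomp A" and "A2 \<equiv> vcomp (g c) w A" and "B1 \<equiv> hcomp B" and "B2 \<equiv> vcomp (g c) w B"
  assumes w: "xpart w \<in> S"
  shows "nabla_endo (sasaki g c) (J3_hat g J c) (\<lambda>_. A) (\<lambda>_. B) w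
    = horiz (g c) w ((1/2) *\<^sub>R (R u (j B2) A1 - R u A2 (j B1) + j (R u A2 B1) + j (R u B2 A1)) - NJ (xpart w) A1 B1)
    + vert (NJ (xpart w) A1 B2 + (1/2) *\<^sub>R (R A1 (j B1) u + j (R A1 B1 u)))"
proof -
  note Y = has_derivative_vcomp[OF w, of B]
  have *: "J3_hat g J c z *v B = horiz (g c) z (- (J c (xpart z) *v B1)) + vert (J c (xpart z) *v vcomp (g c) z B)" for z
    by (subst lift_cancel[of "g c" z B, symmetric]) (simp only: J3_hat_lift_sum B1_def)
  show ?thesis
    unfolding nabla_endo_def[of "sasaki g c"] * nabla_sasaki_const[OF w Y]
      nabla_sasaki_lift[OF w has_derivative_minus[OF has_derivative_J[OF w has_derivative_const]] has_derivative_J[OF w Y]]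
      J3_hat_lift_sum lift_diff lift_eq_iff
    unfolding R_def u_def A1_def A2_def B1_def B2_def j_def
    by (simp add: algebra_simps matrix_vector_mult_scaleR)
qed

end


section \<open>The Lie forms on the tangent bundle\<close>

context tangent_chart
begin

lemma bilinear_bil_curv:
  "bilinear (\<lambda>X Y. bil G (curv (g c) x u X Y) Z)"
  by (auto simp: bilinear_def intro!: linearI)

lemma trace_curv:
  assumes "x \<in> S"
  shows "metric_trace (g c x) (\<lambda>X Y. bil (g c x) (curv (g c) x X Y u) Z) = 0"
proof (rule metric_trace_skew[OF inv sym])
  show "bil (g c x) (curv (g c) x Y X u) Z = - bil (g c x) (curv (g c) x X Y u) Z" for X Y
    by (subst curv_skew) simp
qed (rule assms)+

text \<open>The horizontal lifts contribute \<open>1/2 R(u, Y) X - 1/2 R(X, Y) u\<close> and the vertical lifts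
  \<open>- 1/2 R(u, X) Y\<close>.  The middle term is skew in \<open>X\<close> and \<open>Y\<close> and has trace zero, and the other two
  cancel after exchanging \<open>X\<close> and \<open>Y\<close>.\<close>

theorem lie_form_J1_hat:
  assumes w: "xpart w \<in> S"
  shows "lie_form (sasaki g c) (J1_hat g c) w C = 0"
proof -
  let ?x = "xpart w" and ?u = "ypart w"
  let ?G = "g c ?x" and ?R = "curv (g c) ?x"
  note G = inv[OF w] sym[OF w]
  let ?T = "\<lambda>A B. fundamental_F (sasaki g c) (J1_hat g c) w A B C"
  have bil: "bilinear ?T"
    unfolding fundamental_F_def nabla_J1_hat[OF w] bil_sasaki_lift
    by (auto simp: bilinear_def algebra_simps add_divide_distrib diff_divide_distrib intro!: linearI)
  have "metric_trace ?G (\<lambda>X Y. ?T (horiz (g c) w X) (horiz (g c) w Y))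
      = metric_trace ?G (\<lambda>X Y. (1/2) * bil ?G (?R ?u Y X) (hcomp C) + (- (1/2)) * bil ?G (?R X Y ?u) (hcomp C))"
    unfolding fundamental_F_def nabla_J1_hat[OF w] bil_sasaki_lift
    by (simp add: algebra_simps)
  also have "\<dots> = (1/2) * metric_trace ?G (\<lambda>X Y. bil ?G (?R ?u X Y) (hcomp C))"
    unfolding metric_trace_add metric_trace_scale
      metric_trace_swap[OF G, of "\<lambda>X Y. bil ?G (?R ?u X Y) (hcomp C)"]
    by (simp add: trace_curv[OF w])
  finally have 1: "metric_trace ?G (\<lambda>X Y. ?T (horiz (g c) w X) (horiz (g c) w Y)) = \<dots>" .
  have "metric_trace ?G (\<lambda>X Y. ?T (vert X) (vert Y))
      = metric_trace ?G (\<lambda>X Y. (- (1/2)) * bil ?G (?R ?u X Y) (hcomp C))"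
    unfolding fundamental_F_def nabla_J1_hat[OF w] bil_sasaki_lift
    by simp
  then have 2: "metric_trace ?G (\<lambda>X Y. ?T (vert X) (vert Y))
      = (- (1/2)) * metric_trace ?G (\<lambda>X Y. bil ?G (?R ?u X Y) (hcomp C))"
    unfolding metric_trace_scale .
  show ?thesis
    unfolding lie_form_def metric_trace_sasaki[of g c w, OF inv[OF w] bil] 1 2 by simp
qed

end

context skew_hermitian_chart
begin

text \<open>Moving \<open>J\<close> to the other slot and exchanging the slots reverses the sign.\<close>

lemma trace_curv_J:
  assumes w: "x \<in> S"
  shows "metric_trace (g c x) (\<lambda>X Y. bil (g c x) (curv (g c) x X (J c x *v Y) u) Z) = 0"
proof -
  let ?T = "\<lambda>X Y. bil (g c x) (curv (g c) x X Y u) Z"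
  have "bilinear ?T" by (auto simp: bilinear_def intro!: linearI)
  from metric_trace_selfadjoint[OF inv[OF w] this J_selfadjoint[OF w]]
  have "metric_trace (g c x) (\<lambda>X Y. ?T X (J c x *v Y)) = metric_trace (g c x) (\<lambda>X Y. ?T (J c x *v X) Y)" .
  also have "\<dots> = metric_trace (g c x) (\<lambda>X Y. ?T (J c x *v Y) X)"
    by (rule metric_trace_swap[OF inv[OF w] sym[OF w], symmetric])
  also have "\<dots> = metric_trace (g c x) (\<lambda>X Y. - ?T X (J c x *v Y))"
    by (subst curv_skew) simp
  finally show ?thesis
    unfolding metric_trace_minus by simp
qed

text \<open>The horizontal lifts contribute \<open>1/2 R(u, JY) X + 1/2 J R(X, Y) u\<close> and \<open>(\<nabla>\<^sub>X J) Y\<close>, the vertical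
  lifts \<open>1/2 R(u, X) JY\<close>.  Since \<open>J\<close> is self-adjoint, \<open>R(u, JY) X\<close> and \<open>R(u, X) JY\<close> have the same
  trace, which is the associated Ricci tensor by the skew symmetries of \<open>R\<close>.\<close>

theorem lie_form_J2_hat:
  assumes w: "xpart w \<in> S"
  shows "lie_form (sasaki g c) (J2_hat g J c) w C
    = assoc_ricci (g c) (J c) (xpart w) (ypart w) (hcomp C) + lie_form (g c) (J c) (xpart w) (vcomp (g c) w C)"
proof -
  let ?x = "xpart w" and ?u = "ypart w"
  let ?G = "g c ?x" and ?R = "curv (g c) ?x" and ?J = "J c ?x"
  note G = inv[OF w] sym[OF w]
  let ?T = "\<lambda>A B. fundamental_F (sasaki g c) (J2_hat g J c) w A B C"
  let ?\<rho> = "metric_trace ?G (\<lambda>X Y. bil ?G (?R ?u X (?J *v Y)) (hcomp C))"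
  note NJ = bilinear_NJ[OF w]
  have bil: "bilinear ?T"
    unfolding fundamental_F_def nabla_J2_hat[OF w] bil_sasaki_lift
    by (auto simp: bilinear_def algebra_simps add_divide_distrib diff_divide_distrib
        matrix_vector_mult_scaleR matrix_vector_right_distrib
        bilinear_ladd[OF NJ] bilinear_radd[OF NJ] bilinear_lmul[OF NJ] bilinear_rmul[OF NJ] intro!: linearI)
  have \<rho>: "?\<rho> = assoc_ricci (g c) (J c) ?x ?u (hcomp C)"
  proof -
    have "bil ?G (?R ?u X (?J *v Y)) (hcomp C) = bil ?G (?R X ?u (hcomp C)) (?J *v Y)" for X Y
      using curv_metric_skew[OF w, of ?u X "?J *v Y" "hcomp C"] bil_sym[OF sym[OF w]]
      by (simp add: curv_skew[of "g c" ?x ?u X])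
    then show ?thesis
      by (simp add: assoc_ricci_def curvature_eq[OF w])
  qed
  have swap: "metric_trace ?G (\<lambda>X Y. bil ?G (?R ?u (?J *v Y) X) (hcomp C)) = ?\<rho>"
    using metric_trace_swap[OF G, of "\<lambda>X Y. bil ?G (?R ?u (?J *v X) Y) (hcomp C)"]
      metric_trace_selfadjoint[OF inv[OF w] bilinear_bil_curv J_selfadjoint[OF w], of ?G ?x ?u "hcomp C"]
    by simp
  have "metric_trace ?G (\<lambda>X Y. ?T (horiz (g c) w X) (horiz (g c) w Y))
      = metric_trace ?G (\<lambda>X Y. (1/2) * bil ?G (?R ?u (?J *v Y) X) (hcomp C)
        + (1/2) * bil ?G (?R X Y ?u) (?J *v hcomp C) + bil ?G (NJ ?x X Y) (vcomp (g c) w C))"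
    unfolding fundamental_F_def nabla_J2_hat[OF w] bil_sasaki_lift
    by (simp add: algebra_simps J_selfadjoint[OF w] bilinear_lzero[OF NJ] bilinear_rzero[OF NJ])
  also have "\<dots> = (1/2) * ?\<rho> + lie_form (g c) (J c) ?x (vcomp (g c) w C)"
    unfolding metric_trace_add metric_trace_scale swap
    by (simp add: trace_curv[OF w] lie_form_def fundamental_F_def)
  finally have 1: "metric_trace ?G (\<lambda>X Y. ?T (horiz (g c) w X) (horiz (g c) w Y)) = \<dots>" .
  have "metric_trace ?G (\<lambda>X Y. ?T (vert X) (vert Y))
      = metric_trace ?G (\<lambda>X Y. (1/2) * bil ?G (?R ?u X (?J *v Y)) (hcomp C))"
    unfolding fundamental_F_def nabla_J2_hat[OF w] bil_sasaki_lift
    by (simp add: bilinear_lzero[OF NJ] bilinear_rzero[OF NJ])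
  then have 2: "metric_trace ?G (\<lambda>X Y. ?T (vert X) (vert Y)) = (1/2) * ?\<rho>"
    unfolding metric_trace_scale .
  show ?thesis
    unfolding lie_form_def[of "sasaki g c"] metric_trace_sasaki[of g c w, OF inv[OF w] bil] 1 2 \<rho> by simp
qed

text \<open>The vertical lifts contribute nothing.  On horizontal lifts the curvature terms are traceless by
  \<open>trace_curv\<close> and \<open>trace_curv_J\<close>, which leaves \<open>- (\<nabla>\<^sub>X J) Y\<close>.\<close>

theorem lie_form_J3_hat:
  assumes w: "xpart w \<in> S"
  shows "lie_form (sasaki g c) (J3_hat g J c) w C = - lie_form (g c) (J c) (xpart w) (hcomp C)"
proof -
  let ?x = "xpart w" and ?u = "ypart w"
  let ?G = "g c ?x" and ?R = "curv (g c) ?x" and ?J = "J c ?x"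
  note G = inv[OF w] sym[OF w]
  let ?T = "\<lambda>A B. fundamental_F (sasaki g c) (J3_hat g J c) w A B C"
  note NJ = bilinear_NJ[OF w]
  have bil: "bilinear ?T"
    unfolding fundamental_F_def nabla_J3_hat[OF w] bil_sasaki_lift
    by (auto simp: bilinear_def algebra_simps add_divide_distrib diff_divide_distrib
        matrix_vector_mult_scaleR matrix_vector_right_distrib
        bilinear_ladd[OF NJ] bilinear_radd[OF NJ] bilinear_lmul[OF NJ] bilinear_rmul[OF NJ] intro!: linearI)
  have "metric_trace ?G (\<lambda>X Y. ?T (horiz (g c) w X) (horiz (g c) w Y))
      = metric_trace ?G (\<lambda>X Y. (1/2) * bil ?G (?R X (?J *v Y) ?u) (vcomp (g c) w C)
        + (1/2) * bil ?G (?R X Y ?u) (?J *v vcomp (g c) w C) + - bil ?G (NJ ?x X Y) (hcomp C))"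
    unfolding fundamental_F_def nabla_J3_hat[OF w] bil_sasaki_lift
    by (simp add: algebra_simps J_selfadjoint[OF w] bilinear_lzero[OF NJ] bilinear_rzero[OF NJ])
  also have "\<dots> = - lie_form (g c) (J c) ?x (hcomp C)"
    unfolding metric_trace_add metric_trace_scale metric_trace_minus trace_curv_J[OF w]
    by (simp add: trace_curv[OF w] lie_form_def fundamental_F_def)
  finally have 1: "metric_trace ?G (\<lambda>X Y. ?T (horiz (g c) w X) (horiz (g c) w Y)) = \<dots>" .
  have 2: "metric_trace ?G (\<lambda>X Y. ?T (vert X) (vert Y)) = 0"
    unfolding fundamental_F_def nabla_J3_hat[OF w] bil_sasaki_lift
    by (simp add: bilinear_lzero[OF NJ] bilinear_rzero[OF NJ] metric_trace_def)
  show ?thesis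
    unfolding lie_form_def[of "sasaki g c"] metric_trace_sasaki[of g c w, OF inv[OF w] bil] 1 2 by simp
qed

end

lemma curv_eq_0:
  assumes "metric_chart g S" "x \<in> S" "\<And>X Y Z W. curvature g x X Y Z W = 0"
  shows "curv g x X Y Z = 0"
proof -
  interpret metric_chart g S by (rule assms(1))
  have "bil (g x) W (curv g x X Y Z) = 0" for W
    using assms(3)[of X Y Z W] curvature_eq[OF assms(2)] bil_sym[OF sym[OF assms(2)]] by simp
  then show ?thesis by (rule bil_nondegenerate[OF inv[OF assms(2)]])
qed


section \<open>Atlases\<close>

text \<open>The axioms of a smooth manifold without the topological ones: for the tangent bundle these are needed to
  describe its topology before the Hausdorff property and second countability are known.\<close>

locale smooth_atlas =
  fixes M :: "('p, 'c, 'd::finite) atlas"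
  assumes points: "points M = (\<Union>c\<in>charts M. cdom M c)"
    and inj: "c \<in> charts M \<Longrightarrow> inj_on (cmap M c) (cdom M c)"
    and open_overlap: "c \<in> charts M \<Longrightarrow> c' \<in> charts M \<Longrightarrow> open (cmap M c ` (cdom M c \<inter> cdom M c'))"
    and smooth_transition: "c \<in> charts M \<Longrightarrow> c' \<in> charts M \<Longrightarrow>
      smooth_on (cmap M c ` (cdom M c \<inter> cdom M c')) (\<lambda>x. transition M c c' x $ k)"

lemma smooth_manifold_iff:
  "smooth_manifold M \<longleftrightarrow>
    smooth_atlas M \<and> Hausdorff_space (atlas_topology M) \<and> second_countable (atlas_topology M)"
proof -
  have "smooth_atlas M \<longleftrightarrow> points M = (\<Union>c\<in>charts M. cdom M c) \<and>
     (\<forall>c\<in>charts M. inj_on (cmap M c) (cdom M c)) \<and>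
     (\<forall>c\<in>charts M. \<forall>c'\<in>charts M.
        open (cmap M c ` (cdom M c \<inter> cdom M c')) \<and>
        (\<forall>k. smooth_on (cmap M c ` (cdom M c \<inter> cdom M c')) (\<lambda>x. transition M c c' x $ k)))"
    unfolding smooth_atlas_def by (simp add: Ball_def) (simp only: all_simps imp_conjR all_conj_distrib)
  then show ?thesis
    unfolding smooth_manifold_def by simp
qed

lemma jacobian_apply:
  fixes f :: "real^'d::finite \<Rightarrow> real^'e::finite"
  assumes "(f has_derivative f') (at x)"
  shows "jacobian f (at x) *v v = f' v"
  unfolding jacobian_def frechet_derivative_at[OF assms, symmetric]
  by (rule matrix_works[OF iffD2[OF linear_matrix_vector_mul_eq has_derivative_linear[OF assms]]])

context smooth_atlas
begin

abbreviation overlap :: "'c \<Rightarrow> 'c \<Rightarrow> (real^'d) set" where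
  "overlap c c' \<equiv> cmap M c ` (cdom M c \<inter> cdom M c')"

abbreviation jac :: "'c \<Rightarrow> 'c \<Rightarrow> real^'d \<Rightarrow> real^'d^'d" where
  "jac c c' x \<equiv> jacobian (transition M c c') (at x)"

lemma open_cimg: "c \<in> charts M \<Longrightarrow> open (cimg M c)"
  using open_overlap[of c c] by (simp add: cimg_def)

lemma transition_cmap [simp]:
  "c \<in> charts M \<Longrightarrow> p \<in> cdom M c \<Longrightarrow> transition M c c' (cmap M c p) = cmap M c' p"
  by (simp add: transition_def the_inv_into_f_f inj)

lemma cmap_image_Int:
  "c \<in> charts M \<Longrightarrow> cmap M c ` (cdom M c \<inter> A \<inter> B)
    = cmap M c ` (cdom M c \<inter> A) \<inter> cmap M c ` (cdom M c \<inter> B)"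
  using inj by (fastforce simp: inj_on_def)

lemma transition_has_derivative:
  assumes "c \<in> charts M" "c' \<in> charts M" "x \<in> overlap c c'"
  shows "(transition M c c' has_derivative (*v) (jac c c' x)) (at x)"
proof -
  have "transition M c c' differentiable (at x)"
    using assms smooth_transition[OF assms(1,2)] open_overlap[OF assms(1,2)]
    by (intro smooth_map_on_differentiable) (auto simp: smooth_map_on_def)
  then show ?thesis by (simp add: jacobian_works)
qed

lemma jac_self:
  assumes "c \<in> charts M" "p \<in> cdom M c"
  shows "jac c c (cmap M c p) = mat 1"
proof (rule matrix_eqI)
  have "((\<lambda>x. x) has_derivative (*v) (jac c c (cmap M c p))) (at (cmap M c p))"
    by (rule has_derivative_transform_within_open[OF transition_has_derivative[of c c], of _ "overlap c c"])
      (use assms open_overlap[of c c] in auto)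
  from fun_cong[OF has_derivative_unique[OF this has_derivative_ident]]
  show "jac c c (cmap M c p) *v X = mat 1 *v X" for X
    by simp
qed

lemma jac_cocycle:
  assumes c: "c \<in> charts M" "c' \<in> charts M" "c'' \<in> charts M"
    and p: "p \<in> cdom M c" "p \<in> cdom M c'" "p \<in> cdom M c''"
  shows "jac c c'' (cmap M c p) = jac c' c'' (cmap M c' p) ** jac c c' (cmap M c p)"
proof (rule matrix_eqI)
  let ?U = "cmap M c ` (cdom M c \<inter> cdom M c' \<inter> cdom M c'')"
  have U: "open ?U"
    unfolding cmap_image_Int[OF c(1)] using c by (intro open_Int open_overlap)
  have "(transition M c c' has_derivative (*v) (jac c c' (cmap M c p))) (at (cmap M c p))"
    using c p by (intro transition_has_derivative) auto
  moreover have "(transition M c' c'' has_derivative (*v) (jac c' c'' (cmap M c' p)))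
      (at (transition M c c' (cmap M c p)))"
    using c p transition_has_derivative[of c' c'' "cmap M c' p"] by auto
  ultimately have "((\<lambda>x. transition M c' c'' (transition M c c' x)) has_derivative
      (\<lambda>X. jac c' c'' (cmap M c' p) *v (jac c c' (cmap M c p) *v X))) (at (cmap M c p))"
    by (rule has_derivative_compose)
  then have "(transition M c c'' has_derivative
      (\<lambda>X. jac c' c'' (cmap M c' p) *v (jac c c' (cmap M c p) *v X))) (at (cmap M c p))"
    by (rule has_derivative_transform_within_open[OF _ U]) (use c p in auto)
  then show "jac c c'' (cmap M c p) *v X = (jac c' c'' (cmap M c' p) ** jac c c' (cmap M c p)) *v X" for X
    by (simp add: jacobian_apply matrix_vector_mul_assoc)
qed

lemma openin_atlas:
  "openin (atlas_topology M) W \<longleftrightarrow>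
    W \<subseteq> points M \<and> (\<forall>c\<in>charts M. open (cmap M c ` (W \<inter> cdom M c)))"
  by (rule openin_atlas_topology) (auto intro: inj open_cimg)

lemma topspace_atlas [simp]: "topspace (atlas_topology M) = points M"
proof -
  have "points M \<inter> cdom M c = cdom M c" if "c \<in> charts M" for c
    using that points by auto
  then have "openin (atlas_topology M) (points M)"
    unfolding openin_atlas using open_cimg by (simp add: cimg_def)
  moreover have "topspace (atlas_topology M) \<subseteq> points M"
    using openin_atlas openin_topspace by blast
  ultimately show ?thesis
    using openin_subset by blast
qed

lemma openin_chart_vimage:
  assumes c: "c \<in> charts M" and V: "open V"
  shows "openin (atlas_topology M) {p \<in> cdom M c. cmap M c p \<in> V}"
  unfolding openin_atlas
proof (intro conjI ballI)
  show "{p \<in> cdom M c. cmap M c p \<in> V} \<subseteq> points M"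
    using c points by auto
  fix c' assume c': "c' \<in> charts M"
  have "cmap M c' ` ({p \<in> cdom M c. cmap M c p \<in> V} \<inter> cdom M c')
      = overlap c' c \<inter> transition M c' c -` V"
    using c' by auto
  moreover have "continuous_on (overlap c' c) (transition M c' c)"
    using transition_has_derivative[OF c' c] has_derivative_continuous
    by (blast intro: continuous_at_imp_continuous_on)
  ultimately show "open (cmap M c' ` ({p \<in> cdom M c. cmap M c p \<in> V} \<inter> cdom M c'))"
    using continuous_open_preimage[OF _ open_overlap[OF c' c] V] by simp
qed

lemma openin_cdom: "c \<in> charts M \<Longrightarrow> openin (atlas_topology M) (cdom M c)"
  using openin_chart_vimage[of c UNIV] by simp

text \<open>Countably many charts suffice for a countable base: pull back a countable base of
  coordinate space along each of them.\<close>

lemma second_countable_atlas: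
  assumes C: "countable C" "C \<subseteq> charts M" "points M = (\<Union>c\<in>C. cdom M c)"
  shows "second_countable (atlas_topology M)"
proof -
  obtain B :: "(real^'d) set set" where B: "countable B" "topological_basis B"
    using ex_countable_basis by blast
  define \<B> where "\<B> = (\<lambda>(c, V). {p \<in> cdom M c. cmap M c p \<in> V}) ` (C \<times> B)"
  show ?thesis
    unfolding second_countable_def
  proof (intro exI[of _ \<B>] conjI ballI allI impI)
    show "countable \<B>"
      using C B by (auto simp: \<B>_def)
    show "openin (atlas_topology M) V" if "V \<in> \<B>" for V
      using that C B topological_basis_open[OF B(2)]
      by (auto simp: \<B>_def intro!: openin_chart_vimage)
    fix W p assume W: "openin (atlas_topology M) W \<and> p \<in> W"
    then have "p \<in> points M" using openin_atlas by blast
    then obtain c where c: "c \<in> C" "p \<in> cdom M c" using C by blast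
    then have "open (cmap M c ` (W \<inter> cdom M c))" "cmap M c p \<in> cmap M c ` (W \<inter> cdom M c)"
      using W C openin_atlas by blast+
    then obtain V where V: "V \<in> B" "cmap M c p \<in> V" "V \<subseteq> cmap M c ` (W \<inter> cdom M c)"
      using topological_basisE[OF B(2)] by metis
    have "{p \<in> cdom M c. cmap M c p \<in> V} \<subseteq> W"
    proof
      fix p' assume p': "p' \<in> {p \<in> cdom M c. cmap M c p \<in> V}"
      then obtain p'' where "p'' \<in> W" "p'' \<in> cdom M c" "cmap M c p' = cmap M c p''"
        using V(3) by auto
      moreover have "inj_on (cmap M c) (cdom M c)"
        using c C inj by blast
      ultimately show "p' \<in> W"
        using p' inj_onD[of "cmap M c" "cdom M c" p' p''] by auto
    qed
    with c V show "\<exists>V\<in>\<B>. p \<in> V \<and> V \<subseteq> W"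
      by (intro bexI[of _ "{p \<in> cdom M c. cmap M c p \<in> V}"]) (auto simp: \<B>_def)
  qed
qed

text \<open>A second countable space is Lindelof, so countably many chart domains cover it.\<close>

lemma countable_subatlas:
  assumes "second_countable (atlas_topology M)"
  obtains C where "countable C" "C \<subseteq> charts M" "points M = (\<Union>c\<in>C. cdom M c)"
proof -
  have "Lindelof_space (atlas_topology M)"
    by (rule second_countable_imp_Lindelof_space[OF assms])
  then obtain \<V> where V: "countable \<V>" "\<V> \<subseteq> cdom M ` charts M" "\<Union>\<V> = points M"
    unfolding Lindelof_space_def using points openin_cdom
    by (metis (no_types, lifting) image_iff topspace_atlas)
  then obtain C where "C \<subseteq> charts M" "countable C" "\<V> = cdom M ` C"
    by (metis countable_subset_image)
  with V that show ?thesis by auto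
qed


section \<open>The tangent bundle of an atlas\<close>

text \<open>The tangent vector at \<open>p\<close> with components \<open>y\<close> in the chart \<open>c\<close>.\<close>

definition tangent_vector :: "'p \<Rightarrow> 'c \<Rightarrow> real^'d \<Rightarrow> 'c \<Rightarrow> real^'d" where
  "tangent_vector p c y c' =
    (if c' \<in> charts M \<and> p \<in> cdom M c' then jac c c' (cmap M c p) *v y else 0)"

lemma tangent_vector:
  assumes "c \<in> charts M" "p \<in> cdom M c"
  shows "tangent_vector p c y \<in> tangent_space M p" "tangent_vector p c y c = y"
proof -
  show "tangent_vector p c y c = y"
    using assms by (simp add: tangent_vector_def jac_self)
  have *: "tangent_vector p c y c'' = jac c' c'' (cmap M c' p) *v tangent_vector p c y c'"
    if "c' \<in> charts M" "c'' \<in> charts M" "p \<in> cdom M c'" "p \<in> cdom M c''" for c' c''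
    unfolding tangent_vector_def
    by (simp only: that if_True simp_thms matrix_vector_mul_assoc
        jac_cocycle[OF assms(1) that(1,2) assms(2) that(3,4)])
  show "tangent_vector p c y \<in> tangent_space M p"
    unfolding tangent_space_def mem_Collect_eq
    by (intro conjI ballI allI impI, rule *, assumption+) (auto simp: tangent_vector_def)
qed

lemma tangent_space_transform:
  assumes "v \<in> tangent_space M p" "c \<in> charts M" "p \<in> cdom M c" "c' \<in> charts M" "p \<in> cdom M c'"
  shows "v c' = jac c c' (cmap M c p) *v v c"
  using assms unfolding tangent_space_def by blast

lemma tangent_space_eqI:
  assumes "v \<in> tangent_space M p" "v' \<in> tangent_space M p" "c \<in> charts M" "p \<in> cdom M c" "v c = v' c"
  shows "v = v'"
proof
  fix c'
  show "v c' = v' c'"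
  proof (cases "c' \<in> charts M \<and> p \<in> cdom M c'")
    case True
    then show ?thesis
      using tangent_space_transform[OF assms(1,3,4), of c'] tangent_space_transform[OF assms(2,3,4), of c']
        assms(5) by auto
  next
    case False
    then have "v c' = 0" "v' c' = 0"
      using assms(1,2) unfolding tangent_space_def by blast+
    then show ?thesis by simp
  qed
qed

abbreviation "TM \<equiv> tangent_bundle M"

lemma TM_simps [simp]:
  "points TM = Sigma (points M) (tangent_space M)" "charts TM = charts M"
  "cdom TM c = Sigma (cdom M c) (tangent_space M)" "cmap TM c (p, v) = join (cmap M c p) (v c)"
  by (simp_all add: tangent_bundle_def)

text \<open>Every \<open>y\<close> occurs as the components of a tangent vector, so the charts of the tangent bundle fill whole
  fibres.\<close>

lemma cmap_TM_image:
  assumes "c \<in> charts M" "A \<subseteq> cdom M c"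
  shows "cmap TM c ` (Sigma A (tangent_space M)) = {w. xpart w \<in> cmap M c ` A}"
proof (intro equalityI subsetI)
  fix w assume "w \<in> {w. xpart w \<in> cmap M c ` A}"
  then obtain p where p: "p \<in> A" "xpart w = cmap M c p" by auto
  have "p \<in> cdom M c" using p assms by blast
  then have "cmap TM c (p, tangent_vector p c (ypart w)) = join (xpart w) (ypart w)"
    by (simp add: p(2) tangent_vector(2)[OF assms(1)])
  then have "w = cmap TM c (p, tangent_vector p c (ypart w))"
    by simp
  moreover have "(p, tangent_vector p c (ypart w)) \<in> Sigma A (tangent_space M)"
    using assms p tangent_vector(1) by auto
  ultimately show "w \<in> cmap TM c ` (Sigma A (tangent_space M))" by blast
qed auto

lemma cimg_TM: "c \<in> charts M \<Longrightarrow> cimg TM c = {w. xpart w \<in> cimg M c}"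
  using cmap_TM_image[of c "cdom M c"] by (simp add: cimg_def)

lemma overlap_TM:
  assumes "c \<in> charts M"
  shows "cmap TM c ` (cdom TM c \<inter> cdom TM c') = {w. xpart w \<in> overlap c c'}"
proof -
  have "cdom TM c \<inter> cdom TM c' = Sigma (cdom M c \<inter> cdom M c') (tangent_space M)" by auto
  then show ?thesis using cmap_TM_image[OF assms, of "cdom M c \<inter> cdom M c'"] by simp
qed

lemma inj_TM:
  assumes "c \<in> charts M"
  shows "inj_on (cmap TM c) (cdom TM c)"
proof (rule inj_onI)
  fix a b assume ab: "a \<in> cdom TM c" "b \<in> cdom TM c" "cmap TM c a = cmap TM c b"
  obtain p v q u where [simp]: "a = (p, v)" "b = (q, u)" by fastforce
  from ab have "cmap M c p = cmap M c q" "v c = u c" by (auto simp: join_eq_iff)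
  moreover from this have "p = q" using ab inj[OF assms] by (auto simp: inj_on_def)
  ultimately show "a = b"
    using ab assms tangent_space_eqI[of v p u c] by auto
qed

lemma transition_TM:
  assumes "c \<in> charts M" "c' \<in> charts M" "xpart w \<in> overlap c c'"
  shows "transition TM c c' w = join (transition M c c' (xpart w)) (jac c c' (xpart w) *v ypart w)"
proof -
  obtain p where p: "p \<in> cdom M c" "p \<in> cdom M c'" "xpart w = cmap M c p"
    using assms(3) by auto
  let ?v = "tangent_vector p c (ypart w)"
  have "cmap TM c (p, ?v) = join (xpart w) (ypart w)"
    by (simp add: p tangent_vector(2)[OF assms(1)])
  then have w: "cmap TM c (p, ?v) = w"
    by simp
  have "the_inv_into (cdom TM c) (cmap TM c) (cmap TM c (p, ?v)) = (p, ?v)"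
    using inj_TM[OF assms(1)] p assms tangent_vector(1) by (intro the_inv_into_f_f) auto
  then have "transition TM c c' w = cmap TM c' (p, ?v)"
    unfolding w by (simp add: transition_def)
  then show ?thesis
    using p assms by (simp add: tangent_vector_def)
qed

lemma smooth_jac:
  assumes "c \<in> charts M" "c' \<in> charts M"
  shows "smooth_matrix_on (overlap c c') (jac c c')"
  unfolding smooth_matrix_on_def
proof (intro allI)
  fix i j
  have "jac c c' x $ i $ j = pd j (\<lambda>z. transition M c c' z $ i) x" if "x \<in> overlap c c'" for x
    using pd_has_derivative[OF has_derivative_vecD[OF transition_has_derivative[OF assms that]], of j i]
    by (simp add: matrix_vector_mult_basis column_def)
  then show "smooth_on (overlap c c') (\<lambda>x. jac c c' x $ i $ j)"
    using smooth_on_pd[OF smooth_transition[OF assms], of j i]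
      smooth_on_cong[OF open_overlap[OF assms], of "\<lambda>x. jac c c' x $ i $ j"] by blast
qed

end

lemma smooth_on_xpart:
  assumes "open S" "smooth_on S f"
  shows "smooth_on {w. xpart w \<in> S} (\<lambda>w. f (xpart w))"
  by (rule smooth_on_compose[OF open_xpart_vimage[OF assms(1)] assms(1) _ _ assms(2)])
    (auto simp: xpart_def)

lemma smooth_on_ypart: "smooth_on S (\<lambda>w. ypart w $ i)"
  by (simp add: ypart_def)

lemma smooth_map_on_join:
  assumes "smooth_map_on S f" "smooth_map_on S h"
  shows "smooth_map_on S (\<lambda>z. join (f z) (h z))"
  unfolding smooth_map_on_def
proof
  fix k :: "'b + 'b"
  show "smooth_on S (\<lambda>z. join (f z) (h z) $ k)"
    using assms by (cases k) (auto simp: join_def smooth_map_on_def)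
qed

context smooth_atlas
begin

lemma smooth_atlas_TM: "smooth_atlas TM"
proof
  show "points TM = (\<Union>c\<in>charts TM. cdom TM c)"
    using points by auto
  show "inj_on (cmap TM c) (cdom TM c)" if "c \<in> charts TM" for c
    using that inj_TM by simp
  fix c c' assume "c \<in> charts TM" "c' \<in> charts TM"
  then have c: "c \<in> charts M" "c' \<in> charts M" by auto
  note U = open_xpart_vimage[OF open_overlap[OF c]]
  show "open (cmap TM c ` (cdom TM c \<inter> cdom TM c'))"
    unfolding overlap_TM[OF c(1)] by (rule U)
  fix k
  have "smooth_map_on {w. xpart w \<in> overlap c c'}
      (\<lambda>w. join (transition M c c' (xpart w)) (jac c c' (xpart w) *v ypart w))"
  proof (rule smooth_map_on_join)
    show "smooth_map_on {w. xpart w \<in> overlap c c'} (\<lambda>w. transition M c c' (xpart w))"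
      unfolding smooth_map_on_def
      by (rule allI) (rule smooth_on_xpart[OF open_overlap[OF c] smooth_transition[OF c]])
    show "smooth_map_on {w. xpart w \<in> overlap c c'} (\<lambda>w. jac c c' (xpart w) *v ypart w)"
    proof (rule smooth_map_on_mult[OF U])
      show "smooth_matrix_on {w. xpart w \<in> overlap c c'} (\<lambda>w. jac c c' (xpart w))"
        unfolding smooth_matrix_on_def
      proof (intro allI)
        fix i j
        have "smooth_on (overlap c c') (\<lambda>x. jac c c' x $ i $ j)"
          using smooth_jac[OF c] unfolding smooth_matrix_on_def by blast
        then show "smooth_on {w. xpart w \<in> overlap c c'} (\<lambda>w. jac c c' (xpart w) $ i $ j)"
          by (rule smooth_on_xpart[OF open_overlap[OF c]])
      qed
    qed (simp add: smooth_map_on_def smooth_on_ypart)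
  qed
  then have "smooth_on {w. xpart w \<in> overlap c c'}
      (\<lambda>w. join (transition M c c' (xpart w)) (jac c c' (xpart w) *v ypart w) $ k)"
    by (simp add: smooth_map_on_def)
  then have "smooth_on {w. xpart w \<in> overlap c c'} (\<lambda>w. transition TM c c' w $ k)"
    by (rule smooth_on_cong[OF U, THEN iffD2, rotated]) (use transition_TM[OF c] in simp)
  then show "smooth_on (cmap TM c ` (cdom TM c \<inter> cdom TM c')) (\<lambda>w. transition TM c c' w $ k)"
    unfolding overlap_TM[OF c(1)] .
qed

interpretation TM: smooth_atlas TM by (rule smooth_atlas_TM)

lemma second_countable_TM:
  assumes "second_countable (atlas_topology M)"
  shows "second_countable (atlas_topology TM)"
proof -
  obtain C where C: "countable C" "C \<subseteq> charts M" "points M = (\<Union>c\<in>C. cdom M c)"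
    using countable_subatlas[OF assms] .
  have "points TM = (\<Union>c\<in>C. cdom TM c)"
    unfolding TM_simps C(3) by blast
  with C show ?thesis
    using TM.second_countable_atlas[of C] by simp
qed

lemma openin_TM_Sigma:
  assumes "openin (atlas_topology M) W"
  shows "openin (atlas_topology TM) (Sigma W (tangent_space M))"
  unfolding TM.openin_atlas
proof (intro conjI ballI)
  show "Sigma W (tangent_space M) \<subseteq> points TM"
    using assms openin_atlas by auto
  fix c assume "c \<in> charts TM"
  then have c: "c \<in> charts M" by simp
  have "Sigma W (tangent_space M) \<inter> cdom TM c = Sigma (W \<inter> cdom M c) (tangent_space M)" by auto
  then have "cmap TM c ` (Sigma W (tangent_space M) \<inter> cdom TM c) = {w. xpart w \<in> cmap M c ` (W \<inter> cdom M c)}"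
    using cmap_TM_image[OF c, of "W \<inter> cdom M c"] by simp
  then show "open (cmap TM c ` (Sigma W (tangent_space M) \<inter> cdom TM c))"
    using assms c openin_atlas open_xpart_vimage by metis
qed

text \<open>Points in different fibres are separated over the base, points of one fibre inside one chart.\<close>

lemma Hausdorff_TM:
  assumes H: "Hausdorff_space (atlas_topology M)"
  shows "Hausdorff_space (atlas_topology TM)"
  unfolding Hausdorff_space_def
proof (intro allI impI)
  fix a b assume ab: "a \<in> topspace (atlas_topology TM) \<and> b \<in> topspace (atlas_topology TM) \<and> a \<noteq> b"
  obtain p v q u where a: "a = (p, v)" and b: "b = (q, u)" by fastforce
  from ab have p: "p \<in> points M" "v \<in> tangent_space M p" and q: "q \<in> points M" "u \<in> tangent_space M q"
    unfolding TM.topspace_atlas by (auto simp: a b)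
  show "\<exists>U V. openin (atlas_topology TM) U \<and> openin (atlas_topology TM) V \<and> a \<in> U \<and> b \<in> V \<and> disjnt U V"
  proof (cases "p = q")
    case False
    then have "\<exists>U V. openin (atlas_topology M) U \<and> openin (atlas_topology M) V \<and> p \<in> U \<and> q \<in> V \<and> disjnt U V"
      using H p(1) q(1) unfolding Hausdorff_space_def topspace_atlas by blast
    then obtain U V where "openin (atlas_topology M) U" "openin (atlas_topology M) V" "p \<in> U" "q \<in> V" "disjnt U V"
      by blast
    then show ?thesis
      using p q by (intro exI[of _ "Sigma U (tangent_space M)"] exI[of _ "Sigma V (tangent_space M)"])
        (auto simp: openin_TM_Sigma a b disjnt_iff)
  next
    case True
    obtain c where c: "c \<in> charts M" "p \<in> cdom M c"
      using p points by auto
    have "cmap TM c a \<noteq> cmap TM c b"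
      using inj_TM[OF c(1)] ab p q c True by (auto simp: inj_on_def a b)
    then obtain U V where "open U" "open V" "cmap TM c a \<in> U" "cmap TM c b \<in> V" "U \<inter> V = {}"
      using hausdorff[of "cmap TM c a" "cmap TM c b"] by blast
    moreover have "a \<in> cdom TM c" "b \<in> cdom TM c"
      using p q c True by (auto simp: a b)
    ultimately show ?thesis
      using c TM.openin_chart_vimage[of c U] TM.openin_chart_vimage[of c V]
      by (intro exI[of _ "{p \<in> cdom TM c. cmap TM c p \<in> U}"] exI[of _ "{p \<in> cdom TM c. cmap TM c p \<in> V}"])
        (auto simp: disjnt_iff simp del: TM_simps(3,4))
  qed
qed

end

theorem smooth_manifold_tangent_bundle:
  "smooth_manifold M \<Longrightarrow> smooth_manifold (tangent_bundle M)"
  unfolding smooth_manifold_iff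
  using smooth_atlas.smooth_atlas_TM smooth_atlas.Hausdorff_TM smooth_atlas.second_countable_TM by blast


section \<open>Change of coordinates\<close>

lemma bil_transform_invertible:
  fixes A G H :: "real^'d^'d::finite"
  assumes "G = transpose A ** H ** A" "invertible G"
  shows "invertible A"
  using assms by (simp add: invertible_det_nz det_mul)

text \<open>Transporting the connection of \<open>g'\<close> by \<open>t\<close> gives a symmetric connection compatible with \<open>g\<close>, hence
  the one of \<open>g\<close>.  Its symmetry is the symmetry of the second derivative of \<open>t\<close>.\<close>

theorem gamma_transform:
  fixes t :: "real^'d::finite \<Rightarrow> real^'d"
  assumes g: "metric_chart g S" and g': "metric_chart g' S'" and U: "open U" "U \<subseteq> S"
    and t: "smooth_map_on U t" "t ` U \<subseteq> S'"
    and A: "smooth_matrix_on U A" "\<And>x. x \<in> U \<Longrightarrow> (t has_derivative (*v) (A x)) (at x)"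
    and iso: "\<And>x. x \<in> U \<Longrightarrow> g x = transpose (A x) ** g' (t x) ** A x"
    and x: "x \<in> U"
  shows "A x *v gamma g x X Y = dmatrix A x X *v Y + gamma g' (t x) (A x *v X) (A x *v Y)"
proof -
  interpret g: metric_chart g S by (rule g)
  interpret g': metric_chart g' S' by (rule g')
  have xS: "x \<in> S" and tx: "t x \<in> S'" using x U t by auto
  have Ax: "invertible (A x)"
    by (rule bil_transform_invertible[OF iso[OF x] g.inv[OF xS]])
  define N where "N = matrix_inv (A x)"
  (* The transported connection, before the inverse of the Jacobian brings it back to the first chart. *)
  define C where "C X Y = dmatrix A x X *v Y + gamma g' (t x) (A x *v X) (A x *v Y)" for X Y
  have AN: "A x *v (N *v Z) = Z" for Z
    by (simp add: N_def matrix_vector_mul_assoc matrix_inv_cancel[OF Ax])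
  have dA: "((\<lambda>z. A z *v Y) has_derivative (\<lambda>X. dmatrix A x X *v Y)) (at x)" for Y
  proof -
    have "(\<lambda>z. A z $ i $ j) differentiable (at x)" for i j
      using A(1) U(1) x by (intro smooth_on_differentiable) (auto simp: smooth_matrix_on_def)
    from has_derivative_matrix_vector[of A "\<lambda>z. z", OF this has_derivative_ident has_derivative_const[of Y]]
    show ?thesis by simp
  qed
  have dA_sym: "dmatrix A x X *v Y = dmatrix A x Y *v X" for X Y
  proof -
    have "(dmatrix A x X *v Y) $ k = (dmatrix A x Y *v X) $ k" for k
    proof (rule second_derivative_symmetric[where D = "\<lambda>Y X. (dmatrix A x X *v Y) $ k"
          and \<phi>' = "\<lambda>z Y. (A z *v Y) $ k", OF _ U(1) x])
      show "smooth_on U (\<lambda>z. t z $ k)"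
        using t(1) by (simp add: smooth_map_on_def)
      show "((\<lambda>z. t z $ k) has_derivative (\<lambda>Y. (A z *v Y) $ k)) (at z)" if "z \<in> U" for z
        by (rule has_derivative_vecD[OF A(2)[OF that]])
      show "((\<lambda>z. (A z *v Y) $ k) has_derivative (\<lambda>X. (dmatrix A x X *v Y) $ k)) (at x)" for Y
        by (rule has_derivative_vecD[OF dA])
    qed
    then show ?thesis by (simp add: vec_eq_iff)
  qed
  have C_add: "C (X + X') Y = C X Y + C X' Y" "C X (Y + Y') = C X Y + C X Y'" for X X' Y Y'
    by (simp_all add: C_def dmatrix_linear algebra_simps)
  have C_scale: "C (r *\<^sub>R X) Y = r *\<^sub>R C X Y" "C X (r *\<^sub>R Y) = r *\<^sub>R C X Y" for r X Y
    by (simp_all add: C_def dmatrix_linear algebra_simps matrix_vector_mult_scaleR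
        flip: scaleR_matrix_vector_assoc)
  have "gamma g x X Y = N *v C X Y"
  proof (rule levi_civita_unique[where g = g and x = x and B = "\<lambda>X Y. N *v C X Y", OF g.inv[OF xS] U(1) x])
    show "transpose (g z) = g z" if "z \<in> U" for z
      using g.sym U that by blast
    show "bilinear (\<lambda>X Y. N *v C X Y)"
      unfolding bilinear_def
      by (auto intro!: linearI simp: C_add C_scale matrix_vector_right_distrib matrix_vector_mult_scaleR)
    show "N *v C X Y = N *v C Y X" for X Y
      by (simp add: C_def dA_sym[of X Y] g'.gamma_sym[OF tx, of "A x *v X" "A x *v Y"])
    fix X Y
    have iso': "bil (g z) X Y = bil (g' (t z)) (A z *v X) (A z *v Y)" if "z \<in> U" for z X Y
      by (simp add: iso[OF that] bil_transpose_mult)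
    have "((\<lambda>z. bil (g' (t z)) (A z *v X) (A z *v Y)) has_derivative
        (\<lambda>H. bil (g' (t x)) (C H X) (A x *v Y) + bil (g' (t x)) (A x *v X) (C H Y))) (at x)"
      unfolding C_def by (rule g'.has_derivative_bil[OF tx A(2)[OF x] dA dA])
    then have "((\<lambda>z. bil (g z) X Y) has_derivative
        (\<lambda>H. bil (g' (t x)) (C H X) (A x *v Y) + bil (g' (t x)) (A x *v X) (C H Y))) (at x)"
      by (rule has_derivative_transform_within_open[OF _ U(1) x]) (rule iso'[symmetric])
    then show "((\<lambda>z. bil (g z) X Y) has_derivative
        (\<lambda>H. bil (g x) (N *v C H X) Y + bil (g x) X (N *v C H Y))) (at x)"
      unfolding iso'[OF x] AN .
  qed
  then show ?thesis by (simp add: AN C_def)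
qed


section \<open>Smoothness of the lifted tensor fields\<close>

lemma smooth_on_bil:
  assumes "open S" "smooth_matrix_on S G" "smooth_map_on S X" "smooth_map_on S Y"
  shows "smooth_on S (\<lambda>w. bil (G w) (X w) (Y w))"
  using assms unfolding bil_sum smooth_matrix_on_def smooth_map_on_def
  by (intro smooth_on_sum smooth_on_mult) auto

lemma smooth_matrix_onI:
  assumes "\<And>b. smooth_map_on S (\<lambda>w. T w *v axis b 1)"
  shows "smooth_matrix_on S T"
  using assms unfolding smooth_matrix_on_def smooth_map_on_def
  by (simp add: matrix_vector_mult_basis column_def)

lemma smooth_map_on_const: "smooth_map_on S (\<lambda>w. X)"
  by (simp add: smooth_map_on_def)

lemma smooth_map_on_minus: "open S \<Longrightarrow> smooth_map_on S f \<Longrightarrow> smooth_map_on S (\<lambda>w. - f w)"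
  by (simp add: smooth_map_on_def smooth_on_minus)

context tangent_chart
begin

lemma smooth_gamma_TS:
  assumes "smooth_map_on TS X" "smooth_map_on TS Y"
  shows "smooth_map_on TS (\<lambda>w. gamma (g c) (xpart w) (X w) (Y w))"
  using assms open_TS smooth_on_xpart[OF open_S smooth_christoffel]
  unfolding smooth_map_on_def gamma_def vec_lambda_beta
  by (intro allI smooth_on_sum smooth_on_mult) auto

lemma smooth_ypart: "smooth_map_on TS ypart"
  by (simp add: smooth_map_on_def smooth_on_ypart)

lemma smooth_vcomp: "smooth_map_on TS (\<lambda>w. vcomp (g c) w B)"
proof -
  have "smooth_map_on TS (\<lambda>w. gamma (g c) (xpart w) (ypart w) (hcomp B))"
    by (rule smooth_gamma_TS[OF smooth_ypart smooth_map_on_const])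
  then show ?thesis
    unfolding vcomp_eq smooth_map_on_def vector_add_component
    by (intro allI smooth_on_add[OF open_TS] smooth_on_const) blast
qed

lemma smooth_lift:
  assumes "smooth_map_on TS X" "smooth_map_on TS Y"
  shows "smooth_map_on TS (\<lambda>w. horiz (g c) w (X w) + vert (Y w))"
  unfolding lift_eq_join
proof (rule smooth_map_on_join[OF assms(1)])
  show "smooth_map_on TS (\<lambda>w. Y w - gamma (g c) (xpart w) (ypart w) (X w))"
    using smooth_gamma_TS[OF smooth_ypart assms(1)] assms(2)
    unfolding smooth_map_on_def vector_minus_component
    by (intro allI smooth_on_diff[OF open_TS]) blast+
qed

lemma smooth_matrix_on_xpart:
  assumes "smooth_matrix_on S G"
  shows "smooth_matrix_on TS (\<lambda>w. G (xpart w))"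
  using assms smooth_on_xpart[OF open_S] unfolding smooth_matrix_on_def by blast

lemma smooth_sasaki: "smooth_matrix_on TS (sasaki g c)"
  unfolding smooth_matrix_on_def sasaki_def vec_lambda_beta
  by (intro allI smooth_on_add smooth_on_bil open_TS smooth_matrix_on_xpart smooth_g
      smooth_vcomp smooth_map_on_const)

lemma J1_hat_column: "J1_hat g c w *v B = horiz (g c) w (- vcomp (g c) w B) + vert (hcomp B)"
  by (subst lift_cancel[of "g c" w B, symmetric]) (simp only: J1_hat_lift_sum)

lemma smooth_J1_hat: "smooth_matrix_on TS (J1_hat g c)"
  by (rule smooth_matrix_onI, unfold J1_hat_column)
    (intro smooth_lift smooth_map_on_minus open_TS smooth_vcomp smooth_map_on_const)

end

context skew_hermitian_chart
begin

lemma J2_hat_column: "J2_hat g J c w *v B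
    = horiz (g c) w (J c (xpart w) *v vcomp (g c) w B) + vert (J c (xpart w) *v hcomp B)"
  by (subst lift_cancel[of "g c" w B, symmetric]) (simp only: J2_hat_lift_sum)

lemma smooth_J2_hat: "smooth_matrix_on TS (J2_hat g J c)"
  by (rule smooth_matrix_onI, unfold J2_hat_column)
    (intro smooth_lift smooth_map_on_mult smooth_matrix_on_xpart smooth_J open_TS smooth_vcomp smooth_map_on_const)

lemma smooth_J3_hat: "smooth_matrix_on TS (J3_hat g J c)"
  unfolding J3_hat_def by (intro smooth_matrix_on_mult open_TS smooth_J1_hat smooth_J2_hat)

end


section \<open>Algebraic relations on the tangent bundle\<close>

lemma lift_cases:
  obtains X Y where "A = horiz g w X + vert Y"
  using lift_cancel[of g w A] by metis

lemma minus_lift: "- (horiz g w X + vert Y) = horiz g w (- X) + vert (- Y)"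
  by (simp add: lift_linear)

lemma bil_sasaki_lifts: "bil (sasaki g c w) (horiz (g c) w X + vert Y) (horiz (g c) w X' + vert Y')
    = bil (g c (xpart w)) X X' + bil (g c (xpart w)) Y Y'"
  by (simp add: sasaki_apply)

lemma J1_hat_square: "J1_hat g c w ** J1_hat g c w = - mat 1"
proof (rule matrix_eqI)
  fix A
  obtain X Y where A: "A = horiz (g c) w X + vert Y" by (rule lift_cases)
  show "(J1_hat g c w ** J1_hat g c w) *v A = - mat 1 *v A"
    unfolding A minus_mat_1_mult matrix_vector_mul_assoc[symmetric] J1_hat_lift_sum minus_lift
    by simp
qed

lemma J1_hat_isometry: "bil (sasaki g c w) (J1_hat g c w *v A) (J1_hat g c w *v B) = bil (sasaki g c w) A B"
proof -
  obtain X Y where A: "A = horiz (g c) w X + vert Y" by (rule lift_cases)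
  obtain X' Y' where B: "B = horiz (g c) w X' + vert Y'" by (rule lift_cases)
  show ?thesis
    unfolding A B J1_hat_lift_sum bil_sasaki_lifts by simp
qed

lemma skew_selfadjoint:
  fixes G J :: "real^'k^'k::finite"
  assumes "J ** J = - mat 1" "\<And>X Y. bil G (J *v X) (J *v Y) = - bil G X Y"
  shows "bil G (J *v X) Y = bil G X (J *v Y)"
  using assms(2)[of X "J *v Y"] by (simp add: matrix_vector_mul_assoc assms(1) minus_mat_1_mult)

context skew_hermitian_chart
begin

lemma J2_hat_square:
  assumes "xpart w \<in> S"
  shows "J2_hat g J c w ** J2_hat g J c w = - mat 1"
proof (rule matrix_eqI)
  fix A
  obtain X Y where A: "A = horiz (g c) w X + vert Y" by (rule lift_cases)
  show "(J2_hat g J c w ** J2_hat g J c w) *v A = - mat 1 *v A"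
    unfolding A minus_mat_1_mult matrix_vector_mul_assoc[symmetric] J2_hat_lift_sum minus_lift
    by (simp add: J_J[OF assms])
qed

lemma J3_hat_square:
  assumes "xpart w \<in> S"
  shows "J3_hat g J c w ** J3_hat g J c w = - mat 1"
proof (rule matrix_eqI)
  fix A
  obtain X Y where A: "A = horiz (g c) w X + vert Y" by (rule lift_cases)
  show "(J3_hat g J c w ** J3_hat g J c w) *v A = - mat 1 *v A"
    unfolding A minus_mat_1_mult matrix_vector_mul_assoc[symmetric] J3_hat_lift_sum minus_lift
    by (simp add: J_J[OF assms] matrix_vector_mult_minus)
qed

lemma J2_hat_skew:
  assumes "xpart w \<in> S"
  shows "bil (sasaki g c w) (J2_hat g J c w *v A) (J2_hat g J c w *v B) = - bil (sasaki g c w) A B"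
proof -
  obtain X Y where A: "A = horiz (g c) w X + vert Y" by (rule lift_cases)
  obtain X' Y' where B: "B = horiz (g c) w X' + vert Y'" by (rule lift_cases)
  show ?thesis
    unfolding A B J2_hat_lift_sum bil_sasaki_lifts by (simp add: J_skew[OF assms])
qed

lemma J3_hat_skew:
  assumes "xpart w \<in> S"
  shows "bil (sasaki g c w) (J3_hat g J c w *v A) (J3_hat g J c w *v B) = - bil (sasaki g c w) A B"
proof -
  obtain X Y where A: "A = horiz (g c) w X + vert Y" by (rule lift_cases)
  obtain X' Y' where B: "B = horiz (g c) w X' + vert Y'" by (rule lift_cases)
  show ?thesis
    unfolding A B J3_hat_lift_sum bil_sasaki_lifts by (simp add: J_skew[OF assms])
qed

end

lemma signature_invertible:
  fixes G :: "real^'d^'d::finite"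
  assumes "has_signature p q G"
  shows "invertible G"
proof -
  obtain P :: "real^'d^'d" and S where P: "transpose P ** G ** P
      = (\<chi> i j. if i = j then (if i \<in> S then 1 else - 1) else 0)" (is "_ = ?D")
    using assms unfolding has_signature_def by blast
  have "det ?D = (\<Prod>i\<in>UNIV. ?D $ i $ i)"
    by (rule det_diagonal) simp
  also have "\<dots> \<noteq> 0" by simp
  finally have "det (transpose P ** G ** P) \<noteq> 0"
    unfolding P .
  then show ?thesis
    by (simp add: invertible_det_nz det_mul)
qed

lemma part_axis [simp]:
  "xpart (axis (Inl i) 1) = axis i 1" "xpart (axis (Inr i) 1) = 0"
  "ypart (axis (Inl i) 1) = 0" "ypart (axis (Inr i) 1) = axis i 1"
  by (simp_all add: xpart_def ypart_def axis_def vec_eq_iff)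

text \<open>The lifts of a pseudo-orthonormal frame are pseudo-orthonormal, and every sign occurs twice.\<close>

lemma sasaki_signature:
  fixes g :: "('c, 'd::finite) tensor"
  assumes "has_signature p q (g c (xpart w))"
  shows "has_signature (2 * p) (2 * q) (sasaki g c w)"
proof -
  let ?x = "xpart w"
  obtain P :: "real^'d^'d" and S where "invertible P" and S: "card S = p" "card (- S) = q"
    and D: "transpose P ** g c ?x ** P = (\<chi> i j. if i = j then (if i \<in> S then 1 else - 1) else 0)"
    using assms unfolding has_signature_def by blast
  (* The columns of Q are the lifts of the columns of P. *)
  define Q where "Q = matrix (\<lambda>A. horiz (g c) w (P *v xpart A) + vert (P *v ypart A))"
  have Q: "Q *v A = horiz (g c) w (P *v xpart A) + vert (P *v ypart A)" for A
  proof -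
    have "linear (\<lambda>A. horiz (g c) w (P *v xpart A) + vert (P *v ypart A))"
      by (auto intro!: linearI simp: lift_linear matrix_vector_right_distrib matrix_vector_mult_scaleR algebra_simps)
    then show ?thesis unfolding Q_def
      by (rule matrix_works[OF iffD2[OF linear_matrix_vector_mul_eq]])
  qed
  have "inj ((*v) Q)"
  proof (rule injI)
    fix A B assume "Q *v A = Q *v B"
    then have "P *v xpart A = P *v xpart B" "P *v ypart A = P *v ypart B"
      unfolding Q lift_eq_iff by auto
    moreover have "inj ((*v) P)"
      using \<open>invertible P\<close> by (simp add: invertible_left_inverse matrix_left_invertible_injective)
    ultimately have "xpart A = xpart B" "ypart A = ypart B"
      by (auto dest: injD)
    then show "A = B" by (metis join_simps(3))
  qed
  then have "invertible Q"
    by (simp add: invertible_left_inverse matrix_left_invertible_injective)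
  moreover define S' where "S' = Inl ` S \<union> Inr ` S"
  have compl: "- S' = Inl ` (- S) \<union> Inr ` (- S)"
  proof (intro set_eqI)
    show "k \<in> - S' \<longleftrightarrow> k \<in> Inl ` (- S) \<union> Inr ` (- S)" for k
      by (cases k) (auto simp: S'_def)
  qed
  have card: "card (Inl ` T \<union> Inr ` T :: ('d + 'd) set) = 2 * card T" for T :: "'d set"
    by (subst card_Un_disjoint) (auto simp: card_image inj_on_def)
  have "card S' = 2 * p" "card (- S') = 2 * q"
    unfolding compl unfolding S'_def by (simp_all add: card S)
  moreover have "transpose Q ** sasaki g c w ** Q
      = (\<chi> i j. if i = j then (if i \<in> S' then 1 else - 1) else 0)"
  proof -
    have D': "bil (g c ?x) (P *v axis i 1) (P *v axis j 1) = (if i = j then (if i \<in> S then 1 else - 1) else 0)" for i j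
      using arg_cong[OF D, of "\<lambda>G. G $ i $ j"] by (simp flip: bil_axis add: bil_transpose_mult)
    have "bil (sasaki g c w) (Q *v axis a 1) (Q *v axis b 1)
        = (if a = b then (if a \<in> S' then 1 else - 1) else 0)" for a b
      unfolding Q bil_sasaki_lifts by (cases a; cases b) (auto simp: D' S'_def)
    then show ?thesis
      by (simp add: vec_eq_iff bil_transpose_mult flip: bil_axis[of "transpose Q ** _ ** Q"])
  qed
  ultimately show ?thesis
    unfolding has_signature_def by blast
qed


section \<open>The lifted structures are tensor fields\<close>

locale skew_hermitian_manifold =
  fixes n :: nat and M :: "('p, 'c, 'd::finite) atlas" and J g gt :: "('c, 'd) tensor"
  assumes skew_hermitian: "almost_skew_hermitian n M J g gt"

sublocale skew_hermitian_manifold \<subseteq> smooth_atlas M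
  using skew_hermitian by (simp add: almost_skew_hermitian_def smooth_manifold_iff)

context skew_hermitian_manifold
begin

lemma metric:
  "pseudo_riemannian_metric n n M g" and acs: "almost_complex_structure M J"
  using skew_hermitian by (simp_all add: almost_skew_hermitian_def)

lemma signature: "c \<in> charts M \<Longrightarrow> x \<in> cimg M c \<Longrightarrow> has_signature n n (g c x)"
  using metric unfolding pseudo_riemannian_metric_def by blast

lemma chart: 
  assumes c: "c \<in> charts M"
  shows "skew_hermitian_chart g c (cimg M c) J"
proof
  show "open (cimg M c)" by (rule open_cimg[OF c])
  show "smooth_matrix_on (cimg M c) (g c)" "smooth_matrix_on (cimg M c) (J c)"
    using metric acs c unfolding pseudo_riemannian_metric_def almost_complex_structure_def
      tensor_field_02_def tensor_field_11_def smooth_components_def smooth_matrix_on_def by blast+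
  fix x assume x: "x \<in> cimg M c"
  show "transpose (g c x) = g c x" "J c x ** J c x = - mat 1"
    using metric acs c x unfolding pseudo_riemannian_metric_def almost_complex_structure_def by blast+
  show "invertible (g c x)"
    by (rule signature_invertible[OF signature[OF c x]])
  show "bil (g c x) (J c x *v X) (J c x *v Y) = - bil (g c x) X Y" for X Y
    using skew_hermitian c x unfolding almost_skew_hermitian_def by blast
qed

lemma overlap_subset: "overlap c c' \<subseteq> cimg M c"
  by (auto simp: cimg_def)

lemma metric_transform:
  assumes "c \<in> charts M" "c' \<in> charts M" "p \<in> cdom M c" "p \<in> cdom M c'"
  shows "g c (cmap M c p)
    = transpose (jac c c' (cmap M c p)) ** g c' (cmap M c' p) ** jac c c' (cmap M c p)"
  using metric assms unfolding pseudo_riemannian_metric_def tensor_field_02_def Let_def by blast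

lemma J_transform:
  assumes "c \<in> charts M" "c' \<in> charts M" "p \<in> cdom M c" "p \<in> cdom M c'"
  shows "jac c c' (cmap M c p) *v (J c (cmap M c p) *v X)
    = J c' (cmap M c' p) *v (jac c c' (cmap M c p) *v X)"
proof -
  have "jac c c' (cmap M c p) ** J c (cmap M c p) = J c' (cmap M c' p) ** jac c c' (cmap M c p)"
    using acs assms unfolding almost_complex_structure_def tensor_field_11_def Let_def by blast
  then show ?thesis by (simp add: matrix_vector_mul_assoc)
qed

lemma christoffel_transform:
  assumes c: "c \<in> charts M" "c' \<in> charts M" and p: "p \<in> cdom M c" "p \<in> cdom M c'"
  defines "x \<equiv> cmap M c p"
  shows "jac c c' x *v gamma (g c) x X Y
    = dmatrix (jac c c') x X *v Y + gamma (g c') (cmap M c' p) (jac c c' x *v X) (jac c c' x *v Y)"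
proof -
  interpret A: skew_hermitian_chart g c "cimg M c" J by (rule chart[OF c(1)])
  interpret B: skew_hermitian_chart g c' "cimg M c'" J by (rule chart[OF c(2)])
  have "jac c c' x *v gamma (g c) x X Y
    = dmatrix (jac c c') x X *v Y
      + gamma (g c') (transition M c c' x) (jac c c' x *v X) (jac c c' x *v Y)"
  proof (rule gamma_transform[OF A.metric_chart_axioms B.metric_chart_axioms open_overlap[OF c] overlap_subset])
    show "smooth_map_on (overlap c c') (transition M c c')"
      using smooth_transition[OF c] by (simp add: smooth_map_on_def)
    show "transition M c c' ` overlap c c' \<subseteq> cimg M c'"
      using c by (auto simp: cimg_def)
    show "smooth_matrix_on (overlap c c') (jac c c')"
      by (rule smooth_jac[OF c])
    show "(transition M c c' has_derivative (*v) (jac c c' x)) (at x)" if "x \<in> overlap c c'" for x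
      by (rule transition_has_derivative[OF c that])
    show "g c x = transpose (jac c c' x) ** g c' (transition M c c' x) ** jac c c' x"
      if "x \<in> overlap c c'" for x
    proof -
      from that obtain q where "q \<in> cdom M c" "q \<in> cdom M c'" "x = cmap M c q" by auto
      then show ?thesis using metric_transform[OF c, of q] c by simp
    qed
    show "x \<in> overlap c c'" using p by (auto simp: x_def)
  qed
  then show ?thesis
    using c p by (simp add: x_def)
qed

text \<open>The Jacobian of a change of charts of the tangent bundle contains a second derivative of the change of
  charts of the base; the inhomogeneous term of \<open>christoffel_transform\<close> cancels it, so that lifts are mapped
  to lifts.\<close>

lemma lift_transform:
  assumes c: "c \<in> charts M" "c' \<in> charts M" and p: "p \<in> cdom M c" "p \<in> cdom M c'"
    and v: "v \<in> tangent_space M p"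
  defines "w \<equiv> join (cmap M c p) (v c)" and "w' \<equiv> join (cmap M c' p) (v c')"
    and "A \<equiv> jac c c' (cmap M c p)"
  shows "jacobian (transition TM c c') (at w) *v (horiz (g c) w X + vert Y)
    = horiz (g c') w' (A *v X) + vert (A *v Y)"
proof -
  interpret B: skew_hermitian_chart g c' "cimg M c'" J by (rule chart[OF c(2)])
  let ?x = "cmap M c p" and ?x' = "cmap M c' p"
  let ?U = "{w. xpart w \<in> overlap c c'}"
  have x: "?x \<in> overlap c c'" "?x' \<in> cimg M c'" using p by (auto simp: cimg_def)
  have U: "open ?U" by (rule open_xpart_vimage[OF open_overlap[OF c]])
  have w: "xpart w = ?x" "ypart w = v c" "w \<in> ?U" "xpart w' = ?x'" "ypart w' = A *v v c"
    using x tangent_space_transform[OF v c(1) p(1) c(2) p(2)] by (simp_all add: w_def w'_def A_def)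
  have "(\<lambda>z. jac c c' z $ i $ j) differentiable (at (xpart w))" for i j
    using smooth_jac[OF c] open_overlap[OF c] x w
    by (intro smooth_on_differentiable) (auto simp: smooth_matrix_on_def)
  note dA = has_derivative_matrix_vector[of "jac c c'" xpart, OF this has_derivative_parts]
  have "(transition M c c' has_derivative (*v) A) (at (xpart w))"
    unfolding w(1) A_def by (rule transition_has_derivative[OF c x(1)])
  note dt = has_derivative_compose[OF has_derivative_parts(1) this]
  have "(transition TM c c' has_derivative
      (\<lambda>B. join (A *v hcomp B) (dmatrix (jac c c') ?x (hcomp B) *v v c + A *v ypart B))) (at w)"
    by (rule has_derivative_transform_within_open[OF has_derivative_join[OF dt dA, unfolded w(1,2), folded A_def] U w(3)])
      (simp add: transition_TM[OF c])
  from jacobian_apply[OF this, of "horiz (g c) w X + vert Y"]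
  have "jacobian (transition TM c c') (at w) *v (horiz (g c) w X + vert Y)
      = join (A *v X) (dmatrix (jac c c') ?x X *v v c + A *v (Y - gamma (g c) ?x (v c) X))"
    by (simp add: hcomp_def lift_eq_join w)
  also have "gamma (g c) ?x (v c) X = gamma (g c) ?x X (v c)"
  proof -
    interpret C: skew_hermitian_chart g c "cimg M c" J by (rule chart[OF c(1)])
    show ?thesis using x overlap_subset by (intro C.gamma_sym) auto
  qed
  also have "dmatrix (jac c c') ?x X *v v c + A *v (Y - gamma (g c) ?x X (v c))
      = A *v Y - gamma (g c') ?x' (A *v X) (A *v v c)"
    unfolding matrix_vector_mult_diff_distrib A_def christoffel_transform[OF c p] by simp
  also have "gamma (g c') ?x' (A *v X) (A *v v c) = gamma (g c') ?x' (A *v v c) (A *v X)"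
    by (rule B.gamma_sym[OF x(2)])
  finally show ?thesis
    by (simp add: lift_eq_join w)
qed

lemma tensor_field_02_TM:
  assumes "\<And>c. c \<in> charts M \<Longrightarrow> smooth_matrix_on {w. xpart w \<in> cimg M c} (T c)"
    and "\<And>c c' p v. c \<in> charts M \<Longrightarrow> c' \<in> charts M \<Longrightarrow> p \<in> cdom M c \<Longrightarrow> p \<in> cdom M c' \<Longrightarrow>
      v \<in> tangent_space M p \<Longrightarrow>
      (let w = join (cmap M c p) (v c); A = jacobian (transition TM c c') (at w)
       in T c w = transpose A ** T c' (join (cmap M c' p) (v c')) ** A)"
  shows "tensor_field_02 TM T"
  unfolding tensor_field_02_def
proof (intro conjI ballI)
  show "smooth_components TM T"
    using assms(1) by (simp add: smooth_components_def smooth_matrix_on_def cimg_TM)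
  fix c c' a assume "c \<in> charts TM" "c' \<in> charts TM" "a \<in> cdom TM c \<inter> cdom TM c'"
  then show "let A = jacobian (transition TM c c') (at (cmap TM c a))
      in T c (cmap TM c a) = transpose A ** T c' (cmap TM c' a) ** A"
    using assms(2)[of c c' "fst a" "snd a"] by (cases a) (simp add: Let_def)
qed

lemma tensor_field_11_TM:
  assumes "\<And>c. c \<in> charts M \<Longrightarrow> smooth_matrix_on {w. xpart w \<in> cimg M c} (T c)"
    and "\<And>c c' p v. c \<in> charts M \<Longrightarrow> c' \<in> charts M \<Longrightarrow> p \<in> cdom M c \<Longrightarrow> p \<in> cdom M c' \<Longrightarrow>
      v \<in> tangent_space M p \<Longrightarrow>
      (let w = join (cmap M c p) (v c); A = jacobian (transition TM c c') (at w)
       in A ** T c w = T c' (join (cmap M c' p) (v c')) ** A)"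
  shows "tensor_field_11 TM T"
  unfolding tensor_field_11_def
proof (intro conjI ballI)
  show "smooth_components TM T"
    using assms(1) by (simp add: smooth_components_def smooth_matrix_on_def cimg_TM)
  fix c c' a assume "c \<in> charts TM" "c' \<in> charts TM" "a \<in> cdom TM c \<inter> cdom TM c'"
  then show "let A = jacobian (transition TM c c') (at (cmap TM c a))
      in A ** T c (cmap TM c a) = T c' (cmap TM c' a) ** A"
    using assms(2)[of c c' "fst a" "snd a"] by (cases a) (simp add: Let_def)
qed

text \<open>In the frame of lifts the matrix of the Sasaki metric consists of two copies of that of \<open>g\<close>.\<close>

lemma sasaki_tensor: "tensor_field_02 TM (sasaki g)"
proof (rule tensor_field_02_TM, goal_cases)
  case (1 c)
  interpret skew_hermitian_chart g c "cimg M c" J by (rule chart[OF 1])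
  show ?case by (rule smooth_sasaki)
next
  case (2 c c' p v)
  show ?case
    unfolding Let_def
  proof (rule bil_eqI)
    fix X Y
    let ?w = "join (cmap M c p) (v c)"
    obtain A B where X: "X = horiz (g c) ?w A + vert B" by (rule lift_cases)
    obtain A' B' where Y: "Y = horiz (g c) ?w A' + vert B'" by (rule lift_cases)
    show "bil (sasaki g c ?w) X Y = bil (transpose (jacobian (transition TM c c') (at ?w)) **
        sasaki g c' (join (cmap M c' p) (v c')) ** jacobian (transition TM c c') (at ?w)) X Y"
      unfolding X Y bil_transpose_mult lift_transform[OF 2] bil_sasaki_lifts join_simps
        metric_transform[OF 2(1-4)] ..
  qed
qed

lemma J1_hat_tensor: "tensor_field_11 TM (J1_hat g)"
proof (rule tensor_field_11_TM, goal_cases)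
  case (1 c)
  interpret skew_hermitian_chart g c "cimg M c" J by (rule chart[OF 1])
  show ?case by (rule smooth_J1_hat)
next
  case (2 c c' p v)
  show ?case
    unfolding Let_def
  proof (rule matrix_eqI)
    fix X
    let ?w = "join (cmap M c p) (v c)"
    obtain A B where X: "X = horiz (g c) ?w A + vert B" by (rule lift_cases)
    show "(jacobian (transition TM c c') (at ?w) ** J1_hat g c ?w) *v X
        = (J1_hat g c' (join (cmap M c' p) (v c')) ** jacobian (transition TM c c') (at ?w)) *v X"
      unfolding X matrix_vector_mul_assoc[symmetric] lift_transform[OF 2] J1_hat_lift_sum
        matrix_vector_mult_minus ..
  qed
qed

lemma J2_hat_tensor: "tensor_field_11 TM (J2_hat g J)"
proof (rule tensor_field_11_TM, goal_cases)
  case (1 c)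
  interpret skew_hermitian_chart g c "cimg M c" J by (rule chart[OF 1])
  show ?case by (rule smooth_J2_hat)
next
  case (2 c c' p v)
  show ?case
    unfolding Let_def
  proof (rule matrix_eqI)
    fix X
    let ?w = "join (cmap M c p) (v c)"
    obtain A B where X: "X = horiz (g c) ?w A + vert B" by (rule lift_cases)
    show "(jacobian (transition TM c c') (at ?w) ** J2_hat g J c ?w) *v X
        = (J2_hat g J c' (join (cmap M c' p) (v c')) ** jacobian (transition TM c c') (at ?w)) *v X"
      unfolding X matrix_vector_mul_assoc[symmetric] lift_transform[OF 2] J2_hat_lift_sum join_simps
        J_transform[OF 2(1-4)] ..
  qed
qed

lemma J3_hat_tensor: "tensor_field_11 TM (J3_hat g J)"
proof (rule tensor_field_11_TM, goal_cases)
  case (1 c)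
  interpret skew_hermitian_chart g c "cimg M c" J by (rule chart[OF 1])
  show ?case by (rule smooth_J3_hat)
next
  case (2 c c' p v)
  show ?case
    unfolding Let_def
  proof (rule matrix_eqI)
    fix X
    let ?w = "join (cmap M c p) (v c)"
    obtain A B where X: "X = horiz (g c) ?w A + vert B" by (rule lift_cases)
    show "(jacobian (transition TM c c') (at ?w) ** J3_hat g J c ?w) *v X
        = (J3_hat g J c' (join (cmap M c' p) (v c')) ** jacobian (transition TM c c') (at ?w)) *v X"
      unfolding X matrix_vector_mul_assoc[symmetric] lift_transform[OF 2] J3_hat_lift_sum join_simps
        matrix_vector_mult_minus J_transform[OF 2(1-4)] ..
  qed
qed


section \<open>The classes of the tangent bundle\<close>

lemma smooth_manifold_TM: "smooth_manifold TM"
  by (rule smooth_manifold_tangent_bundle) (use skew_hermitian in \<open>simp add: almost_skew_hermitian_def\<close>)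

lemma dimension_TM: "CARD('d + 'd) = 2 * (2 * n)"
  using skew_hermitian by (simp add: almost_skew_hermitian_def)

lemma TM_chart_cases:
  assumes "c \<in> charts TM" "w \<in> cimg TM c"
  shows "c \<in> charts M" "xpart w \<in> cimg M c"
  using assms by (auto simp: cimg_TM)

lemma sasaki_metric: "pseudo_riemannian_metric (2 * n) (2 * n) TM (sasaki g)"
  unfolding pseudo_riemannian_metric_def
proof (intro conjI ballI)
  fix c w assume "c \<in> charts TM" "w \<in> cimg TM c"
  then have c: "c \<in> charts M" and w: "xpart w \<in> cimg M c" by (rule TM_chart_cases)+
  interpret skew_hermitian_chart g c "cimg M c" J by (rule chart[OF c])
  show "transpose (sasaki g c w) = sasaki g c w"
    by (rule sasaki_symmetric[of g c w, OF sym[OF w]])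
  show "has_signature (2 * n) (2 * n) (sasaki g c w)"
    by (rule sasaki_signature[of n n g c w, OF signature[OF c w]])
qed (rule sasaki_tensor)

lemma J1_hat_hermitian:
  "almost_pseudo_hermitian (2 * n) TM (J1_hat g) (sasaki g) (Phi_hat g)"
  unfolding almost_pseudo_hermitian_def almost_complex_structure_def
  by (simp add: smooth_manifold_TM dimension_TM sasaki_metric J1_hat_tensor J1_hat_square J1_hat_isometry
      Phi_hat_def lower_apply del: TM_simps card_sum)

lemma J2_hat_skew_hermitian:
  "almost_skew_hermitian (2 * n) TM (J2_hat g J) (sasaki g) (g2_hat g J)"
  unfolding almost_skew_hermitian_def almost_complex_structure_def
proof (intro conjI ballI allI)
  fix c w assume "c \<in> charts TM" "w \<in> cimg TM c"
  then have c: "c \<in> charts M" and w: "xpart w \<in> cimg M c" by (rule TM_chart_cases)+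
  interpret skew_hermitian_chart g c "cimg M c" J by (rule chart[OF c])
  show "J2_hat g J c w ** J2_hat g J c w = - mat 1"
    by (rule J2_hat_square[OF w])
  fix X Y
  show "bil (sasaki g c w) (J2_hat g J c w *v X) (J2_hat g J c w *v Y) = - bil (sasaki g c w) X Y"
    by (rule J2_hat_skew[OF w])
  show "bil (g2_hat g J c w) X Y = bil (sasaki g c w) X (J2_hat g J c w *v Y)"
    unfolding g2_hat_def lower_apply by (rule skew_selfadjoint[OF J2_hat_square[OF w] J2_hat_skew[OF w]])
qed (rule smooth_manifold_TM dimension_TM J2_hat_tensor sasaki_metric)+

lemma J3_hat_skew_hermitian:
  "almost_skew_hermitian (2 * n) TM (J3_hat g J) (sasaki g) (g3_hat g J)"
  unfolding almost_skew_hermitian_def almost_complex_structure_def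
proof (intro conjI ballI allI)
  fix c w assume "c \<in> charts TM" "w \<in> cimg TM c"
  then have c: "c \<in> charts M" and w: "xpart w \<in> cimg M c" by (rule TM_chart_cases)+
  interpret skew_hermitian_chart g c "cimg M c" J by (rule chart[OF c])
  show "J3_hat g J c w ** J3_hat g J c w = - mat 1"
    by (rule J3_hat_square[OF w])
  fix X Y
  show "bil (sasaki g c w) (J3_hat g J c w *v X) (J3_hat g J c w *v Y) = - bil (sasaki g c w) X Y"
    by (rule J3_hat_skew[OF w])
  show "bil (g3_hat g J c w) X Y = bil (sasaki g c w) X (J3_hat g J c w *v Y)"
    unfolding g3_hat_def lower_apply by (rule skew_selfadjoint[OF J3_hat_square[OF w] J3_hat_skew[OF w]])
qed (rule smooth_manifold_TM dimension_TM J3_hat_tensor sasaki_metric)+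

theorem J1_hat_almost_kahler: "class_AK (2 * n) TM (J1_hat g) (sasaki g) (Phi_hat g)"
  unfolding class_AK_def
proof (intro conjI ballI allI)
  fix c w Z assume "c \<in> charts TM" "w \<in> cimg TM c"
  note c = TM_chart_cases[OF this]
  interpret skew_hermitian_chart g c "cimg M c" J by (rule chart[OF c(1)])
  show "lie_form (sasaki g c) (J1_hat g c) w Z = 0"
    by (rule lie_form_J1_hat[OF c(2)])
qed (rule J1_hat_hermitian)

theorem J1_hat_kahler:
  assumes "flat M g"
  shows "class_K (2 * n) TM (J1_hat g) (sasaki g) (Phi_hat g)"
  unfolding class_K_def
proof (intro conjI ballI allI)
  fix c w X Y Z assume "c \<in> charts TM" "w \<in> cimg TM c"
  note c = TM_chart_cases[OF this]
  interpret skew_hermitian_chart g c "cimg M c" J by (rule chart[OF c(1)])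
  have "curv (g c) (xpart w) A B C = 0" for A B C
    using curv_eq_0[OF metric_chart_axioms c(2)] assms c unfolding flat_def by blast
  then show "fundamental_F (sasaki g c) (J1_hat g c) w X Y Z = 0"
    by (simp add: fundamental_F_def nabla_J1_hat[OF c(2)] lift_linear)
qed (rule J1_hat_hermitian)

theorem J2_hat_W23:
  assumes "class_W23 n M J g gt" "assoc_ricci_flat M g J"
  shows "class_W23 (2 * n) TM (J2_hat g J) (sasaki g) (g2_hat g J)"
  unfolding class_W23_def
proof (intro conjI ballI allI)
  fix c w Z assume "c \<in> charts TM" "w \<in> cimg TM c"
  note c = TM_chart_cases[OF this]
  interpret skew_hermitian_chart g c "cimg M c" J by (rule chart[OF c(1)])
  show "lie_form (sasaki g c) (J2_hat g J c) w Z = 0"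
    using assms c unfolding lie_form_J2_hat[OF c(2)] class_W23_def assoc_ricci_flat_def by simp
qed (rule J2_hat_skew_hermitian)

theorem J3_hat_W23:
  assumes "class_W23 n M J g gt"
  shows "class_W23 (2 * n) TM (J3_hat g J) (sasaki g) (g3_hat g J)"
  unfolding class_W23_def
proof (intro conjI ballI allI)
  fix c w Z assume "c \<in> charts TM" "w \<in> cimg TM c"
  note c = TM_chart_cases[OF this]
  interpret skew_hermitian_chart g c "cimg M c" J by (rule chart[OF c(1)])
  show "lie_form (sasaki g c) (J3_hat g J c) w Z = 0"
    using assms c unfolding lie_form_J3_hat[OF c(2)] class_W23_def by simp
qed (rule J3_hat_skew_hermitian)

lemma flat_imp_assoc_ricci_flat: "flat M g \<Longrightarrow> assoc_ricci_flat M g J"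
  by (simp add: flat_def assoc_ricci_flat_def assoc_ricci_def metric_trace_def)

end

theorem proposition3p17:
  fixes M :: "('p, 'c, 'd::finite) atlas"
    and J g gt :: "('c, 'd) tensor"
    and n :: nat
  assumes "almost_skew_hermitian n M J g gt"
  shows
    "(class_W23 n M J g gt \<longrightarrow>
        class_AK (2 * n) (tangent_bundle M) (J1_hat g) (sasaki g) (Phi_hat g) \<and>
        class_W123 (2 * n) (tangent_bundle M) (J2_hat g J) (sasaki g) (g2_hat g J) \<and>
        class_W23 (2 * n) (tangent_bundle M) (J3_hat g J) (sasaki g) (g3_hat g J))
   \<and> (class_W23 n M J g gt \<and> ricci_flat M g \<and> assoc_ricci_flat M g J \<longrightarrow>
        class_AK (2 * n) (tangent_bundle M) (J1_hat g) (sasaki g) (Phi_hat g) \<and>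
        class_W23 (2 * n) (tangent_bundle M) (J2_hat g J) (sasaki g) (g2_hat g J) \<and>
        class_W23 (2 * n) (tangent_bundle M) (J3_hat g J) (sasaki g) (g3_hat g J))
   \<and> (class_W23 n M J g gt \<and> flat M g \<longrightarrow>
        class_K (2 * n) (tangent_bundle M) (J1_hat g) (sasaki g) (Phi_hat g) \<and>
        class_W23 (2 * n) (tangent_bundle M) (J2_hat g J) (sasaki g) (g2_hat g J) \<and>
        class_W23 (2 * n) (tangent_bundle M) (J3_hat g J) (sasaki g) (g3_hat g J))"
proof -
  interpret skew_hermitian_manifold n M J g gt by unfold_locales (rule assms)
  show ?thesis
    using J1_hat_almost_kahler J1_hat_kahler J2_hat_W23 J3_hat_W23 J2_hat_skew_hermitian
      flat_imp_assoc_ricci_flat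
    unfolding class_W123_def by blast
qed

end
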